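(* Let $K$ be an algebraically closed field. The three functions $\deg_z$, $\deg_\pi$ and $\deg_{\rm lci}$ on constructible sets are sub-additive: for any two constructible subsets $C,C'\subseteq\mathbb{A}^n(K)$, $$\deg_z(C\cup C')\le\deg_z(C)+\deg_z(C'),$$ $$\deg_\pi(C\cup C')\le\deg_\pi(C)+\deg_\pi(C'),$$ $$\deg_{\rm lci}(C\cup C')\le\deg_{\rm lci}(C)+\deg_{\rm lci}(C').$$
   Context: $\mathbb{A}^n=\mathbb{A}^n(K)=K^n$ carries the Zariski topology. A locally closed set is the intersection of an open and a closed set; it is irreducible if it is a non-empty open subset of an irreducible closed variety. A constructible set is a finite union of locally closed sets. Degree of locally closed sets: for an irreducible locally closed $V\subseteq\mathbb{A}^n$ of dimension $r$, $\deg(V):=\max\{\sharp(A\cap V): A \text{ an affine linear subvariety of codimension } r,\ \sharp(A\cap V)<\infty\}$; for a general locally closed $W$, $\deg(W)$ is the sum of the degrees of its irreducible components (equivalently $\deg(W)=\deg(\overline{W}^z)$, with $\overline{W}^z$ the Zariski closure). The empty set has degree $0$. For a constructible $C\subseteq\mathbb{A}^n$: $\deg_z(C):=\deg(\overline{C}^z)$. $\deg_{\rm lci}(C)$ is the minimum of $\sum_{i}\deg(V_i)$ over all finite decompositions $C=(U_1\cap V_1)\cup\cdots\cup(U_t\cap V_t)$ into irreducible (non-empty) locally closed sets where the $V_i$ are pairwise distinct irreducible closed varieties and $U_i$ is the largest Zariski open set $O\subseteq\mathbb{A}^n$ with $O\cap V_i\subseteq C$. $\deg_\pi(C)$ is the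 minimum of $\deg(V)$ over all $m\ge n$ and all locally closed $V\subseteq\mathbb{A}^m$ with $\pi(V)=C$, where $\pi:\mathbb{A}^m\to\mathbb{A}^n$ is the canonical projection. *)

theory Defs
  imports
    "HOL-Analysis.Abstract_Topology"
    "HOL-Library.Poly_Mapping"
    "HOL-Library.Function_Algebras"
    "HOL-Computational_Algebra.Polynomial"
begin

section \<open>Irreducibility, dimension and constructibility in a topological space\<close>

definition irreducible_closed :: "'p topology \<Rightarrow> 'p set \<Rightarrow> bool" where
  "irreducible_closed X V \<longleftrightarrow> closedin X V \<and> V \<noteq> {} \<and>
     (\<forall>A B. closedin X A \<longrightarrow> closedin X B \<longrightarrow> V = A \<union> B \<longrightarrow> V = A \<or> V = B)"

definition locally_closed :: "'p topology \<Rightarrow> 'p set \<Rightarrow> bool" where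
  "locally_closed X S \<longleftrightarrow> (\<exists>U V. openin X U \<and> closedin X V \<and> S = U \<inter> V)"

definition irreducible_locally_closed :: "'p topology \<Rightarrow> 'p set \<Rightarrow> bool" where
  "irreducible_locally_closed X S \<longleftrightarrow>
     S \<noteq> {} \<and> (\<exists>V. irreducible_closed X V \<and> openin (subtopology X V) S)"

definition constructible :: "'p topology \<Rightarrow> 'p set \<Rightarrow> bool" where
  "constructible X C \<longleftrightarrow> (\<exists>F. finite F \<and> (\<forall>S\<in>F. locally_closed X S) \<and> C = \<Union>F)"

text \<open>Used for locally closed \<open>W\<close>.  A maximal irreducible subspace of \<open>W\<close> is closed in \<open>W\<close>, hence
  again locally closed, so maximality among irreducible locally closed sets is no restriction.\<close>

definition irreducible_components :: "'p topology \<Rightarrow> 'p set \<Rightarrow> 'p set set" where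
  "irreducible_components X W = {Z. irreducible_locally_closed X Z \<and> Z \<subseteq> W \<and>
     (\<forall>Z'. irreducible_locally_closed X Z' \<and> Z \<subseteq> Z' \<and> Z' \<subseteq> W \<longrightarrow> Z' = Z)}"

text \<open>Krull dimension.  It is a genuine supremum only if the lengths of the chains are bounded,
  as they are (by \<open>n\<close>) for the subspaces of affine \<open>n\<close>-space.\<close>

definition krull_dim :: "'p topology \<Rightarrow> nat" where
  "krull_dim X = Sup {d. \<exists>Z. (\<forall>i\<le>d. irreducible_closed X (Z i)) \<and> (\<forall>i<d. Z i \<subset> Z (Suc i))}"


section \<open>Affine space and its Zariski topology\<close>

text \<open>Points of \<open>K\<^sup>n\<close> are the functions \<open>nat \<Rightarrow> K\<close> that vanish outside \<open>{..<n}\<close>, so that all the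
  \<open>K\<^sup>n\<close> are linear subspaces of one vector space and \<open>n\<close> can be quantified over.\<close>

definition affine_space :: "nat \<Rightarrow> (nat \<Rightarrow> 'a::field) set" where
  "affine_space n = {x. \<forall>i\<ge>n. x i = 0}"

definition canonical_proj :: "nat \<Rightarrow> (nat \<Rightarrow> 'a::field) \<Rightarrow> nat \<Rightarrow> 'a" where
  "canonical_proj n x = (\<lambda>i. if i < n then x i else 0)"

text \<open>Polynomials in \<open>X\<^sub>0, \<dots>, X\<^bsub>n-1\<^esub>\<close>: finitely supported families of coefficients, indexed by
  exponent vectors supported in \<open>{..<n}\<close>.\<close>

definition polys :: "nat \<Rightarrow> ((nat \<Rightarrow>\<^sub>0 nat) \<Rightarrow>\<^sub>0 'a::field) set" where
  "polys n = {p. \<forall>m\<in>Poly_Mapping.keys p. Poly_Mapping.keys m \<subseteq> {..<n}}"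

definition eval_poly :: "nat \<Rightarrow> ((nat \<Rightarrow>\<^sub>0 nat) \<Rightarrow>\<^sub>0 'a::field) \<Rightarrow> (nat \<Rightarrow> 'a) \<Rightarrow> 'a" where
  "eval_poly n p x = (\<Sum>m\<in>Poly_Mapping.keys p. Poly_Mapping.lookup p m * (\<Prod>i<n. x i ^ Poly_Mapping.lookup m i))"

definition zero_set :: "nat \<Rightarrow> ((nat \<Rightarrow>\<^sub>0 nat) \<Rightarrow>\<^sub>0 'a::field) set \<Rightarrow> (nat \<Rightarrow> 'a) set" where
  "zero_set n F = {x \<in> affine_space n. \<forall>p\<in>F. eval_poly n p x = 0}"

definition zariski :: "nat \<Rightarrow> (nat \<Rightarrow> 'a::field) topology" where
  "zariski n = topology (\<lambda>U. \<exists>F\<subseteq>polys n. U = affine_space n - zero_set n F)"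

lemma eval_poly_superset:
  assumes "finite M" "Poly_Mapping.keys p \<subseteq> M"
  shows "eval_poly n p x = (\<Sum>m\<in>M. Poly_Mapping.lookup p m * (\<Prod>i<n. x i ^ Poly_Mapping.lookup m i))"
  unfolding eval_poly_def using assms by (intro sum.mono_neutral_left) (auto simp: in_keys_iff)

lemma eval_poly_add: "eval_poly n (p + q) x = eval_poly n p x + eval_poly n q x"
proof -
  let ?M = "Poly_Mapping.keys p \<union> Poly_Mapping.keys q"
  have "Poly_Mapping.keys (p + q) \<subseteq> ?M" by (rule Poly_Mapping.keys_add)
  then show ?thesis
    by (simp add: eval_poly_superset[where M = ?M] lookup_add distrib_right sum.distrib)
qed

lemma eval_poly_sum: "eval_poly n (sum f A) x = (\<Sum>a\<in>A. eval_poly n (f a) x)"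
  by (induction A rule: infinite_finite_induct) (auto simp: eval_poly_add, auto simp: eval_poly_def)

lemma eval_poly_single: "eval_poly n (Poly_Mapping.single m c) x = c * (\<Prod>i<n. x i ^ Poly_Mapping.lookup m i)"
  by (subst eval_poly_superset[where M = "{m}"]) auto

lemma eval_poly_mult: "eval_poly n (p * q) x = eval_poly n p x * eval_poly n q x"
proof -
  have expand: "r = (\<Sum>m\<in>Poly_Mapping.keys r. Poly_Mapping.single m (Poly_Mapping.lookup r m))"
    for r :: "(nat \<Rightarrow>\<^sub>0 nat) \<Rightarrow>\<^sub>0 'a"
    by (intro poly_mapping_eqI)
      (auto simp: lookup_sum lookup_single when_def in_keys_iff)
  have "p * q = (\<Sum>m\<in>Poly_Mapping.keys p. \<Sum>m'\<in>Poly_Mapping.keys q.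
      Poly_Mapping.single (m + m') (Poly_Mapping.lookup p m * Poly_Mapping.lookup q m'))"
    using arg_cong2[OF expand[of p] expand[of q], of "(*)"] by (simp only: sum_product mult_single)
  then show ?thesis
    unfolding eval_poly_def[of n p] eval_poly_def[of n q] sum_product
    by (simp only: eval_poly_sum eval_poly_single lookup_add power_add prod.distrib mult_ac)
qed

lemma polys_mult:
  assumes "p \<in> polys n" "q \<in> polys n"
  shows "p * q \<in> polys n"
  unfolding polys_def
proof (intro CollectI ballI)
  fix m assume "m \<in> Poly_Mapping.keys (p * q)"
  then obtain a b where ab: "m = a + b" "a \<in> Poly_Mapping.keys p" "b \<in> Poly_Mapping.keys q"
    using keys_mult[of p q] by blast
  have "Poly_Mapping.keys m \<subseteq> Poly_Mapping.keys a \<union> Poly_Mapping.keys b"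
    unfolding ab(1) by (rule Poly_Mapping.keys_add)
  with ab assms show "Poly_Mapping.keys m \<subseteq> {..<n}"
    unfolding polys_def by blast
qed

lemma istopology_zariski:
  "istopology (\<lambda>U. \<exists>F\<subseteq>polys n. U = affine_space n - zero_set n (F :: ((nat \<Rightarrow>\<^sub>0 nat) \<Rightarrow>\<^sub>0 'a::field) set))"
  unfolding istopology_def
proof (intro conjI allI impI)
  fix S T :: "(nat \<Rightarrow> 'a) set"
  assume "\<exists>F\<subseteq>polys n. S = affine_space n - zero_set n F" "\<exists>F\<subseteq>polys n. T = affine_space n - zero_set n F"
  then obtain F G where FG: "F \<subseteq> polys n" "G \<subseteq> polys n"
    and S: "S = affine_space n - zero_set n F" and T: "T = affine_space n - zero_set n G"
    by auto
  let ?H = "(\<lambda>(p, q). p * q) ` (F \<times> G)"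
  have "x \<in> zero_set n ?H \<longleftrightarrow> x \<in> zero_set n F \<or> x \<in> zero_set n G" for x
    by (simp add: zero_set_def eval_poly_mult) blast
  then have "S \<inter> T = affine_space n - zero_set n ?H"
    unfolding S T by blast
  moreover have "?H \<subseteq> polys n"
    using FG by (force intro: polys_mult)
  ultimately show "\<exists>F\<subseteq>polys n. S \<inter> T = affine_space n - zero_set n F"
    by blast
next
  fix \<U> :: "(nat \<Rightarrow> 'a) set set"
  assume "\<forall>U\<in>\<U>. \<exists>F\<subseteq>polys n. U = affine_space n - zero_set n F"
  then have "\<exists>F. \<forall>U\<in>\<U>. F U \<subseteq> polys n \<and> U = affine_space n - zero_set n (F U)"
    by (intro bchoice) simp
  then obtain F where F: "\<And>U. U \<in> \<U> \<Longrightarrow> F U \<subseteq> polys n"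
    and U: "\<And>U. U \<in> \<U> \<Longrightarrow> U = affine_space n - zero_set n (F U)"
    by blast
  let ?H = "\<Union>U\<in>\<U>. F U"
  have "x \<in> \<Union>\<U> \<longleftrightarrow> x \<in> affine_space n \<and> (\<exists>U\<in>\<U>. x \<notin> zero_set n (F U))" for x
    using U by blast
  then have "\<Union>\<U> = affine_space n - zero_set n ?H"
    by (auto simp: zero_set_def)
  moreover have "?H \<subseteq> polys n"
    using F by blast
  ultimately show "\<exists>F\<subseteq>polys n. \<Union>\<U> = affine_space n - zero_set n F"
    by blast
qed

lemma openin_zariski_iff:
  "openin (zariski n) U \<longleftrightarrow> (\<exists>F\<subseteq>polys n. U = affine_space n - zero_set n F)"
  unfolding zariski_def topology_inverse'[OF istopology_zariski] ..

lemma topspace_zariski [simp]: "topspace (zariski n) = (affine_space n :: (nat \<Rightarrow> 'a::field) set)"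
proof -
  have "Poly_Mapping.single 0 (1 :: 'a) \<in> polys n"
    by (simp add: polys_def)
  then have "openin (zariski n) (affine_space n :: (nat \<Rightarrow> 'a) set)"
    unfolding openin_zariski_iff
    by (intro exI[of _ "{Poly_Mapping.single 0 1}"]) (use eval_poly_single[of n 0 "1 :: 'a"] in \<open>auto simp: zero_set_def\<close>)
  then show ?thesis
    by (auto simp: topspace_def openin_zariski_iff)
qed

lemma closedin_zariski_iff: "closedin (zariski n) V \<longleftrightarrow> (\<exists>F\<subseteq>polys n. V = zero_set n F)"
proof -
  have sub: "zero_set n F \<subseteq> affine_space n" for F :: "((nat \<Rightarrow>\<^sub>0 nat) \<Rightarrow>\<^sub>0 'a) set"
    by (auto simp: zero_set_def)
  have "V = W" if "V \<subseteq> A" "W \<subseteq> A" "A - V = A - W" for V W A :: "(nat \<Rightarrow> 'a) set"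
    using that by blast
  then show ?thesis
    unfolding closedin_def openin_zariski_iff topspace_zariski using sub by metis
qed


section \<open>Degrees\<close>

global_interpretation fun_vs: vector_space "\<lambda>(c::'a::field) (x :: nat \<Rightarrow> 'a) i. c * x i"
  by unfold_locales (auto simp: fun_eq_iff algebra_simps)

text \<open>\<open>A\<close> is an affine linear subvariety of codimension \<open>r\<close> of \<open>K\<^sup>n\<close>, i.e. a coset of a linear
  subspace of dimension \<open>n - r\<close>.\<close>

definition affine_linear :: "nat \<Rightarrow> nat \<Rightarrow> (nat \<Rightarrow> 'a::field) set \<Rightarrow> bool" where
  "affine_linear n r A \<longleftrightarrow> (\<exists>a W. a \<in> affine_space n \<and> W \<subseteq> affine_space n \<and>
     fun_vs.subspace W \<and> fun_vs.dim W + r = n \<and> A = (\<lambda>w. a + w) ` W)"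

text \<open>For irreducible locally closed \<open>V\<close> over an algebraically closed field the set below is
  non-empty and bounded, so that the maximum exists.\<close>

definition deg_irreducible :: "nat \<Rightarrow> (nat \<Rightarrow> 'a::field) set \<Rightarrow> nat" where
  "deg_irreducible n V = Max {card (A \<inter> V) | A.
     affine_linear n (krull_dim (subtopology (zariski n) V)) A \<and> finite (A \<inter> V)}"

definition deg :: "nat \<Rightarrow> (nat \<Rightarrow> 'a::field) set \<Rightarrow> nat" where
  "deg n W = (\<Sum>V\<in>irreducible_components (zariski n) W. deg_irreducible n V)"

definition deg_z :: "nat \<Rightarrow> (nat \<Rightarrow> 'a::field) set \<Rightarrow> nat" where
  "deg_z n C = deg n (zariski n closure_of C)"

definition largest_open :: "nat \<Rightarrow> (nat \<Rightarrow> 'a::field) set \<Rightarrow> (nat \<Rightarrow> 'a) set \<Rightarrow> (nat \<Rightarrow> 'a) set" where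
  "largest_open n V C = \<Union>{U. openin (zariski n) U \<and> U \<inter> V \<subseteq> C}"

lemma largest_open:
  "openin (zariski n) (largest_open n V C)" "largest_open n V C \<inter> V \<subseteq> C"
  "openin (zariski n) U \<Longrightarrow> U \<inter> V \<subseteq> C \<Longrightarrow> U \<subseteq> largest_open n V C"
  by (auto simp: largest_open_def)

text \<open>The pairwise distinct closed varieties \<open>V\<^sub>1, \<dots>, V\<^sub>t\<close> of a decomposition form a finite set; the
  open sets are determined by them.\<close>

definition lci_decomposition :: "nat \<Rightarrow> (nat \<Rightarrow> 'a::field) set \<Rightarrow> (nat \<Rightarrow> 'a) set set \<Rightarrow> bool" where
  "lci_decomposition n C \<V> \<longleftrightarrow> finite \<V> \<and>
     (\<forall>V\<in>\<V>. irreducible_closed (zariski n) V \<and> largest_open n V C \<inter> V \<noteq> {}) \<and>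
     C = (\<Union>V\<in>\<V>. largest_open n V C \<inter> V)"

definition deg_lci :: "nat \<Rightarrow> (nat \<Rightarrow> 'a::field) set \<Rightarrow> nat" where
  "deg_lci n C = (LEAST d. \<exists>\<V>. lci_decomposition n C \<V> \<and> d = (\<Sum>V\<in>\<V>. deg n V))"

definition deg_pi :: "nat \<Rightarrow> (nat \<Rightarrow> 'a::field) set \<Rightarrow> nat" where
  "deg_pi n C = (LEAST d. \<exists>m V. n \<le> m \<and> locally_closed (zariski m) V \<and>
     canonical_proj n ` V = C \<and> d = deg m V)"

end

(* Sub-additivity of deg_z and deg_lci only needs that the Zariski topology is Noetherian: the components
   of a union of two closed sets are among those of the two sets, and two decompositions can be merged.

   For deg_pi, let V and V' project onto C and C'. After raising both to the same K^m, the set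
   V x {0} \<union> V' x {1} in K^(m+1) is locally closed and projects onto the union of C and C'. It remains to see
   that the degree of V x {c} in K^(m+1) is at most that of V in K^m. An affine subspace A of codimension
   r = dim V in K^(m+1) misses the hyperplane x_m = c, meets it in codimension r, or lies in it and then has
   codimension r - 1 in it. In the latter case A cannot meet V x {c} in a finite non-empty set, by Krull's
   height theorem: if V has an isolated point on a linear section of codimension s, then dim V \<le> s.

   The height theorem is proved for transcendence degrees, which bound the length of chains. Its
   induction step is Krull's principal ideal theorem, obtained from Noether normalisation and unique
   factorisation in polynomial rings over a field. *)
theory Submission
  imports Defs
begin

section \<open>Evaluation of polynomials\<close>

text \<open>The coordinate ring of a set X is never formed as a quotient. Its elements are
  represented by arbitrary polynomials, an identity in it is an identity of the values
  \<open>ev x p\<close> at all points of X, and its zero ideal is \<open>vanishing X\<close>.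
  Subrings and homomorphisms live on sets of polynomials that contain \<open>vanishing X\<close>.
  Unique factorisation enters at one point of the principal ideal theorem. The relations over K[y]
  satisfied by a function h on X form a prime ideal of K[y][T] that meets K[y] only in 0; over a
  factorial ring such an ideal is principal. The constant term of its generator plays the role of
  the norm of h, and its zero locus is the image of the section h = 0. That every zero is hit is
  lying over: a homomorphism to K is extended along a finite ring extension. Locally closed sets and
  isolated points are reduced to closed sets by adjoining a coordinate for the inverse of a
  polynomial g that vanishes on whatever has to be discarded. Chains are compared with transcendence
  degrees in one direction: d strict inclusions of irreducible sets yield d algebraically
  independent functions.\<close>

type_synonym 'a mpoly = "(nat \<Rightarrow>\<^sub>0 nat) \<Rightarrow>\<^sub>0 'a"

abbreviation keys :: "('b \<Rightarrow>\<^sub>0 'c::zero) \<Rightarrow> 'b set" where "keys \<equiv> Poly_Mapping.keys"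
abbreviation lookup :: "('b \<Rightarrow>\<^sub>0 'c::zero) \<Rightarrow> 'b \<Rightarrow> 'c" where "lookup \<equiv> Poly_Mapping.lookup"
abbreviation Const :: "'a::field \<Rightarrow> 'a mpoly" where "Const c \<equiv> Poly_Mapping.single 0 c"
abbreviation Var :: "nat \<Rightarrow> 'a::field mpoly" where "Var i \<equiv> Poly_Mapping.single (Poly_Mapping.single i (Suc 0)) 1"

text \<open>The product runs over the support of the exponent vector, so that no number of variables
  is carried along and polynomials in different sets of variables can be evaluated at one
  point.\<close>

definition ev_monom :: "(nat \<Rightarrow> 'a::field) \<Rightarrow> (nat \<Rightarrow>\<^sub>0 nat) \<Rightarrow> 'a" where
  "ev_monom x m = (\<Prod>i\<in>keys m. x i ^ lookup m i)"

definition ev :: "(nat \<Rightarrow> 'a::field) \<Rightarrow> 'a mpoly \<Rightarrow> 'a" where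
  "ev x p = (\<Sum>m\<in>keys p. lookup p m * ev_monom x m)"

text \<open>Arbitrary sets of variables are allowed because the principal ideal theorem removes a
  variable that need not be the last one.\<close>

definition polys_in :: "nat set \<Rightarrow> 'a::field mpoly set" where
  "polys_in J = {p. \<forall>m\<in>keys p. keys m \<subseteq> J}"

lemma polys_eq_polys_in: "polys n = polys_in {..<n}"
  by (simp add: polys_def polys_in_def)

lemma ev_monom_superset:
  assumes "finite M" "keys m \<subseteq> M"
  shows "ev_monom x m = (\<Prod>i\<in>M. x i ^ lookup m i)"
  unfolding ev_monom_def using assms by (intro prod.mono_neutral_left) (auto simp: in_keys_iff)

lemma ev_monom_add: "ev_monom x (a + b) = ev_monom x a * ev_monom x b"
proof -
  let ?M = "keys a \<union> keys b"
  have "keys (a + b) \<subseteq> ?M" by (rule Poly_Mapping.keys_add)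
  then show ?thesis
    by (simp add: ev_monom_superset[where M = ?M] lookup_add power_add prod.distrib)
qed

lemma ev_monom_0 [simp]: "ev_monom x 0 = 1"
  by (simp add: ev_monom_def)

lemma ev_superset:
  assumes "finite M" "keys p \<subseteq> M"
  shows "ev x p = (\<Sum>m\<in>M. lookup p m * ev_monom x m)"
  unfolding ev_def using assms by (intro sum.mono_neutral_left) (auto simp: in_keys_iff)

lemma ev_0 [simp]: "ev x 0 = 0"
  by (simp add: ev_def)

lemma ev_single: "ev x (Poly_Mapping.single m c) = c * ev_monom x m"
  by (subst ev_superset[where M = "{m}"]) auto

lemma ev_Const [simp]: "ev x (Const c) = c"
  by (simp add: ev_single)

lemma ev_1 [simp]: "ev x 1 = 1"
  using ev_Const[of x 1] by simp

lemma ev_Var [simp]: "ev x (Var i) = x i"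
  by (simp add: ev_single ev_monom_def)

lemma ev_add [simp]: "ev x (p + q) = ev x p + ev x q"
proof -
  let ?M = "keys p \<union> keys q"
  have "keys (p + q) \<subseteq> ?M" by (rule Poly_Mapping.keys_add)
  then show ?thesis
    by (simp add: ev_superset[where M = ?M] lookup_add distrib_right sum.distrib)
qed

lemma ev_uminus [simp]: "ev x (- p) = - ev x p"
  using ev_add[of x p "- p"] by (simp add: eq_neg_iff_add_eq_0 add.commute)

lemma ev_diff [simp]: "ev x (p - q) = ev x p - ev x q"
  using ev_add[of x p "- q"] by simp

lemma ev_sum: "ev x (sum f A) = (\<Sum>a\<in>A. ev x (f a))"
  by (induction A rule: infinite_finite_induct) auto

lemma poly_mapping_expand: "p = (\<Sum>m\<in>keys p. Poly_Mapping.single m (lookup p m))"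
  by (intro poly_mapping_eqI) (auto simp: lookup_sum lookup_single when_def in_keys_iff)

lemma mpoly_induct [case_names zero add]:
  assumes "P 0" and "\<And>m c p. P p \<Longrightarrow> c \<noteq> 0 \<Longrightarrow> m \<notin> keys p \<Longrightarrow> P (Poly_Mapping.single m c + p)"
  shows "P (p :: 'a::field mpoly)"
proof (induction p rule: Poly_Mapping.update_induct)
  case (update p a b)
  have "Poly_Mapping.update a b p = Poly_Mapping.single a b + p"
    using update(1) by (intro poly_mapping_eqI)
      (auto simp: lookup_update lookup_add lookup_single in_keys_iff when_def)
  then show ?case using assms(2) update by simp
qed (use assms in auto)

lemma ev_mult [simp]: "ev x (p * q) = ev x p * ev x q"
proof -
  have "p * q = (\<Sum>m\<in>keys p. \<Sum>m'\<in>keys q.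
      Poly_Mapping.single (m + m') (lookup p m * lookup q m'))"
    using arg_cong2[OF poly_mapping_expand[of p] poly_mapping_expand[of q], of "(*)"]
    by (simp only: sum_product mult_single)
  then show ?thesis
    unfolding ev_def[of x p] ev_def[of x q] sum_product
    by (simp only: ev_sum ev_single ev_monom_add mult_ac)
qed

lemma ev_power [simp]: "ev x (p ^ k) = ev x p ^ k"
  by (induction k) auto

lemma ev_prod: "ev x (prod f A) = (\<Prod>a\<in>A. ev x (f a))"
  by (induction A rule: infinite_finite_induct) auto

lemma ev_poly: "ev x (poly Q p) = poly (map_poly (ev x) Q) (ev x p)"
  by (induction Q) (auto simp: map_poly_pCons)

lemma ev_cong:
  assumes "p \<in> polys_in J" "\<And>i. i \<in> J \<Longrightarrow> x i = x' i"
  shows "ev x p = ev x' p"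
  unfolding ev_def ev_monom_def using assms
  by (intro sum.cong refl arg_cong2[of _ _ _ _ "(*)"] prod.cong arg_cong2[of _ _ _ _ "(^)"])
    (auto simp: polys_in_def)

lemma eval_poly_eq_ev:
  assumes "p \<in> polys n"
  shows "eval_poly n p x = ev x p"
  unfolding eval_poly_def ev_def using assms
  by (intro sum.cong refl arg_cong2[of _ _ _ _ "(*)"])
    (auto simp: polys_def intro!: ev_monom_superset[symmetric])

lemma polys_in_0 [simp]: "0 \<in> polys_in J"
  by (simp add: polys_in_def)

lemma polys_in_single: "keys m \<subseteq> J \<Longrightarrow> Poly_Mapping.single m c \<in> polys_in J"
  by (simp add: polys_in_def)

lemma polys_in_Const [simp]: "Const c \<in> polys_in J"
  by (simp add: polys_in_single)

lemma polys_in_1 [simp]: "1 \<in> polys_in J"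
  using polys_in_Const[of 1] by simp

lemma polys_in_Var: "i \<in> J \<Longrightarrow> Var i \<in> polys_in J"
  by (simp add: polys_in_single)

lemma polys_in_add: "p \<in> polys_in J \<Longrightarrow> q \<in> polys_in J \<Longrightarrow> p + q \<in> polys_in J"
  using Poly_Mapping.keys_add[of p q] by (auto simp: polys_in_def)

lemma polys_in_uminus: "p \<in> polys_in J \<Longrightarrow> - p \<in> polys_in J"
  by (simp add: polys_in_def in_keys_iff)

lemma polys_in_diff: "p \<in> polys_in J \<Longrightarrow> q \<in> polys_in J \<Longrightarrow> p - q \<in> polys_in J"
  using polys_in_add[of p J "- q"] polys_in_uminus by auto

lemma polys_in_mult:
  assumes "p \<in> polys_in J" "q \<in> polys_in J"
  shows "p * q \<in> polys_in J"
  unfolding polys_in_def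
proof (intro CollectI ballI)
  fix m assume "m \<in> keys (p * q)"
  then obtain a b where ab: "m = a + b" "a \<in> keys p" "b \<in> keys q"
    using keys_mult[of p q] by blast
  have "keys m \<subseteq> keys a \<union> keys b"
    unfolding ab(1) by (rule Poly_Mapping.keys_add)
  with ab assms show "keys m \<subseteq> J"
    unfolding polys_in_def by blast
qed

lemma polys_in_sum: "(\<And>a. a \<in> A \<Longrightarrow> f a \<in> polys_in J) \<Longrightarrow> sum f A \<in> polys_in J"
  by (induction A rule: infinite_finite_induct) (auto intro: polys_in_add)

lemma polys_in_prod: "(\<And>a. a \<in> A \<Longrightarrow> f a \<in> polys_in J) \<Longrightarrow> prod f A \<in> polys_in J"
  by (induction A rule: infinite_finite_induct) (auto intro: polys_in_mult)

lemma polys_in_mono: "J \<subseteq> J' \<Longrightarrow> polys_in J \<subseteq> polys_in J'"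
  by (auto simp: polys_in_def)

lemma polys_in_empty:
  assumes "p \<in> polys_in {}"
  obtains c where "p = Const c"
proof -
  have "p = Const (lookup p 0)"
    using assms by (intro poly_mapping_eqI) (auto simp: lookup_single when_def in_keys_iff polys_in_def)
  then show ?thesis by (rule that)
qed

lemma polys_in_finite: "\<exists>J. finite J \<and> p \<in> polys_in J"
  by (intro exI[of _ "\<Union>m\<in>keys p. keys m"]) (auto simp: polys_in_def)

lemma Var_power: "Var j ^ k = (Poly_Mapping.single (Poly_Mapping.single j k) 1 :: 'a::field mpoly)"
  by (induction k) (simp_all add: mult_single single_add[symmetric])

section \<open>Subrings given by carrier sets, and polynomials over them\<close>

definition polys_over :: "'r::comm_ring_1 set \<Rightarrow> 'r poly set" where
  "polys_over A = {Q. \<forall>i. coeff Q i \<in> A}"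

text \<open>The single type \<open>'a mpoly\<close> contains the polynomial rings in all sets of
  variables. Rings are therefore carrier sets, and the ring theory below is relative to
  them.\<close>

definition subring :: "'r::comm_ring_1 set \<Rightarrow> bool" where
  "subring A \<longleftrightarrow> 0 \<in> A \<and> 1 \<in> A \<and> (\<forall>a\<in>A. \<forall>b\<in>A. a + b \<in> A \<and> a - b \<in> A \<and> a * b \<in> A)"

lemma subringD:
  assumes "subring A"
  shows "0 \<in> A" "1 \<in> A" "a \<in> A \<Longrightarrow> b \<in> A \<Longrightarrow> a + b \<in> A" "a \<in> A \<Longrightarrow> b \<in> A \<Longrightarrow> a - b \<in> A"
    "a \<in> A \<Longrightarrow> b \<in> A \<Longrightarrow> a * b \<in> A" "a \<in> A \<Longrightarrow> - a \<in> A"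
  using assms diff_0[of a] unfolding subring_def by (blast, blast, blast, blast, blast, metis)

lemma subring_sum: "subring A \<Longrightarrow> (\<And>i. i \<in> I \<Longrightarrow> f i \<in> A) \<Longrightarrow> sum f I \<in> A"
  by (induction I rule: infinite_finite_induct) (auto intro: subringD)

lemma subring_power: "subring A \<Longrightarrow> a \<in> A \<Longrightarrow> a ^ k \<in> A"
  by (induction k) (auto intro: subringD)

lemma subring_polys_in [intro]: "subring (polys_in J)"
  by (auto simp: subring_def intro: polys_in_add polys_in_diff polys_in_mult)

lemma subring_polys_over [intro]:
  assumes "subring A"
  shows "subring (polys_over A)"
  unfolding subring_def[of "polys_over A"]
  unfolding polys_over_def using assms by (auto simp: coeff_mult of_bool_def intro!: subring_sum intro: subringD)

lemma polys_over_const: "subring A \<Longrightarrow> a \<in> A \<Longrightarrow> [:a:] \<in> polys_over A"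
  by (auto simp: polys_over_def coeff_pCons subringD split: nat.splits)

lemma polys_over_monom: "subring A \<Longrightarrow> a \<in> A \<Longrightarrow> monom a k \<in> polys_over A"
  by (auto simp: polys_over_def subringD)

lemma polys_over_smult: "subring A \<Longrightarrow> a \<in> A \<Longrightarrow> Q \<in> polys_over A \<Longrightarrow> smult a Q \<in> polys_over A"
  by (auto simp: polys_over_def subringD)

lemma poly_in_subring:
  assumes "subring A" "Q \<in> polys_over A" "x \<in> A"
  shows "poly Q x \<in> A"
  unfolding poly_altdef using assms
  by (auto simp: polys_over_def intro!: subring_sum intro: subringD subring_power)

lemma map_poly_ev_cong:
  assumes "Q \<in> polys_over (polys_in J)" "\<And>i. i \<in> J \<Longrightarrow> x i = x' i"
  shows "map_poly (ev x) Q = map_poly (ev x') Q"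
  using assms by (intro poly_eqI) (auto simp: coeff_map_poly polys_over_def intro!: ev_cong[of _ J])

text \<open>Splits the power of \<open>Var j\<close> off each monomial. Together with
  \<open>poly_Var_eq_0_iff\<close> it identifies polynomials in one more variable with univariate
  polynomials over the old ring.\<close>

lemma polys_in_insert_decompose:
  assumes "p \<in> polys_in (insert j J)"
  obtains Q where "Q \<in> polys_over (polys_in J)" "p = poly Q (Var j)"
proof -
  have "p \<in> polys_in (insert j J) \<longrightarrow> (\<exists>Q\<in>polys_over (polys_in J). p = poly Q (Var j))"
  proof (induction p rule: mpoly_induct)
    case zero
    show ?case by (intro impI bexI[of _ 0]) (auto simp: polys_over_def)
  next
    case (add m c p)
    show ?case
    proof
      assume a: "Poly_Mapping.single m c + p \<in> polys_in (insert j J)"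
      have k: "keys (Poly_Mapping.single m c + p) = insert m (keys p)"
        using add(2,3) by (auto simp: in_keys_iff lookup_add lookup_single when_def split: if_splits)
      have p: "p \<in> polys_in (insert j J)" and m: "keys m \<subseteq> insert j J"
        using a[unfolded polys_in_def mem_Collect_eq k] by (auto simp: polys_in_def)
      obtain Q where Q: "Q \<in> polys_over (polys_in J)" "p = poly Q (Var j)"
        using add(1) p by blast
      define m' where "m' = Poly_Mapping.update j 0 m"
      have km: "keys m' \<subseteq> J"
        using m by (auto simp: m'_def keys_update)
      have mm: "m = m' + Poly_Mapping.single j (lookup m j)"
        by (intro poly_mapping_eqI) (auto simp: m'_def lookup_add lookup_update lookup_single when_def)
      let ?R = "monom (Poly_Mapping.single m' c) (lookup m j) + Q"
      have "Poly_Mapping.single m c = Poly_Mapping.single m' c * Var j ^ lookup m j"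
        unfolding Var_power mult_single using mm by simp
      then have "Poly_Mapping.single m c + p = poly ?R (Var j)"
        using Q(2) by (simp add: poly_monom)
      moreover have "?R \<in> polys_over (polys_in J)"
        using Q(1) km by (intro subringD(3) subring_polys_over subring_polys_in polys_over_monom polys_in_single)
      ultimately show "\<exists>Q\<in>polys_over (polys_in J). Poly_Mapping.single m c + p = poly Q (Var j)"
        by blast
    qed
  qed
  with assms that show ?thesis by blast
qed

section \<open>Polynomials as functions over an infinite field\<close>

lemma infinite_alg_closed: "infinite (UNIV :: 'a::alg_closed_field set)"
proof
  assume fin: "finite (UNIV :: 'a set)"
  \<comment> \<open>Over a finite field this polynomial has the value 1 everywhere, although its
    degree is positive.\<close>
  let ?p = "(\<Prod>a\<in>(UNIV :: 'a set). [:-a, 1:]) + 1"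
  have "degree (\<Prod>a\<in>(UNIV :: 'a set). [:-a, 1:]) = (\<Sum>a\<in>(UNIV :: 'a set). 1)"
    by (subst degree_prod_eq_sum_degree) auto
  then have "degree (\<Prod>a\<in>(UNIV :: 'a set). [:-a, 1:]) > 0"
    using fin by (simp add: card_gt_0_iff)
  then have "degree ?p > 0"
    by (subst degree_add_eq_left) auto
  then obtain x where "poly ?p x = 0"
    using alg_closed_imp_poly_has_root by blast
  moreover have "poly (\<Prod>a\<in>(UNIV :: 'a set). [:-a, 1:]) x = 0"
    using fin by (auto simp: poly_prod prod_zero_iff)
  ultimately show False by simp
qed

lemma exists_nonroot:
  fixes Q :: "'a::alg_closed_field poly"
  assumes "Q \<noteq> 0"
  obtains x where "poly Q x \<noteq> 0"
  using poly_roots_finite[OF assms] infinite_alg_closed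
  by (metis (mono_tags, lifting) Collect_cong UNIV_def)

text \<open>Induction on the number of variables: the other coordinates are chosen such that the
  leading coefficient in x_j survives, and then x_j outside the finitely many roots of the
  specialised polynomial.\<close>

lemma exists_ev_nonzero:
  fixes p :: "'a::alg_closed_field mpoly"
  assumes "p \<noteq> 0"
  obtains x where "ev x p \<noteq> 0"
proof -
  have "\<exists>x. ev x p \<noteq> 0" if "finite J" "p \<in> polys_in J" "p \<noteq> 0" for J and p :: "'a mpoly"
    using that
  proof (induction J arbitrary: p rule: finite_induct)
    case empty
    then obtain c where "p = Const c" using polys_in_empty by blast
    then show ?case using empty by auto
  next
    case (insert j J)
    obtain Q where Q: "Q \<in> polys_over (polys_in J)" "p = poly Q (Var j)"
      using polys_in_insert_decompose insert by metis
    have "Q \<noteq> 0" using Q insert by auto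
    then have "lead_coeff Q \<noteq> 0" "lead_coeff Q \<in> polys_in J"
      using Q by (auto simp: polys_over_def)
    then obtain x where x: "ev x (lead_coeff Q) \<noteq> 0" using insert.IH by blast
    then have "map_poly (ev x) Q \<noteq> 0"
      by (metis coeff_0 coeff_map_poly ev_0)
    then obtain t where t: "poly (map_poly (ev x) Q) t \<noteq> 0" by (rule exists_nonroot)
    have "map_poly (ev (x(j := t))) Q = map_poly (ev x) Q"
      using insert(2) by (intro map_poly_ev_cong[OF Q(1)]) auto
    then have "ev (x(j := t)) p \<noteq> 0"
      using t unfolding Q(2) ev_poly by simp
    then show ?case by blast
  qed
  with assms polys_in_finite[of p] that show ?thesis by blast
qed

lemma mpoly_eqI:
  fixes p q :: "'a::alg_closed_field mpoly"
  assumes "\<And>x. ev x p = ev x q"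
  shows "p = q"
  using exists_ev_nonzero[of "p - q"] assms by (metis ev_diff eq_iff_diff_eq_0)

text \<open>Changing coordinate j alone leaves the values of the coefficients fixed. Hence the
  specialisation of Q at any point vanishes for all values of x_j, and so do its
  coefficients.\<close>

lemma poly_Var_eq_0_iff:
  fixes Q :: "'a::alg_closed_field mpoly poly"
  assumes "Q \<in> polys_over (polys_in J)" "j \<notin> J"
  shows "poly Q (Var j) = 0 \<longleftrightarrow> Q = 0"
proof
  assume 0: "poly Q (Var j) = 0"
  have "coeff Q i = 0" for i
  proof (rule mpoly_eqI)
    fix x
    have "poly (map_poly (ev x) Q) t = 0" for t
    proof -
      have "map_poly (ev (x(j := t))) Q = map_poly (ev x) Q"
        using assms(2) by (intro map_poly_ev_cong[OF assms(1)]) auto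
      then show ?thesis
        using ev_poly[of "x(j := t)" Q "Var j"] 0 by simp
    qed
    then have "map_poly (ev x) Q = 0" using exists_nonroot by blast
    then show "ev x (coeff Q i) = ev x 0"
      by (metis coeff_0 coeff_map_poly ev_0)
  qed
  then show "Q = 0" by (intro poly_eqI) simp
qed simp

text \<open>On points whose coordinates outside J are 0 this does not change the value. It carries a
  polynomial function on K^n over to K^(n+1) in such a way that it ignores the new
  coordinate.\<close>

definition restrict_vars :: "nat set \<Rightarrow> 'a::field mpoly \<Rightarrow> 'a mpoly" where
  "restrict_vars J p = (\<Sum>m | m \<in> keys p \<and> keys m \<subseteq> J. Poly_Mapping.single m (lookup p m))"

lemma restrict_vars_in: "restrict_vars J p \<in> polys_in J"
  unfolding restrict_vars_def by (intro polys_in_sum polys_in_single) auto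

lemma ev_restrict_vars: "ev x (restrict_vars J p) = ev (\<lambda>i. if i \<in> J then x i else 0) p"
proof -
  let ?x = "\<lambda>i. if i \<in> J then x i else 0"
  have *: "ev_monom ?x m = (if keys m \<subseteq> J then ev_monom x m else 0)" for m
  proof (cases "keys m \<subseteq> J")
    case False
    then obtain i where "i \<in> keys m" "i \<notin> J" by blast
    then show ?thesis
      using False unfolding ev_monom_def
      by (auto intro!: prod_zero bexI[of _ i] simp: in_keys_iff)
  qed (auto simp: ev_monom_def intro!: prod.cong)
  have "ev ?x p = (\<Sum>m\<in>keys p. if keys m \<subseteq> J then lookup p m * ev_monom x m else 0)"
    unfolding ev_def * by (intro sum.cong) auto
  also have "\<dots> = (\<Sum>m | m \<in> keys p \<and> keys m \<subseteq> J. lookup p m * ev_monom x m)"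
    by (intro sum.mono_neutral_cong_right) auto
  finally show ?thesis
    by (simp add: restrict_vars_def ev_sum ev_single)
qed

section \<open>Unique factorisation in polynomial rings\<close>

text \<open>This and the following notions are relative to the carrier: inverses and quotients have
  to lie in A, whereas divisibility of the type class refers to the whole ambient ring.\<close>

definition unit_in :: "'r::idom set \<Rightarrow> 'r \<Rightarrow> bool" where
  "unit_in A a \<longleftrightarrow> a \<in> A \<and> (\<exists>b\<in>A. a * b = 1)"

definition dvd_in :: "'r::idom set \<Rightarrow> 'r \<Rightarrow> 'r \<Rightarrow> bool" where
  "dvd_in A a b \<longleftrightarrow> (\<exists>c\<in>A. b = a * c)"

definition irred_in :: "'r::idom set \<Rightarrow> 'r \<Rightarrow> bool" where
  "irred_in A a \<longleftrightarrow> a \<in> A \<and> a \<noteq> 0 \<and> \<not> unit_in A a \<and>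
     (\<forall>b\<in>A. \<forall>c\<in>A. a = b * c \<longrightarrow> unit_in A b \<or> unit_in A c)"

definition prime_in :: "'r::idom set \<Rightarrow> 'r \<Rightarrow> bool" where
  "prime_in A a \<longleftrightarrow> a \<in> A \<and> a \<noteq> 0 \<and> \<not> unit_in A a \<and>
     (\<forall>b\<in>A. \<forall>c\<in>A. dvd_in A a (b * c) \<longrightarrow> dvd_in A a b \<or> dvd_in A a c)"

text \<open>The additive size function \<open>\<delta>\<close> makes factorisation into irreducibles terminate.\<close>

definition ufd :: "'r::idom set \<Rightarrow> ('r \<Rightarrow> nat) \<Rightarrow> bool" where
  "ufd A \<delta> \<longleftrightarrow> subring A \<and> (\<forall>a\<in>A. \<forall>b\<in>A. a \<noteq> 0 \<longrightarrow> b \<noteq> 0 \<longrightarrow> \<delta> (a * b) = \<delta> a + \<delta> b) \<and>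
     (\<forall>a\<in>A. a \<noteq> 0 \<longrightarrow> (\<delta> a = 0 \<longleftrightarrow> unit_in A a)) \<and> (\<forall>a. irred_in A a \<longrightarrow> prime_in A a)"

lemma ufdD:
  assumes "ufd A \<delta>"
  shows "subring A" "a \<in> A \<Longrightarrow> b \<in> A \<Longrightarrow> a \<noteq> 0 \<Longrightarrow> b \<noteq> 0 \<Longrightarrow> \<delta> (a * b) = \<delta> a + \<delta> b"
    "a \<in> A \<Longrightarrow> a \<noteq> 0 \<Longrightarrow> \<delta> a = 0 \<longleftrightarrow> unit_in A a" "irred_in A a \<Longrightarrow> prime_in A a"
  using assms unfolding ufd_def by blast+

lemma ufd_prime_factor:
  assumes "ufd A \<delta>" "a \<in> A" "a \<noteq> 0" "\<not> unit_in A a"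
  shows "\<exists>\<pi> c. prime_in A \<pi> \<and> c \<in> A \<and> a = \<pi> * c"
  using assms(2-)
proof (induction "\<delta> a" arbitrary: a rule: less_induct)
  case less
  note D = ufdD[OF assms(1)]
  show ?case
  proof (cases "irred_in A a")
    case True
    then show ?thesis using D(4) subringD(2)[OF D(1)] by (metis mult.right_neutral)
  next
    case False
    then obtain b c where bc: "b \<in> A" "c \<in> A" "a = b * c" "\<not> unit_in A b" "\<not> unit_in A c"
      using less unfolding irred_in_def by blast
    then have "\<delta> a = \<delta> b + \<delta> c" "\<delta> c \<noteq> 0" using D(2,3) less by auto
    then have "\<delta> b < \<delta> a" by simp
    then obtain \<pi> d where "prime_in A \<pi>" "d \<in> A" "b = \<pi> * d"
      using less bc by (metis mult_zero_left)
    then show ?thesis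
      using bc subringD(5)[OF D(1)] by (metis mult.assoc)
  qed
qed

section \<open>Gauss's lemma\<close>

lemma dvd_in_const_iff:
  assumes "subring A"
  shows "dvd_in (polys_over A) [:\<pi>:] f \<longleftrightarrow> (\<forall>i. dvd_in A \<pi> (coeff f i))"
proof
  assume "dvd_in (polys_over A) [:\<pi>:] f"
  then obtain q where "q \<in> polys_over A" "f = [:\<pi>:] * q" unfolding dvd_in_def by blast
  then show "\<forall>i. dvd_in A \<pi> (coeff f i)"
    unfolding dvd_in_def polys_over_def by auto
next
  assume "\<forall>i. dvd_in A \<pi> (coeff f i)"
  then obtain c where c: "\<And>i. c i \<in> A" "\<And>i. coeff f i = \<pi> * c i" unfolding dvd_in_def by metis
  let ?q = "\<Sum>i\<le>degree f. monom (c i) i"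
  have "?q \<in> polys_over A"
    using c assms by (intro subring_sum subring_polys_over polys_over_monom) auto
  moreover have "f = [:\<pi>:] * ?q"
    by (subst poly_as_sum_of_monoms[of f, symmetric])
      (simp only: c(2) sum_distrib_left smult_monom[symmetric] mult_pCons_left mult_zero_left pCons_0_0 add_0_right)
  ultimately show "dvd_in (polys_over A) [:\<pi>:] f" unfolding dvd_in_def by blast
qed

lemma dvd_in_0: "subring A \<Longrightarrow> dvd_in A a 0"
  unfolding dvd_in_def by (metis mult_zero_right subringD(1))

lemma dvd_in_add: "subring A \<Longrightarrow> dvd_in A a b \<Longrightarrow> dvd_in A a c \<Longrightarrow> dvd_in A a (b + c)"
  unfolding dvd_in_def by (metis distrib_left subringD(3))

lemma dvd_in_diff: "subring A \<Longrightarrow> dvd_in A a b \<Longrightarrow> dvd_in A a c \<Longrightarrow> dvd_in A a (b - c)"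
  unfolding dvd_in_def by (metis right_diff_distrib subringD(4))

lemma dvd_in_mult: "subring A \<Longrightarrow> dvd_in A a b \<Longrightarrow> c \<in> A \<Longrightarrow> dvd_in A a (b * c)"
  unfolding dvd_in_def by (metis mult.assoc subringD(5))

lemma dvd_in_sum: "subring A \<Longrightarrow> (\<And>i. i \<in> I \<Longrightarrow> dvd_in A a (f i)) \<Longrightarrow> dvd_in A a (sum f I)"
  by (induction I rule: infinite_finite_induct) (auto intro: dvd_in_0 dvd_in_add)

lemma unit_in_polys_over_iff:
  assumes "subring A"
  shows "unit_in (polys_over A) f \<longleftrightarrow> (\<exists>a. f = [:a:] \<and> unit_in A a)"
proof
  assume "unit_in (polys_over A) f"
  then obtain g where g: "f \<in> polys_over A" "g \<in> polys_over A" "f * g = 1" unfolding unit_in_def by blast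
  then have nz: "f \<noteq> 0" "g \<noteq> 0" by auto
  then have "degree f + degree g = 0" using g(3) by (metis degree_mult_eq degree_1)
  then obtain a b where ab: "f = [:a:]" "g = [:b:]"
    by (metis add_is_0 degree_eq_zeroE)
  then have "a \<in> A" "b \<in> A" "a * b = 1"
    using g by (auto simp: polys_over_def one_pCons mult.commute dest: spec[of _ 0])
  then show "\<exists>a. f = [:a:] \<and> unit_in A a" using ab unfolding unit_in_def by blast
next
  assume "\<exists>a. f = [:a:] \<and> unit_in A a"
  then obtain a b where "f = [:a:]" "a \<in> A" "b \<in> A" "a * b = 1" unfolding unit_in_def by blast
  then show "unit_in (polys_over A) f"
    unfolding unit_in_def using polys_over_const[OF assms]
    by (auto simp: one_pCons intro!: bexI[of _ "[:b:]"])
qed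

text \<open>If neither factor is divisible by the constant, let i and j be the first indices at
  which their coefficients are not. In the coefficient of index i + j of the product all terms but
  one are divisible, and the remaining one is not, by primality in A.\<close>

lemma prime_in_const:
  assumes A: "subring A" and p: "prime_in A \<pi>"
  shows "prime_in (polys_over A) [:\<pi>:]"
  unfolding prime_in_def
proof (intro conjI ballI impI)
  show "[:\<pi>:] \<in> polys_over A" "[:\<pi>:] \<noteq> 0" "\<not> unit_in (polys_over A) [:\<pi>:]"
    using p polys_over_const[OF A] unit_in_polys_over_iff[OF A] unfolding prime_in_def by auto
next
  fix f g assume fg: "f \<in> polys_over A" "g \<in> polys_over A" "dvd_in (polys_over A) [:\<pi>:] (f * g)"
  show "dvd_in (polys_over A) [:\<pi>:] f \<or> dvd_in (polys_over A) [:\<pi>:] g"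
  proof (rule ccontr)
    assume "\<not> ?thesis"
    then obtain i0 j0 where i0: "\<not> dvd_in A \<pi> (coeff f i0)" and j0: "\<not> dvd_in A \<pi> (coeff g j0)"
      using dvd_in_const_iff[OF A] by blast
    obtain i where i: "\<not> dvd_in A \<pi> (coeff f i)" "\<And>k. k < i \<Longrightarrow> dvd_in A \<pi> (coeff f k)"
      using exists_least_iff[of "\<lambda>i. \<not> dvd_in A \<pi> (coeff f i)"] i0 by blast
    obtain j where j: "\<not> dvd_in A \<pi> (coeff g j)" "\<And>k. k < j \<Longrightarrow> dvd_in A \<pi> (coeff g k)"
      using exists_least_iff[of "\<lambda>i. \<not> dvd_in A \<pi> (coeff g i)"] j0 by blast
    let ?t = "\<lambda>k. coeff f k * coeff g (i + j - k)"
    have fgA: "coeff f k \<in> A" "coeff g k \<in> A" for k using fg unfolding polys_over_def by auto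
    have "dvd_in A \<pi> (sum ?t ({..i+j} - {i}))"
    proof (rule dvd_in_sum[OF A])
      fix k assume "k \<in> {..i+j} - {i}"
      then consider "k < i" | "i + j - k < j" by fastforce
      then show "dvd_in A \<pi> (?t k)"
        using i(2) j(2) dvd_in_mult[OF A] fgA by cases (blast, metis mult.commute)
    qed
    moreover have "dvd_in A \<pi> (coeff (f * g) (i + j))"
      using fg(3) dvd_in_const_iff[OF A] by blast
    moreover have "coeff (f * g) (i + j) = ?t i + sum ?t ({..i+j} - {i})"
      unfolding coeff_mult by (subst sum.remove[of _ i]) auto
    ultimately have "dvd_in A \<pi> (coeff f i * coeff g j)"
      using dvd_in_diff[OF A] by fastforce
    then show False using p i j fgA unfolding prime_in_def by blast
  qed
qed

text \<open>Testing prime constants avoids speaking of greatest common divisors of the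
  coefficients.\<close>

definition primitive_over :: "'r::idom set \<Rightarrow> 'r poly \<Rightarrow> bool" where
  "primitive_over A F \<longleftrightarrow> F \<in> polys_over A \<and> F \<noteq> 0 \<and> (\<forall>\<pi>. prime_in A \<pi> \<longrightarrow> \<not> dvd_in (polys_over A) [:\<pi>:] F)"

text \<open>The prime factors of c are removed one by one: each divides \<open>F * W\<close>, and
  since it stays prime as a constant polynomial and F is primitive, it divides W.\<close>

lemma primitive_cancel_const:
  assumes u: "ufd A \<delta>" and F: "primitive_over A F"
    and "c \<in> A" "c \<noteq> 0" "G \<in> polys_over A" "W \<in> polys_over A" "smult c G = F * W"
  shows "dvd_in (polys_over A) F G"
  using assms(3-)
proof (induction "\<delta> c" arbitrary: c W rule: less_induct)
  case less
  note D = ufdD[OF u]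
  note P = subring_polys_over[OF D(1)]
  show ?case
  proof (cases "unit_in A c")
    case True
    then obtain d where d: "d \<in> A" "c * d = 1" unfolding unit_in_def by blast
    then have "G = F * smult d W"
      using less(6) by (metis mult.commute mult_smult_right smult_1_left smult_smult)
    then show ?thesis
      using d less polys_over_smult[OF D(1)] unfolding dvd_in_def by blast
  next
    case False
    then obtain \<pi> e where e: "prime_in A \<pi>" "e \<in> A" "c = \<pi> * e"
      using ufd_prime_factor[OF u] less by blast
    have pA: "\<pi> \<in> A" "\<pi> \<noteq> 0" "\<not> unit_in A \<pi>" using e(1) unfolding prime_in_def by auto
    have e0: "e \<noteq> 0" using e less by auto
    have "\<delta> c = \<delta> \<pi> + \<delta> e" "\<delta> \<pi> \<noteq> 0" using D(2,3) e pA e0 by auto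
    then have lt: "\<delta> e < \<delta> c" by simp
    have "F * W = [:\<pi>:] * smult e G" using less(6) e by (simp add: mult.commute)
    moreover have "smult e G \<in> polys_over A" using less e polys_over_smult[OF D(1)] by blast
    ultimately have "dvd_in (polys_over A) [:\<pi>:] (F * W)" unfolding dvd_in_def by blast
    then have "dvd_in (polys_over A) [:\<pi>:] W"
      using prime_in_const[OF D(1) e(1)] F less(5) e(1) unfolding prime_in_def primitive_over_def by blast
    then obtain W' where W': "W' \<in> polys_over A" "W = [:\<pi>:] * W'" unfolding dvd_in_def by blast
    have "smult \<pi> (smult e G) = smult \<pi> (F * W')" using less(6) e W' by simp
    then have "smult \<pi> (smult e G - F * W') = 0" by (simp add: smult_diff_right)
    then have "smult e G = F * W'" using pA by simp
    then show ?thesis using less(1)[OF lt] e e0 less W' by blast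
  qed
qed

text \<open>Prime constants are split off as long as possible; each one lowers the size of the
  leading coefficient.\<close>

lemma primitive_part:
  assumes u: "ufd A \<delta>" and "W \<in> polys_over A" "W \<noteq> 0"
  shows "\<exists>b W'. b \<in> A \<and> b \<noteq> 0 \<and> primitive_over A W' \<and> W = smult b W'"
  using assms(2-)
proof (induction "\<delta> (lead_coeff W)" arbitrary: W rule: less_induct)
  case less
  note D = ufdD[OF u]
  show ?case
  proof (cases "primitive_over A W")
    case True
    then show ?thesis using subringD(2)[OF D(1)] by (intro exI[of _ 1] exI[of _ W]) auto
  next
    case False
    then obtain \<pi> V where e: "prime_in A \<pi>" "V \<in> polys_over A" "W = smult \<pi> V"
      using less unfolding primitive_over_def dvd_in_def by auto
    have pA: "\<pi> \<in> A" "\<pi> \<noteq> 0" "\<not> unit_in A \<pi>" using e(1) unfolding prime_in_def by auto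
    have V0: "V \<noteq> 0" using e less by auto
    have "lead_coeff V \<in> A" "lead_coeff V \<noteq> 0" using e(2) V0 unfolding polys_over_def by auto
    then have "\<delta> (lead_coeff W) = \<delta> \<pi> + \<delta> (lead_coeff V)" "\<delta> \<pi> \<noteq> 0"
      using D(2,3) e pA V0 by (auto simp: lead_coeff_smult)
    then have "\<delta> (lead_coeff V) < \<delta> (lead_coeff W)" by simp
    then obtain b W' where "b \<in> A" "b \<noteq> 0" "primitive_over A W'" "V = smult b W'"
      using less(1) e V0 by blast
    then show ?thesis
      using e pA subringD(5)[OF D(1)] by (intro exI[of _ "\<pi> * b"] exI[of _ W']) auto
  qed
qed

section \<open>Pseudo-division and unique factorisation of univariate polynomials\<close>

lemma pseudo_division:
  fixes F G :: "'r::idom poly"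
  assumes A: "subring A" and F: "F \<in> polys_over A" "F \<noteq> 0" and "G \<in> polys_over A"
  shows "\<exists>k q r. q \<in> polys_over A \<and> r \<in> polys_over A \<and> smult (lead_coeff F ^ k) G = q * F + r \<and>
    (r = 0 \<or> degree r < degree F)"
  using assms(4)
proof (induction "degree G" arbitrary: G rule: less_induct)
  case less
  note P = subringD[OF subring_polys_over[OF A]]
  show ?case
  proof (cases "G = 0 \<or> degree G < degree F")
    case True
    then show ?thesis using less P(1) by (intro exI[of _ 0] exI[of _ G]) auto
  next
    case False
    then have deg: "degree F \<le> degree G" "G \<noteq> 0" by auto
    let ?l = "lead_coeff F" and ?m = "monom (lead_coeff G) (degree G - degree F)"
    have lA: "?l \<in> A" "lead_coeff G \<in> A" using F less unfolding polys_over_def by auto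
    have mA: "?m \<in> polys_over A" using polys_over_monom[OF A] lA by blast
    define G' where "G' = smult ?l G - ?m * F"
    have GA: "G' \<in> polys_over A"
      unfolding G'_def by (intro P(4,5) polys_over_smult[OF A] mA F(1) lA less.prems)
    have "degree (?m * F) = degree G" "coeff (?m * F) (degree G) = ?l * lead_coeff G"
      using deg F by (auto simp: degree_mult_eq degree_monom_eq monom_eq_0_iff coeff_monom_mult)
    moreover have "degree (smult ?l G) = degree G" using F by simp
    ultimately have c: "degree G' \<le> degree G" "coeff G' (degree G) = 0"
      unfolding G'_def by (auto intro: degree_diff_le)
    show ?thesis
    proof (cases "degree G' < degree G")
      case True
      then obtain k q r where kqr: "q \<in> polys_over A" "r \<in> polys_over A"
        "smult (?l ^ k) G' = q * F + r" "r = 0 \<or> degree r < degree F"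
        using less(1)[OF True GA] by blast
      have "smult (?l ^ Suc k) G = smult (?l ^ k) (G' + ?m * F)"
        by (simp add: G'_def mult.commute)
      also have "\<dots> = (q + smult (?l ^ k) ?m) * F + r"
        using kqr(3) by (simp add: smult_add_right algebra_simps)
      finally show ?thesis
        using kqr P(3) mA lA polys_over_smult[OF A] subring_power[OF A] by metis
    next
      case False
      \<comment> \<open>The degree fails to drop only if it is 0; the vanishing coefficient of that
        degree then makes \<open>G'\<close> zero.\<close>
      then have "degree G' = degree G" using c by simp
      then have "G' = 0" using c(2) by (metis leading_coeff_0_iff)
      then have "smult (?l ^ 1) G = ?m * F + 0" by (simp add: G'_def)
      then show ?thesis using mA P(1) by blast
    qed
  qed
qed

text \<open>Replaces the principal ideal property of polynomials over the fraction field of A. The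
  remainder of a pseudo-division by an element of least degree lies in J again, so it is zero; c is
  the cleared denominator.\<close>

lemma min_degree_pseudo_dvd:
  fixes w :: "'r::idom poly"
  assumes A: "subring A" and "J \<subseteq> polys_over A" and w: "w \<in> J" "w \<noteq> 0"
    and min: "\<And>v. v \<in> J \<Longrightarrow> v \<noteq> 0 \<Longrightarrow> degree w \<le> degree v"
    and J: "\<And>a b c q. a \<in> J \<Longrightarrow> b \<in> J \<Longrightarrow> c \<in> polys_over A \<Longrightarrow> q \<in> polys_over A \<Longrightarrow> c * a - q * b \<in> J"
    and F: "F \<in> J"
  shows "\<exists>c u. c \<in> A \<and> c \<noteq> 0 \<and> u \<in> polys_over A \<and> smult c F = w * u"
proof -
  have wA: "w \<in> polys_over A" "F \<in> polys_over A" using assms by auto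
  then have l: "lead_coeff w ^ k \<in> A" "lead_coeff w ^ k \<noteq> 0" for k
    using w subring_power[OF A] unfolding polys_over_def by auto
  obtain k q r where kqr: "q \<in> polys_over A" "smult (lead_coeff w ^ k) F = q * w + r"
    "r = 0 \<or> degree r < degree w"
    using pseudo_division[OF A wA(1) w(2) wA(2)] by blast
  have "r = [:lead_coeff w ^ k:] * F - q * w" using kqr by simp
  then have "r \<in> J" using J[OF F w(1) polys_over_const[OF A l(1)] kqr(1)] by metis
  then have "r = 0" using kqr(3) min by fastforce
  then show ?thesis using kqr l by (metis add_0_right mult.commute)
qed

text \<open>For a constant f this is the assumption on A and Gauss's lemma. An irreducible f of
  positive degree is primitive. If it divides \<open>g * h\<close>, an element w of least degree in
  the ideal (f, g) divides constant multiples of f and g. The primitive part of w then divides f, so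
  it is a unit or an associate of f.\<close>

lemma irred_in_polys_over_imp_prime:
  assumes u: "ufd A \<delta>" and f: "irred_in (polys_over A) f"
  shows "prime_in (polys_over A) f"
proof -
  note D = ufdD[OF u] and A = ufdD(1)[OF u]
  note P = subringD[OF subring_polys_over[OF A]]
  have f': "f \<in> polys_over A" "f \<noteq> 0" "\<not> unit_in (polys_over A) f"
    "\<And>b c. b \<in> polys_over A \<Longrightarrow> c \<in> polys_over A \<Longrightarrow> f = b * c \<Longrightarrow> unit_in (polys_over A) b \<or> unit_in (polys_over A) c"
    using f unfolding irred_in_def by auto
  show ?thesis
  proof (cases "degree f = 0")
    case True
    then obtain a where a: "f = [:a:]" by (rule degree_eq_zeroE)
    have "irred_in A a"
      unfolding irred_in_def
    proof (intro conjI ballI impI)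
      show "a \<in> A" using f' a unfolding polys_over_def by (auto dest: spec[of _ 0])
      show "a \<noteq> 0" using f' a by auto
      show "\<not> unit_in A a" using f' a unit_in_polys_over_iff[OF A] by blast
      fix b c assume "b \<in> A" "c \<in> A" "a = b * c"
      then show "unit_in A b \<or> unit_in A c"
        using f'(4)[of "[:b:]" "[:c:]"] polys_over_const[OF A] unit_in_polys_over_iff[OF A] a by auto
    qed
    then show ?thesis using D(4) prime_in_const[OF A] a by blast
  next
    case False
    have prim: "primitive_over A f"
      unfolding primitive_over_def
    proof (intro conjI allI impI notI)
      fix \<pi> assume p: "prime_in A \<pi>" "dvd_in (polys_over A) [:\<pi>:] f"
      then obtain v where v: "v \<in> polys_over A" "f = [:\<pi>:] * v" unfolding dvd_in_def by blast
      have "\<not> unit_in (polys_over A) [:\<pi>:]" "\<pi> \<in> A"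
        using p prime_in_const[OF A] unfolding prime_in_def by auto
      then have "unit_in (polys_over A) v" using f'(4) v polys_over_const[OF A] by blast
      then have "degree v = 0" using unit_in_polys_over_iff[OF A] by auto
      then show False using False v by (simp add: degree_smult_eq split: if_splits)
    qed (use f' in auto)
    show ?thesis
      unfolding prime_in_def
    proof (intro conjI ballI impI)
      fix g h assume gh: "g \<in> polys_over A" "h \<in> polys_over A" "dvd_in (polys_over A) f (g * h)"
      then obtain k where k: "k \<in> polys_over A" "g * h = f * k" unfolding dvd_in_def by blast
      show "dvd_in (polys_over A) f g \<or> dvd_in (polys_over A) f h"
      proof (rule disjCI)
        assume nh: "\<not> dvd_in (polys_over A) f h"
        define J where "J = {a * f + b * g |a b. a \<in> polys_over A \<and> b \<in> polys_over A}"
        have fJ: "f \<in> J" and gJ: "g \<in> J"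
          unfolding J_def using P(1,2) by (auto intro: exI[of _ 0] exI[of _ 1], metis add_0_right mult_1 mult_zero_left, metis add_0_left mult_1 mult_zero_left)
        obtain w where w: "w \<in> J" "w \<noteq> 0" and min: "\<And>v. v \<in> J \<Longrightarrow> v \<noteq> 0 \<Longrightarrow> degree w \<le> degree v"
          using ex_has_least_nat[of "\<lambda>w. w \<in> J \<and> w \<noteq> 0" f degree] fJ f' by blast
        have JA: "J \<subseteq> polys_over A" unfolding J_def using f' gh P(3,5) by auto
        have Jc: "c * a - q * b \<in> J"
          if aJ: "a \<in> J" and bJ: "b \<in> J" and cq: "c \<in> polys_over A" "q \<in> polys_over A" for a b c q
        proof -
          obtain a1 a2 where a: "a = a1 * f + a2 * g" "a1 \<in> polys_over A" "a2 \<in> polys_over A"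
            using aJ unfolding J_def by blast
          obtain b1 b2 where b: "b = b1 * f + b2 * g" "b1 \<in> polys_over A" "b2 \<in> polys_over A"
            using bJ unfolding J_def by blast
          note ab = a b
          have "c * a - q * b = (c * a1 - q * b1) * f + (c * a2 - q * b2) * g"
            unfolding ab by (simp add: algebra_simps)
          moreover have "c * a1 - q * b1 \<in> polys_over A" "c * a2 - q * b2 \<in> polys_over A"
            using cq ab P(4,5) by auto
          ultimately show ?thesis unfolding J_def by blast
        qed
        obtain b w' where w': "b \<in> A" "b \<noteq> 0" "primitive_over A w'" "w = smult b w'"
          using primitive_part[OF u] w JA by blast
        have w'A: "w' \<in> polys_over A" using w' unfolding primitive_over_def by blast
        obtain c v where c: "c \<in> A" "c \<noteq> 0" "v \<in> polys_over A" "smult c f = w * v"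
          using min_degree_pseudo_dvd[OF A JA w min Jc fJ] by blast
        have "smult c f = w' * smult b v" using c w' by simp
        then have "dvd_in (polys_over A) w' f"
          using primitive_cancel_const[OF u w'(3) c(1,2) f'(1)] polys_over_smult[OF A] w' c by blast
        then obtain v' where v': "v' \<in> polys_over A" "f = w' * v'" unfolding dvd_in_def by blast
        then consider "unit_in (polys_over A) w'" | "unit_in (polys_over A) v'" using f'(4) w'A by blast
        then show "dvd_in (polys_over A) f g"
        proof cases
          case 1
          then obtain a where "w' = [:a:]" "unit_in A a" using unit_in_polys_over_iff[OF A] by blast
          \<comment> \<open>The ideal (f, g) contains a non-zero constant, so f divides a constant
            multiple of h, and primitivity of f cancels the constant.\<close>
          then have e: "w = [:b * a:]" "b * a \<in> A" "b * a \<noteq> 0"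
            using w' w subringD(5)[OF A] unfolding unit_in_def by auto
          obtain a1 a2 where a: "w = a1 * f + a2 * g" "a1 \<in> polys_over A" "a2 \<in> polys_over A"
            using w unfolding J_def by blast
          have "smult (b * a) h = w * h" using e by simp
          also have "\<dots> = f * (a1 * h + a2 * k)" using k a by (simp add: algebra_simps)
          finally have eq: "smult (b * a) h = f * (a1 * h + a2 * k)" .
          have "a1 * h + a2 * k \<in> polys_over A" by (intro P(3,5) a k gh)
          from primitive_cancel_const[OF u prim e(2,3) gh(2) this eq]
          have "dvd_in (polys_over A) f h" .
          then show ?thesis using nh by blast
        next
          case 2
          then obtain z where z: "z \<in> polys_over A" "v' * z = 1" unfolding unit_in_def by blast
          \<comment> \<open>Now f is an associate of the primitive part of w, so it divides a
            constant multiple of g.\<close>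
          then have wf: "w' = f * z" using v' by (simp add: mult.assoc)
          obtain c' v2 where c': "c' \<in> A" "c' \<noteq> 0" "v2 \<in> polys_over A" "smult c' g = w * v2"
            using min_degree_pseudo_dvd[OF A JA w min Jc gJ] by blast
          then have eq: "smult c' g = f * (smult b z * v2)" using w' wf by (simp add: mult.assoc)
          have "smult b z * v2 \<in> polys_over A" by (intro P(5) polys_over_smult[OF A] w' z c')
          from primitive_cancel_const[OF u prim c'(1,2) gh(1) this eq] show ?thesis .
        qed
      qed
    qed (use f' in auto)
  qed
qed

text \<open>The new size is additive because degrees add and leading coefficients multiply. It is
  zero exactly for constants that are units of A.\<close>

lemma ufd_polys_over:
  assumes u: "ufd A \<delta>"
  shows "ufd (polys_over A) (\<lambda>f. degree f + \<delta> (lead_coeff f))"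
proof -
  note D = ufdD[OF u] and A = ufdD(1)[OF u]
  have lA: "lead_coeff f \<in> A" if "f \<in> polys_over A" for f using that unfolding polys_over_def by auto
  have "degree f + \<delta> (lead_coeff f) = 0 \<longleftrightarrow> unit_in (polys_over A) f"
    if f: "f \<in> polys_over A" "f \<noteq> 0" for f
  proof -
    have "degree f + \<delta> (lead_coeff f) = 0 \<longleftrightarrow> degree f = 0 \<and> unit_in A (lead_coeff f)"
      using D(3)[OF lA[OF f(1)]] f by auto
    also have "\<dots> \<longleftrightarrow> (\<exists>a. f = [:a:] \<and> unit_in A a)"
      by (auto elim!: degree_eq_zeroE)
    finally show ?thesis unfolding unit_in_polys_over_iff[OF A] .
  qed
  moreover have "degree (f * g) + \<delta> (lead_coeff (f * g)) = (degree f + \<delta> (lead_coeff f)) + (degree g + \<delta> (lead_coeff g))"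
    if "f \<in> polys_over A" "g \<in> polys_over A" "f \<noteq> 0" "g \<noteq> 0" for f g
    unfolding lead_coeff_mult using that D(2)[OF lA lA, of f g] by (simp add: degree_mult_eq)
  ultimately show ?thesis
    unfolding ufd_def using subring_polys_over[OF A] irred_in_polys_over_imp_prime[OF u] by simp
qed

text \<open>Transport along a ring embedding: the ring of polynomials in n + 1 variables is not
  itself a set of univariate polynomials but the image of one under evaluation at
  \<open>Var n\<close>.\<close>

lemma ufd_image:
  fixes \<phi> :: "'r::idom \<Rightarrow> 's::idom"
  assumes u: "ufd B \<delta>" and inj: "inj_on \<phi> B" and [simp]: "\<phi> 0 = 0" "\<phi> 1 = 1"
    and add: "\<And>a b. \<phi> (a + b) = \<phi> a + \<phi> b" and diff: "\<And>a b. \<phi> (a - b) = \<phi> a - \<phi> b"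
    and mult: "\<And>a b. \<phi> (a * b) = \<phi> a * \<phi> b"
  shows "ufd (\<phi> ` B) (\<delta> \<circ> inv_into B \<phi>)"
proof -
  note D = ufdD[OF u] and B = subringD[OF ufdD(1)[OF u]]
  have eq: "\<phi> a = \<phi> b \<longleftrightarrow> a = b" if "a \<in> B" "b \<in> B" for a b using inj that by (auto dest: inj_onD)
  have inv [simp]: "inv_into B \<phi> (\<phi> a) = a" if "a \<in> B" for a using inj that by simp
  have 0: "\<phi> a = 0 \<longleftrightarrow> a = 0" if "a \<in> B" for a using eq[OF that B(1)] by simp
  have sub: "subring (\<phi> ` B)"
    unfolding subring_def using B by (auto simp: add[symmetric] diff[symmetric] mult[symmetric] intro: image_eqI[of _ _ 0] image_eqI[of _ _ 1])
  have unit: "unit_in (\<phi> ` B) (\<phi> a) \<longleftrightarrow> unit_in B a" if "a \<in> B" for a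
  proof -
    have "\<phi> a * \<phi> b = 1 \<longleftrightarrow> a * b = 1" if "b \<in> B" for b
      using eq[of "a * b" 1] \<open>a \<in> B\<close> that B by (simp add: mult)
    then show ?thesis unfolding unit_in_def using that by auto
  qed
  have dvd: "dvd_in (\<phi> ` B) (\<phi> a) (\<phi> b) \<longleftrightarrow> dvd_in B a b" if "a \<in> B" "b \<in> B" for a b
  proof -
    have "\<phi> b = \<phi> a * \<phi> c \<longleftrightarrow> b = a * c" if "c \<in> B" for c
      using eq[of b "a * c"] \<open>a \<in> B\<close> \<open>b \<in> B\<close> that B by (simp add: mult)
    then show ?thesis unfolding dvd_in_def using that by auto
  qed
  have prod: "\<phi> a = \<phi> b * \<phi> c \<longleftrightarrow> a = b * c" if "a \<in> B" "b \<in> B" "c \<in> B" for a b c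
    using eq[of a "b * c"] that B by (simp add: mult)
  have irr: "irred_in B a" if "irred_in (\<phi> ` B) (\<phi> a)" "a \<in> B" for a
    using that unfolding irred_in_def by (auto simp: unit 0 prod)
  have pr: "prime_in (\<phi> ` B) (\<phi> a)" if "prime_in B a" for a
  proof -
    have "a \<in> B" using that unfolding prime_in_def by blast
    then show ?thesis
      using that B unfolding prime_in_def by (auto simp: unit 0 dvd mult[symmetric])
  qed
  show ?thesis
    unfolding ufd_def
  proof (intro conjI ballI allI impI)
    fix a assume "irred_in (\<phi> ` B) a"
    moreover then obtain b where "b \<in> B" "a = \<phi> b" unfolding irred_in_def by blast
    ultimately show "prime_in (\<phi> ` B) a" using irr pr D(4) by blast
  qed (use sub D(2,3) B in \<open>auto simp: unit 0 mult[symmetric]\<close>)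
qed

lemma ufd_polys_in:
  shows "\<exists>\<delta>. ufd (polys_in {..<n} :: 'a::alg_closed_field mpoly set) \<delta>"
proof (induction n)
  case 0
  have un: "unit_in (polys_in {..<0}) a" if "a \<in> polys_in {..<0}" "a \<noteq> 0" for a :: "'a mpoly"
  proof -
    obtain c where a: "a = Const c" using \<open>a \<in> polys_in {..<0}\<close> polys_in_empty by auto
    then have "c \<noteq> 0" using that by auto
    then have "a * Const (inverse c) = 1" by (simp add: a mult_single)
    then show ?thesis using that unfolding unit_in_def by (auto intro!: bexI[of _ "Const (inverse c)"])
  qed
  \<comment> \<open>The ring is the field of constants: every non-zero element is a unit, so the
    size is 0 throughout and there are no irreducible elements.\<close>
  then have "ufd (polys_in {..<0} :: 'a mpoly set) (\<lambda>_. 0)"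
    unfolding ufd_def irred_in_def by auto
  then show ?case by blast
next
  case (Suc n)
  then obtain \<delta> where "ufd (polys_in {..<n} :: 'a mpoly set) \<delta>" by blast
  note u = ufd_polys_over[OF this]
  let ?\<phi> = "\<lambda>Q :: 'a mpoly poly. poly Q (Var n)"
  have "inj_on ?\<phi> (polys_over (polys_in {..<n}))"
  proof (rule inj_onI)
    fix P Q :: "'a mpoly poly" assume PQ: "P \<in> polys_over (polys_in {..<n})" "Q \<in> polys_over (polys_in {..<n})" "?\<phi> P = ?\<phi> Q"
    then have "P - Q \<in> polys_over (polys_in {..<n})" "poly (P - Q) (Var n) = 0"
      using subringD(4)[OF subring_polys_over[OF subring_polys_in]] by auto
    then have "P - Q = 0" using poly_Var_eq_0_iff[of "P - Q" "{..<n}" n] by simp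
    then show "P = Q" by simp
  qed
  from ufd_image[OF u this] have "\<exists>\<delta>. ufd (?\<phi> ` polys_over (polys_in {..<n})) \<delta>" by auto
  moreover have "?\<phi> ` polys_over (polys_in {..<n}) = polys_in {..<Suc n}"
  proof (intro equalityI subsetI)
    fix p assume "p \<in> ?\<phi> ` polys_over (polys_in {..<n})"
    then obtain Q where "Q \<in> polys_over (polys_in {..<n})" "p = poly Q (Var n)" by blast
    moreover have "polys_over (polys_in {..<n}) \<subseteq> (polys_over (polys_in {..<Suc n}) :: 'a mpoly poly set)"
      using polys_in_mono[of "{..<n}" "{..<Suc n}"] by (fastforce simp: polys_over_def)
    ultimately show "p \<in> polys_in {..<Suc n}"
      using poly_in_subring[OF subring_polys_in] polys_in_Var[of n "{..<Suc n}"] by auto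
  next
    fix p :: "'a mpoly" assume "p \<in> polys_in {..<Suc n}"
    then have "p \<in> polys_in (insert n {..<n})" by (simp add: lessThan_Suc)
    then show "p \<in> ?\<phi> ` polys_over (polys_in {..<n})"
      by (elim polys_in_insert_decompose) auto
  qed
  ultimately show ?case by simp
qed

text \<open>The generator is the primitive part F of an element of least degree. It lies in I
  because I is prime and contains no non-zero constant. By minimality F divides a constant multiple
  of every G in I, and primitivity cancels the constant.\<close>

lemma prime_ideal_principal:
  assumes u: "ufd A \<delta>" and I: "I \<subseteq> polys_over A" "F0 \<in> I" "F0 \<noteq> 0"
    and lin: "\<And>a b c q. a \<in> I \<Longrightarrow> b \<in> I \<Longrightarrow> c \<in> polys_over A \<Longrightarrow> q \<in> polys_over A \<Longrightarrow> c * a - q * b \<in> I"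
    and prime: "\<And>a b. a \<in> polys_over A \<Longrightarrow> b \<in> polys_over A \<Longrightarrow> a * b \<in> I \<Longrightarrow> a \<in> I \<or> b \<in> I"
    and const: "\<And>a. [:a:] \<in> I \<Longrightarrow> a = 0"
  obtains F where "F \<in> I" "F \<noteq> 0" "\<And>G. G \<in> I \<Longrightarrow> dvd_in (polys_over A) F G"
proof -
  note A = ufdD(1)[OF u]
  obtain w where w: "w \<in> I" "w \<noteq> 0" and min: "\<And>v. v \<in> I \<Longrightarrow> v \<noteq> 0 \<Longrightarrow> degree w \<le> degree v"
    using ex_has_least_nat[of "\<lambda>w. w \<in> I \<and> w \<noteq> 0" F0 degree] I by blast
  obtain b F where F: "b \<in> A" "b \<noteq> 0" "primitive_over A F" "w = smult b F"
    using primitive_part[OF u] w I by blast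
  have FA: "F \<in> polys_over A" "F \<noteq> 0" using F unfolding primitive_over_def by auto
  have "[:b:] * F \<in> I" using F w by simp
  then have FI: "F \<in> I" using prime FA polys_over_const[OF A F(1)] const F by blast
  have min': "degree F \<le> degree v" if "v \<in> I" "v \<noteq> 0" for v
    using min[OF that] F by simp
  have "dvd_in (polys_over A) F G" if G: "G \<in> I" for G
  proof -
    obtain c v where "c \<in> A" "c \<noteq> 0" "v \<in> polys_over A" "smult c G = F * v"
      using min_degree_pseudo_dvd[OF A I(1) FI FA(2) min' lin G] by blast
    then show ?thesis using primitive_cancel_const[OF u F(3)] G I by blast
  qed
  with that FI FA show ?thesis by blast
qed

section \<open>Extending homomorphisms along finite ring extensions\<close>

definition hom_on :: "'r::comm_ring_1 set \<Rightarrow> ('r \<Rightarrow> 'k::field) \<Rightarrow> bool" where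
  "hom_on S \<chi> \<longleftrightarrow> \<chi> 1 = 1 \<and> (\<forall>a\<in>S. \<forall>b\<in>S. \<chi> (a + b) = \<chi> a + \<chi> b \<and> \<chi> (a * b) = \<chi> a * \<chi> b)"

lemma hom_onD:
  assumes "hom_on S \<chi>" "subring S"
  shows "\<chi> 1 = 1" "a \<in> S \<Longrightarrow> b \<in> S \<Longrightarrow> \<chi> (a + b) = \<chi> a + \<chi> b"
    "a \<in> S \<Longrightarrow> b \<in> S \<Longrightarrow> \<chi> (a * b) = \<chi> a * \<chi> b" "\<chi> 0 = 0"
    "a \<in> S \<Longrightarrow> b \<in> S \<Longrightarrow> \<chi> (a - b) = \<chi> a - \<chi> b"
proof -
  note S = subringD[OF assms(2)]
  show 1: "\<chi> 1 = 1" "a \<in> S \<Longrightarrow> b \<in> S \<Longrightarrow> \<chi> (a + b) = \<chi> a + \<chi> b"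
    "a \<in> S \<Longrightarrow> b \<in> S \<Longrightarrow> \<chi> (a * b) = \<chi> a * \<chi> b" for a b
    using assms unfolding hom_on_def by auto
  show "\<chi> 0 = 0" using 1(2)[OF S(1) S(1)] by (metis add_0_right add_cancel_left_right)
  show "\<chi> (a - b) = \<chi> a - \<chi> b" if "a \<in> S" "b \<in> S"
    using 1(2)[OF S(4)[OF that] that(2)] by simp
qed

lemma hom_on_sum:
  assumes "hom_on S \<chi>" "subring S" "\<And>i. i \<in> I \<Longrightarrow> f i \<in> S"
  shows "\<chi> (sum f I) = (\<Sum>i\<in>I. \<chi> (f i))"
  using assms(3)
proof (induction I rule: infinite_finite_induct)
  case (insert i I)
  then have "f i \<in> S" "sum f I \<in> S" using subring_sum[OF assms(2), of I f] by auto
  then show ?case using insert hom_onD(2)[OF assms(1,2)] by simp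
qed (use hom_onD(4)[OF assms(1,2)] in auto)

lemma map_poly_hom_on:
  assumes h: "hom_on S \<chi>" and S: "subring S" and GH: "G \<in> polys_over S" "H \<in> polys_over S"
  shows "map_poly \<chi> (G + H) = map_poly \<chi> G + map_poly \<chi> H"
    "map_poly \<chi> (G - H) = map_poly \<chi> G - map_poly \<chi> H"
    "map_poly \<chi> (G * H) = map_poly \<chi> G * map_poly \<chi> H"
proof -
  note D = hom_onD[OF h S]
  note c = coeff_map_poly[of \<chi>, OF D(4)]
  have A: "coeff G i \<in> S" "coeff H i \<in> S" for i using GH unfolding polys_over_def by auto
  show "map_poly \<chi> (G + H) = map_poly \<chi> G + map_poly \<chi> H"
    "map_poly \<chi> (G - H) = map_poly \<chi> G - map_poly \<chi> H"
    using A by (auto intro!: poly_eqI simp: c D)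
  have "\<chi> (\<Sum>i\<le>n. coeff G i * coeff H (n - i)) = (\<Sum>i\<le>n. \<chi> (coeff G i) * \<chi> (coeff H (n - i)))" for n
    using A subringD(5)[OF S] by (subst hom_on_sum[OF h S]) (auto simp: D(3))
  then show "map_poly \<chi> (G * H) = map_poly \<chi> G * map_poly \<chi> H"
    by (intro poly_eqI) (simp add: c coeff_mult)
qed

text \<open>Modulo the kernel of \<open>\<chi>\<close> the matrix \<open>a\<close> is an invertible diagonal matrix, so \<open>d\<close> can play the part
  of its determinant; Gaussian elimination avoids determinants of variable size.\<close>

lemma elimination:
  fixes b :: "nat \<Rightarrow> 'r::comm_ring_1" and \<chi> :: "'r \<Rightarrow> 'k::field"
  assumes h: "hom_on S \<chi>" and S: "subring S"
    and "\<And>k l. a k l \<in> S"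
    and "\<And>k. k < c \<Longrightarrow> (\<Sum>l<c. a k l * b l) = 0"
    and "\<And>k. k < c \<Longrightarrow> \<chi> (a k k) \<noteq> 0"
    and "\<And>k l. k < c \<Longrightarrow> l < c \<Longrightarrow> k \<noteq> l \<Longrightarrow> \<chi> (a k l) = 0"
  shows "\<exists>d\<in>S. \<chi> d \<noteq> 0 \<and> (\<forall>k<c. d * b k = 0)"
  using assms(3-)
proof (induction c arbitrary: a)
  case 0
  then show ?case using subringD(2)[OF S] hom_onD(1)[OF h S] by (intro bexI[of _ 1]) auto
next
  case (Suc c)
  note D = hom_onD[OF h S] and R = subringD[OF S]
  \<comment> \<open>The unknown \<open>b c\<close> is eliminated with row c. Under \<chi> the
    correction term vanishes, so the smaller matrix is again diagonal with non-zero diagonal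
    entries.\<close>
  let ?a = "\<lambda>k l. a c c * a k l - a k c * a c l"
  have row: "(\<Sum>l<c. a k l * b l) = - (a k c * b c)" if "k < Suc c" for k
    using Suc.prems(2)[OF that] by (simp add: eq_neg_iff_add_eq_0)
  have "\<exists>d\<in>S. \<chi> d \<noteq> 0 \<and> (\<forall>k<c. d * b k = 0)"
  proof (rule Suc.IH[of ?a])
    show "?a k l \<in> S" for k l using R Suc.prems(1) by auto
    show "(\<Sum>l<c. ?a k l * b l) = 0" if "k < c" for k
    proof -
      have "(\<Sum>l<c. ?a k l * b l) = a c c * (\<Sum>l<c. a k l * b l) - a k c * (\<Sum>l<c. a c l * b l)"
        unfolding sum_distrib_left sum_subtractf[symmetric] by (intro sum.cong) (auto simp: algebra_simps)
      then show ?thesis using row[of k] row[of c] that by (simp add: algebra_simps)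
    qed
    show "\<chi> (?a k k) \<noteq> 0" if "k < c" for k
      using that Suc.prems by (simp add: D R)
    show "\<chi> (?a k l) = 0" if "k < c" "l < c" "k \<noteq> l" for k l
      using that Suc.prems by (simp add: D R)
  qed
  then obtain d where d: "d \<in> S" "\<chi> d \<noteq> 0" "\<forall>k<c. d * b k = 0" by blast
  have "d * (a c c * b c) = - (\<Sum>l<c. a c l * (d * b l))"
    using arg_cong[OF row[of c], of "(*) d"] by (simp add: sum_distrib_left mult.left_commute)
  then have "(d * a c c) * b c = 0" using d by (simp add: mult.assoc)
  moreover have "(d * a c c) * b k = 0" if "k < c" for k
    using d(3) that by (metis mult.assoc mult.commute mult_zero_right)
  ultimately have "\<forall>k<Suc c. (d * a c c) * b k = 0" by (auto simp: less_Suc_eq)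
  moreover have "d * a c c \<in> S" "\<chi> (d * a c c) \<noteq> 0" using d Suc.prems D R by auto
  ultimately show ?case by blast
qed

text \<open>The whole ambient ring is a finite module over S. The property passes to larger S, so
  that one family b serves for all extension steps.\<close>

definition spans_over :: "'r::comm_ring_1 set \<Rightarrow> nat \<Rightarrow> (nat \<Rightarrow> 'r) \<Rightarrow> bool" where
  "spans_over S c b \<longleftrightarrow> (\<forall>r. \<exists>p. (\<forall>l. p l \<in> S) \<and> r = (\<Sum>l<c. p l * b l))"

lemma spans_over_mono: "spans_over S c b \<Longrightarrow> S \<subseteq> S' \<Longrightarrow> spans_over S' c b"
  unfolding spans_over_def by (meson subsetD)

text \<open>The ideal generated by the kernel of \<chi> stays proper in the finite extension (lying
  over, Nakayama). Multiplying the relation G(x) = 0 by each b_k and expanding in b gives a square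
  system that becomes e times the identity under \<chi>. If e were non-zero, an element d outside
  the kernel would annihilate all b_l, hence also 1.\<close>

lemma no_unit_specialisation:
  fixes b :: "nat \<Rightarrow> 'r::comm_ring_1" and \<chi> :: "'r \<Rightarrow> 'k::field"
  assumes h: "hom_on S \<chi>" and S: "subring S" and sp: "spans_over S c b"
    and G: "G \<in> polys_over S" "poly G x = 0" and e: "map_poly \<chi> G = [:e:]"
  shows "e = 0"
proof (rule ccontr)
  assume "e \<noteq> 0"
  note D = hom_onD[OF h S] and R = subringD[OF S]
  have GA: "coeff G i \<in> S" for i using G unfolding polys_over_def by auto
  have \<chi>G: "\<chi> (coeff G i) = (if i = 0 then e else 0)" for i
    using arg_cong[OF e, of "\<lambda>q. coeff q i"] by (auto simp: coeff_map_poly D(4) coeff_pCons split: nat.splits)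
  obtain p where p: "\<And>r l. p r l \<in> S" "\<And>r. r = (\<Sum>l<c. p r l * b l)"
    using sp unfolding spans_over_def by metis
  \<comment> \<open>Row k expresses \<open>poly G x * b k\<close> in the generators. The constant
    coefficient stays on the diagonal; all coefficients of positive index are killed by
    \<chi>.\<close>
  define a where "a k l = (if k = l then coeff G 0 else 0) + (\<Sum>j=1..degree G. coeff G j * p (x ^ j * b k) l)" for k l
  have t: "(\<Sum>j=1..degree G. coeff G j * p (x ^ j * b k) l) \<in> S" for k l
    using GA p(1) R by (intro subring_sum[OF S]) auto
  have aS: "a k l \<in> S" for k l unfolding a_def using R GA t by auto
  have "\<exists>d\<in>S. \<chi> d \<noteq> 0 \<and> (\<forall>k<c. d * b k = 0)"
  proof (rule elimination[OF h S, of a])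
    show "a k l \<in> S" for k l by (rule aS)
    show "(\<Sum>l<c. a k l * b l) = 0" if "k < c" for k
    proof -
      have "(\<Sum>l<c. a k l * b l) = (\<Sum>l<c. (if k = l then coeff G 0 else 0) * b l)
          + (\<Sum>l<c. \<Sum>j=1..degree G. coeff G j * (p (x ^ j * b k) l * b l))"
        unfolding a_def by (simp add: distrib_right sum.distrib sum_distrib_right mult.assoc)
      also have "(\<Sum>l<c. (if k = l then coeff G 0 else 0) * b l) = (\<Sum>l<c. if k = l then coeff G 0 * b l else 0)"
        by (intro sum.cong) auto
      also have "\<dots> = coeff G 0 * b k"
        using that by simp
      also have "(\<Sum>l<c. \<Sum>j=1..degree G. coeff G j * (p (x ^ j * b k) l * b l))
          = (\<Sum>j=1..degree G. coeff G j * (\<Sum>l<c. p (x ^ j * b k) l * b l))"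
        by (subst sum.swap) (simp add: sum_distrib_left)
      also have "\<dots> = (\<Sum>j=1..degree G. coeff G j * (x ^ j * b k))"
        by (simp only: p(2)[symmetric])
      also have "coeff G 0 * b k + \<dots> = poly G x * b k"
        unfolding poly_altdef by (simp add: sum.atLeast1_atMost_eq sum.atMost_shift sum_distrib_right distrib_right mult.assoc lessThan_Suc_atMost atLeast0AtMost)
      finally show ?thesis using G by simp
    qed
    have "\<chi> (a k l) = (if k = l then e else 0)" for k l
    proof -
      have "\<chi> (\<Sum>j=1..degree G. coeff G j * p (x ^ j * b k) l) = 0"
        using GA p(1) R by (subst hom_on_sum[OF h S]) (auto simp: D(3) \<chi>G)
      then show ?thesis unfolding a_def using D(2)[OF _ t] GA R(1) by (simp add: \<chi>G D(4))
    qed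
    then show "\<chi> (a k k) \<noteq> 0" "k \<noteq> l \<Longrightarrow> \<chi> (a k l) = 0" for k l using \<open>e \<noteq> 0\<close> by auto
  qed
  then obtain d where d: "d \<in> S" "\<chi> d \<noteq> 0" "\<forall>k<c. d * b k = 0" by blast
  have "d = d * (\<Sum>l<c. p 1 l * b l)" using p(2)[of 1] by simp
  also have "\<dots> = (\<Sum>l<c. p 1 l * (d * b l))" by (simp add: sum_distrib_left mult.left_commute)
  also have "\<dots> = 0" using d(3) by simp
  finally show False using d(2) D(4) by simp
qed

text \<open>The images under \<chi> of the relations satisfied by x form an ideal of univariate
  polynomials over the field. By \<open>no_unit_specialisation\<close> it contains no non-zero
  constant, so its elements have a common root \<xi> in the algebraically closed field, and x can be
  sent to \<xi>.\<close>

lemma hom_extend_step: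
  fixes b :: "nat \<Rightarrow> 'r::comm_ring_1" and \<chi> :: "'r \<Rightarrow> 'k::alg_closed_field"
  assumes h: "hom_on S \<chi>" and S: "subring S" and sp: "spans_over S c b"
    and surj: "\<And>k. \<exists>s\<in>S. \<chi> s = k"
  shows "\<exists>S' \<chi>'. subring S' \<and> S \<subseteq> S' \<and> x \<in> S' \<and> hom_on S' \<chi>' \<and> (\<forall>s\<in>S. \<chi>' s = \<chi> s)"
proof -
  note D = hom_onD[OF h S] and R = subringD[OF S] and P = subringD[OF subring_polys_over[OF S]]
  note M = map_poly_hom_on[OF h S]
  define \<aa> where "\<aa> = {map_poly \<chi> G |G. G \<in> polys_over S \<and> poly G x = 0}"
  have "\<exists>\<xi>. \<forall>E\<in>\<aa>. poly E \<xi> = 0"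
  proof (cases "\<aa> \<subseteq> {0}")
    case True
    then show ?thesis by fastforce
  next
    case False
    then obtain D0 where "D0 \<in> \<aa> \<and> D0 \<noteq> 0" by blast
    then obtain d where d: "d \<in> \<aa>" "d \<noteq> 0" and min: "\<And>E. E \<in> \<aa> \<Longrightarrow> E \<noteq> 0 \<Longrightarrow> degree d \<le> degree E"
      using ex_has_least_nat[of "\<lambda>d. d \<in> \<aa> \<and> d \<noteq> 0" D0 degree] by blast
    have "degree d \<noteq> 0"
    proof
      assume "degree d = 0"
      then obtain e where "d = [:e:]" by (rule degree_eq_zeroE)
      then show False using d no_unit_specialisation[OF h S sp] unfolding \<aa>_def by auto
    qed
    then obtain \<xi> where \<xi>: "poly d \<xi> = 0" using alg_closed_imp_poly_has_root by blast
    have "poly E \<xi> = 0" if E: "E \<in> \<aa>" for E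
    proof -
      \<comment> \<open>Surjectivity of \<chi> lifts the quotient \<open>E div d\<close>, so that
        the remainder is again the image of a relation and vanishes by minimality of the degree of
        d.\<close>
      have "\<exists>H\<in>polys_over S. map_poly \<chi> H = q" for q :: "'k poly"
      proof -
        obtain s where s: "\<And>k. s k \<in> S" "\<And>k. \<chi> (s k) = k" using surj by metis
        define H where "H = (\<Sum>i\<le>degree q. monom (s (coeff q i)) i)"
        have cH: "coeff H i = (if i \<le> degree q then s (coeff q i) else 0)" for i
          unfolding H_def by (simp add: coeff_sum)
        then have "H \<in> polys_over S" using s R by (auto simp: polys_over_def)
        moreover have "map_poly \<chi> H = q"
          using s(2) by (intro poly_eqI) (auto simp: coeff_map_poly D(4) cH coeff_eq_0)
        ultimately show ?thesis by blast
      qed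
      then obtain H where H: "H \<in> polys_over S" "map_poly \<chi> H = E div d" by blast
      obtain G where G: "G \<in> polys_over S" "poly G x = 0" "E = map_poly \<chi> G" using E unfolding \<aa>_def by blast
      obtain F where F: "F \<in> polys_over S" "poly F x = 0" "d = map_poly \<chi> F" using d unfolding \<aa>_def by blast
      have "map_poly \<chi> (G - H * F) = E - (E div d) * d"
        using M(2)[OF G(1) P(5)[OF H(1) F(1)]] M(3)[OF H(1) F(1)] G F H by simp
      moreover have "poly (G - H * F) x = 0" "G - H * F \<in> polys_over S" using G F H P by auto
      ultimately have "E - (E div d) * d \<in> \<aa>" unfolding \<aa>_def by (metis (mono_tags, lifting) mem_Collect_eq)
      then have "E mod d \<in> \<aa>" by (simp add: minus_div_mult_eq_mod)
      then have "E mod d = 0"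
        using min d(2) degree_mod_less[OF d(2), of E] by fastforce
      then have "E = E div d * d" by (metis add_0_right div_mult_mod_eq)
      then show ?thesis using \<xi> by (metis mult_zero_right poly_mult)
    qed
    then show ?thesis by blast
  qed
  then obtain \<xi> where \<xi>: "\<And>G. G \<in> polys_over S \<Longrightarrow> poly G x = 0 \<Longrightarrow> poly (map_poly \<chi> G) \<xi> = 0"
    unfolding \<aa>_def by blast
  define S' where "S' = (\<lambda>G. poly G x) ` polys_over S"
  define \<chi>' where "\<chi>' r = poly (map_poly \<chi> (SOME G. G \<in> polys_over S \<and> poly G x = r)) \<xi>" for r
  \<comment> \<open>The choice of representative does not matter: two of them differ by a relation
    of x, whose image vanishes at \<xi>.\<close>
  have \<chi>': "\<chi>' (poly G x) = poly (map_poly \<chi> G) \<xi>" if G: "G \<in> polys_over S" for G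
  proof -
    let ?H = "SOME H. H \<in> polys_over S \<and> poly H x = poly G x"
    have H: "?H \<in> polys_over S \<and> poly ?H x = poly G x"
      by (rule someI[of _ G]) (use G in auto)
    then have "poly (map_poly \<chi> (?H - G)) \<xi> = 0" using \<xi>[of "?H - G"] G P by auto
    then show ?thesis unfolding \<chi>'_def using M(2)[of ?H G] H G by simp
  qed
  have const: "s = poly [:s:] x" "[:s:] \<in> polys_over S" if "s \<in> S" for s
    using that polys_over_const[OF S] by auto
  have "subring S'"
    unfolding subring_def S'_def
  proof (intro conjI ballI)
    show "0 \<in> (\<lambda>G. poly G x) ` polys_over S" "1 \<in> (\<lambda>G. poly G x) ` polys_over S"
      using P(1,2) by (auto intro: image_eqI[of _ _ 0] image_eqI[of _ _ 1])
  qed (use P in \<open>auto simp flip: poly_add poly_diff poly_mult\<close>)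
  moreover have "S \<subseteq> S'" using const unfolding S'_def by blast
  moreover have "x \<in> S'" unfolding S'_def
    using polys_over_monom[OF S R(2), of 1] by (intro image_eqI[of _ _ "monom 1 1"]) (auto simp: poly_monom)
  moreover have ext: "\<chi>' s = \<chi> s" if "s \<in> S" for s
  proof -
    have "map_poly \<chi> [:s:] = [:\<chi> s:]"
      by (intro poly_eqI) (simp add: coeff_map_poly D(4) coeff_pCons split: nat.splits)
    then show ?thesis using \<chi>'[OF const(2)[OF that]] by simp
  qed
  moreover have "hom_on S' \<chi>'"
    unfolding hom_on_def
  proof (intro conjI ballI)
    show "\<chi>' 1 = 1" using ext[OF R(2)] D(1) by simp
    fix a b assume "a \<in> S'" "b \<in> S'"
    then obtain G H where GH: "G \<in> polys_over S" "H \<in> polys_over S" "a = poly G x" "b = poly H x"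
      unfolding S'_def by blast
    show "\<chi>' (a + b) = \<chi>' a + \<chi>' b"
      using \<chi>'[OF P(3)[OF GH(1,2)]] GH by (simp add: \<chi>' M)
    show "\<chi>' (a * b) = \<chi>' a * \<chi>' b"
      using \<chi>'[OF P(5)[OF GH(1,2)]] GH by (simp add: \<chi>' M)
  qed
  ultimately show ?thesis by blast
qed

lemma hom_extend_finite:
  fixes b :: "nat \<Rightarrow> 'r::comm_ring_1" and \<chi> :: "'r \<Rightarrow> 'k::alg_closed_field"
  assumes "finite E" and h: "hom_on S \<chi>" and S: "subring S" and sp: "spans_over S c b"
    and surj: "\<And>k. \<exists>s\<in>S. \<chi> s = k"
  shows "\<exists>S' \<chi>'. subring S' \<and> S \<subseteq> S' \<and> E \<subseteq> S' \<and> hom_on S' \<chi>' \<and> (\<forall>s\<in>S. \<chi>' s = \<chi> s)"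
  using assms(1)
proof (induction E rule: finite_induct)
  case empty
  then show ?case using h S by blast
next
  case (insert x E)
  then obtain S1 \<chi>1 where 1: "subring S1" "S \<subseteq> S1" "E \<subseteq> S1" "hom_on S1 \<chi>1" "\<And>s. s \<in> S \<Longrightarrow> \<chi>1 s = \<chi> s"
    by blast
  have "\<exists>s\<in>S1. \<chi>1 s = k" for k using surj[of k] 1 by (metis subsetD)
  from hom_extend_step[OF 1(4,1) spans_over_mono[OF sp 1(2)] this, of x]
  obtain S2 \<chi>2 where "subring S2" "S1 \<subseteq> S2" "x \<in> S2" "hom_on S2 \<chi>2" "\<And>s. s \<in> S1 \<Longrightarrow> \<chi>2 s = \<chi>1 s"
    by blast
  with 1 show ?case by (intro exI[of _ S2] exI[of _ \<chi>2]) auto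
qed

section \<open>Vanishing ideals, and points obtained from homomorphisms\<close>

definition vanishing :: "(nat \<Rightarrow> 'a::field) set \<Rightarrow> 'a mpoly set" where
  "vanishing X = {p. \<forall>x\<in>X. ev x p = 0}"

text \<open>Uses the largest system of equations, so that none has to be chosen;
  \<open>closedin_zariski_algebraic\<close> shows that these are the closed sets.\<close>

definition algebraic_set :: "nat \<Rightarrow> (nat \<Rightarrow> 'a::field) set \<Rightarrow> bool" where
  "algebraic_set n X \<longleftrightarrow> X = {x \<in> affine_space n. \<forall>p\<in>vanishing X. ev x p = 0}"

lemma Var_vanishing: "X \<subseteq> affine_space n \<Longrightarrow> i \<ge> n \<Longrightarrow> Var i \<in> vanishing X"
  by (auto simp: vanishing_def affine_space_def)

text \<open>Serves as an induction principle: a property that is stable under the ring operations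
  holds for all polynomials if it holds for constants and variables.\<close>

lemma subring_UNIV_if:
  assumes S: "subring S" and "range Const \<subseteq> S" "range Var \<subseteq> (S :: 'a::field mpoly set)"
  shows "S = UNIV"
proof -
  have mon: "Poly_Mapping.single m 1 \<in> S" for m :: "nat \<Rightarrow>\<^sub>0 nat"
  proof (induction m rule: Poly_Mapping.update_induct)
    case const
    then show ?case using subringD(2)[OF S] by simp
  next
    case (update f a b)
    have "Poly_Mapping.update a b f = Poly_Mapping.single a b + f"
      using update(1) by (intro poly_mapping_eqI)
        (auto simp: lookup_update lookup_add lookup_single in_keys_iff when_def)
    then have "Poly_Mapping.single (Poly_Mapping.update a b f) 1 = Var a ^ b * (Poly_Mapping.single f 1 :: 'a mpoly)"
      by (simp add: Var_power mult_single)
    then show ?case using update assms subring_power[OF S] subringD(5)[OF S] by (metis range_subsetD)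
  qed
  have "p \<in> S" for p
  proof (induction p rule: mpoly_induct)
    case (add m c p)
    have "Poly_Mapping.single m c = Const c * Poly_Mapping.single m 1" by (simp add: mult_single)
    then show ?case using add mon[of m] assms subringD(3,5)[OF S] by (metis range_subsetD)
  qed (use subringD[OF S] in auto)
  then show ?thesis by blast
qed

text \<open>After extension to all variables, \<chi> is evaluation at the point with coordinates
  \<chi>(Var i). This point lies in X because \<open>vanishing X\<close> is in the kernel.\<close>

lemma exists_point_over_hom:
  fixes X :: "(nat \<Rightarrow> 'a::alg_closed_field) set"
  assumes X: "algebraic_set n X" and S: "subring S" "range Const \<subseteq> S" "vanishing X \<subseteq> S"
    and h: "hom_on S \<chi>" "\<And>k. \<chi> (Const k) = k" "\<And>p. p \<in> vanishing X \<Longrightarrow> \<chi> p = 0"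
    and sp: "spans_over S c b"
  obtains x where "x \<in> X" "\<And>s. s \<in> S \<Longrightarrow> ev x s = \<chi> s"
proof -
  have surj: "\<exists>s\<in>S. \<chi> s = k" for k using S h(2) by blast
  obtain S' \<chi>' where 1: "subring S'" "S \<subseteq> S'" "Var ` {..<n} \<subseteq> S'" "hom_on S' \<chi>'"
    "\<And>s. s \<in> S \<Longrightarrow> \<chi>' s = \<chi> s"
    using hom_extend_finite[OF _ h(1) S(1) sp surj, of "Var ` {..<n}"] by blast
  have aff: "X \<subseteq> affine_space n" using X unfolding algebraic_set_def by blast
  have "Var i \<in> S'" for i
    using 1 S(3) Var_vanishing[OF aff, of i] by (cases "i < n") auto
  then have U: "S' = UNIV" using subring_UNIV_if[OF 1(1)] S(2) 1(2) by blast
  note D = hom_onD[OF 1(4,1)]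
  define x where "x i = \<chi>' (Var i)" for i
  have Vx: "\<chi>' p = ev x p" for p
  proof -
    have "{p. \<chi>' p = ev x p} = UNIV"
    proof (rule subring_UNIV_if)
      show "subring {p. \<chi>' p = ev x p}" unfolding subring_def using D U by auto
      show "range Const \<subseteq> {p. \<chi>' p = ev x p}"
        using 1(5) S(2) h(2) by auto
      show "range Var \<subseteq> {p. \<chi>' p = ev x p}" by (auto simp: x_def)
    qed
    then show ?thesis by blast
  qed
  have "ev x p = 0" if "p \<in> vanishing X" for p
    using Vx[of p] 1(5) S(3) h(3) that by auto
  moreover from this have "x \<in> affine_space n"
    using Var_vanishing[OF aff] by (fastforce simp: affine_space_def)
  ultimately have "x \<in> X" using X unfolding algebraic_set_def by blast
  then show ?thesis using that Vx 1(5) by metis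
qed

section \<open>Noether normalisation and the transcendence degree\<close>

definition alg_indep :: "(nat \<Rightarrow> 'a::field) set \<Rightarrow> nat set \<Rightarrow> (nat \<Rightarrow> 'a mpoly) \<Rightarrow> bool" where
  "alg_indep X J y \<longleftrightarrow> (\<forall>Q\<in>polys_in J. (\<forall>x\<in>X. ev (\<lambda>j. ev x (y j)) Q = 0) \<longrightarrow> Q = 0)"

text \<open>The coordinate ring of \<open>X\<close> is generated as a module over \<open>K[y\<^sub>0, \<dots>, y\<^bsub>M-1\<^esub>]\<close> by \<open>b\<^sub>0, \<dots>, b\<^bsub>c-1\<^esub>\<close>.\<close>

definition finite_over :: "(nat \<Rightarrow> 'a::field) set \<Rightarrow> nat \<Rightarrow> (nat \<Rightarrow> 'a mpoly) \<Rightarrow> nat \<Rightarrow> (nat \<Rightarrow> 'a mpoly) \<Rightarrow> bool" where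
  "finite_over X M y c b \<longleftrightarrow> (\<forall>f. \<exists>p. (\<forall>l. p l \<in> polys_in {..<M}) \<and>
     (\<forall>x\<in>X. ev x f = (\<Sum>l<c. ev (\<lambda>j. ev x (y j)) (p l) * ev x (b l))))"

section \<open>Bounding the number of algebraically independent functions\<close>

lemma exists_linear_relation:
  fixes a :: "'i \<Rightarrow> 'k \<Rightarrow> 'a::field"
  assumes "finite L" "finite I" "card L < card I"
  shows "\<exists>la. (\<exists>i\<in>I. la i \<noteq> 0) \<and> (\<forall>k\<in>L. (\<Sum>i\<in>I. la i * a i k) = 0)"
  using assms
proof (induction L arbitrary: I a rule: finite_induct)
  case empty
  then have "I \<noteq> {}" by auto
  then show ?case by (intro exI[of _ "\<lambda>_. 1"]) auto
next
  case (insert k L)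
  show ?case
  proof (cases "\<forall>i\<in>I. a i k = 0")
    case True
    have "card L < card I" using insert by simp
    then obtain la where "\<exists>i\<in>I. la i \<noteq> 0" "\<forall>k\<in>L. (\<Sum>i\<in>I. la i * a i k) = 0"
      using insert.IH[OF insert.prems(1), of a] by blast
    then show ?thesis using True by (intro exI[of _ la]) auto
  next
    case False
    then obtain i0 where i0: "i0 \<in> I" "a i0 k \<noteq> 0" by blast
    let ?I = "I - {i0}"
    define a' where "a' i k' = a i k' - a i k / a i0 k * a i0 k'" for i k'
    have "card L < card ?I" "finite ?I" using insert i0 by auto
    then obtain la where l: "\<exists>i\<in>?I. la i \<noteq> 0" "\<forall>k\<in>L. (\<Sum>i\<in>?I. la i * a' i k) = 0"
      using insert.IH[of ?I a'] by blast
    define \<mu> where "\<mu> = la(i0 := - (\<Sum>i\<in>?I. la i * a i k) / a i0 k)"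
    have s: "(\<Sum>i\<in>I. \<mu> i * a i k') = \<mu> i0 * a i0 k' + (\<Sum>i\<in>?I. la i * a i k')" for k'
      using i0 insert.prems(1) by (subst sum.remove[of _ i0]) (auto simp: \<mu>_def intro!: sum.cong)
    have "(\<Sum>i\<in>I. \<mu> i * a i k') = (\<Sum>i\<in>?I. la i * a' i k')" for k'
      unfolding s unfolding a'_def \<mu>_def
      by (simp add: right_diff_distrib sum_subtractf sum_divide_distrib sum_distrib_left sum_distrib_right mult_ac)
    moreover have "(\<Sum>i\<in>I. \<mu> i * a i k) = 0"
      unfolding s unfolding \<mu>_def using i0 by simp
    moreover have "\<exists>i\<in>I. \<mu> i \<noteq> 0" using l(1) by (auto simp: \<mu>_def)
    ultimately show ?thesis using l(2) by (intro exI[of _ \<mu>]) auto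
  qed
qed

text \<open>The exponents are bounded one by one, not in total, which makes the number of monomials
  a plain power.\<close>

definition monoms_below :: "nat set \<Rightarrow> nat \<Rightarrow> (nat \<Rightarrow>\<^sub>0 nat) set" where
  "monoms_below J D = {m. keys m \<subseteq> J \<and> (\<forall>j. lookup m j \<le> D)}"

lemma card_monoms_below:
  assumes "finite J"
  shows "finite (monoms_below J D)" "card (monoms_below J D) = Suc D ^ card J"
proof -
  have "bij_betw (\<lambda>m. restrict (lookup m) J) (monoms_below J D) (PiE J (\<lambda>_. {..D}))"
    unfolding bij_betw_def
  proof (intro conjI inj_onI equalityI subsetI)
    fix m m' assume m: "m \<in> monoms_below J D" "m' \<in> monoms_below J D"
      and eq: "restrict (lookup m) J = restrict (lookup m') J"
    show "m = m'"
    proof (rule poly_mapping_eqI)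
      fix k
      show "lookup m k = lookup m' k"
      proof (cases "k \<in> J")
        case False
        then have "k \<notin> keys m" "k \<notin> keys m'" using m by (auto simp: monoms_below_def)
        then show ?thesis by (simp add: in_keys_iff)
      qed (use fun_cong[OF eq, of k] in simp)
    qed
  next
    fix g assume g: "g \<in> PiE J (\<lambda>_. {..D})"
    let ?g = "\<lambda>j. if j \<in> J then g j else 0"
    have "finite {j. ?g j \<noteq> 0}" using assms by (rule finite_subset[rotated]) auto
    then have l: "lookup (Abs_poly_mapping ?g) = ?g" by (rule lookup_Abs_poly_mapping)
    then have "Abs_poly_mapping ?g \<in> monoms_below J D"
      using g by (auto simp: monoms_below_def in_keys_iff PiE_def split: if_splits)
    moreover have "g = restrict (lookup (Abs_poly_mapping ?g)) J"
      using g unfolding l by (auto simp: PiE_def extensional_def restrict_def)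
    ultimately show "g \<in> (\<lambda>m. restrict (lookup m) J) ` monoms_below J D" by blast
  qed (auto simp: monoms_below_def)
  moreover have "finite (PiE J (\<lambda>_. {..D}))" "card (PiE J (\<lambda>_. {..D})) = Suc D ^ card J"
    using assms by (auto simp: card_PiE intro!: finite_PiE)
  ultimately show "finite (monoms_below J D)" "card (monoms_below J D) = Suc D ^ card J"
    using bij_betw_finite bij_betw_same_card by (blast, metis)
qed

definition polys_below :: "nat set \<Rightarrow> nat \<Rightarrow> 'a::field mpoly set" where
  "polys_below J D = {p. keys p \<subseteq> monoms_below J D}"

lemma polys_below_mono:
  assumes "D \<le> D'"
  shows "polys_below J D \<subseteq> polys_below J D'"
proof -
  have "monoms_below J D \<subseteq> monoms_below J D'"
    using assms by (auto simp: monoms_below_def intro: order_trans)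
  then show ?thesis unfolding polys_below_def by blast
qed

lemma polys_below_0 [simp]: "0 \<in> polys_below J D"
  by (simp add: polys_below_def)

lemma polys_below_add: "p \<in> polys_below J D \<Longrightarrow> q \<in> polys_below J D \<Longrightarrow> p + q \<in> polys_below J D"
  using Poly_Mapping.keys_add[of p q] unfolding polys_below_def by blast

lemma polys_below_sum: "(\<And>i. i \<in> I \<Longrightarrow> f i \<in> polys_below J D) \<Longrightarrow> sum f I \<in> polys_below J D"
  by (induction I rule: infinite_finite_induct) (auto intro: polys_below_add)

lemma polys_below_mult:
  assumes "p \<in> polys_below J D" "q \<in> polys_below J D'"
  shows "p * q \<in> polys_below J (D + D')"
  unfolding polys_below_def
proof (intro CollectI subsetI)
  fix m assume "m \<in> keys (p * q)"
  then obtain a b where ab: "m = a + b" "a \<in> keys p" "b \<in> keys q"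
    using keys_mult[of p q] by blast
  then have "a \<in> monoms_below J D" "b \<in> monoms_below J D'" using assms unfolding polys_below_def by auto
  then show "m \<in> monoms_below J (D + D')"
    using Poly_Mapping.keys_add[of a b] unfolding ab(1) monoms_below_def
    by (auto simp: lookup_add add_mono)
qed

lemma exists_polys_below:
  assumes "p \<in> polys_in J"
  shows "\<exists>D. p \<in> polys_below J D"
proof -
  have "\<exists>D. \<forall>m\<in>keys p. \<forall>j. lookup m j \<le> D"
  proof (intro exI ballI allI)
    fix m j assume m: "m \<in> keys p"
    show "lookup m j \<le> (\<Sum>m\<in>keys p. \<Sum>j\<in>keys m. lookup m j)"
    proof (cases "j \<in> keys m")
      case True
      then have "lookup m j \<le> (\<Sum>j\<in>keys m. lookup m j)" by (intro member_le_sum) auto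
      also have "\<dots> \<le> (\<Sum>m\<in>keys p. \<Sum>j\<in>keys m. lookup m j)"
        using m by (intro member_le_sum[of m "keys p" "\<lambda>m. \<Sum>j\<in>keys m. lookup m j"]) auto
      finally show ?thesis .
    qed (simp add: in_keys_iff)
  qed
  then show ?thesis using assms unfolding polys_below_def monoms_below_def polys_in_def by blast
qed

text \<open>Compare the growth, as \<open>D \<rightarrow> \<infinity>\<close>, of the spaces spanned by the monomials with exponents below \<open>D\<close>
  in the \<open>f\<^sub>j\<close> and in the \<open>y\<^sub>i\<close>.\<close>

lemma alg_indep_card_le:
  fixes X :: "(nat \<Rightarrow> 'a::field) set"
  assumes fin: "finite_over X M y c b" and ind: "alg_indep X J f" and J: "finite J"
  shows "card J \<le> M"
proof (rule ccontr)
  assume "\<not> card J \<le> M"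
  then have MJ: "M < card J" by simp
  let ?J = "{..<M}" and ?y = "\<lambda>x j. ev x (y j)" and ?f = "\<lambda>x j. ev x (f j)"
  obtain P where P: "\<And>g l. P g l \<in> polys_in ?J"
    "\<And>g x. x \<in> X \<Longrightarrow> ev x g = (\<Sum>l<c. ev (?y x) (P g l) * ev x (b l))"
    using fin unfolding finite_over_def by metis
  obtain d where d: "\<And>g l. P g l \<in> polys_below ?J (d g l)"
    using exists_polys_below[OF P(1)] by metis
  \<comment> \<open>\<open>E\<close> bounds the exponents in the expansions of 1 and of all products
    f_j b_k, so multiplication by f_j raises the exponents in y by at most \<open>E\<close>.\<close>
  define E where "E = (\<Sum>l<c. d 1 l) + (\<Sum>j\<in>J. \<Sum>k<c. \<Sum>l<c. d (f j * b k) l)"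
  have E1: "P 1 l \<in> polys_below ?J E" if "l < c" for l
  proof -
    have "d 1 l \<le> (\<Sum>l<c. d 1 l)" using that by (intro member_le_sum) auto
    then have "d 1 l \<le> E" unfolding E_def by simp
    then show ?thesis using d polys_below_mono by blast
  qed
  have E2: "P (f j * b k) l \<in> polys_below ?J E" if "j \<in> J" "k < c" "l < c" for j k l
  proof -
    have "d (f j * b k) l \<le> (\<Sum>l<c. d (f j * b k) l)" using that by (intro member_le_sum) auto
    also have "\<dots> \<le> (\<Sum>k<c. \<Sum>l<c. d (f j * b k) l)"
      using that by (intro member_le_sum[of k _ "\<lambda>k. \<Sum>l<c. d (f j * b k) l"]) auto
    also have "\<dots> \<le> (\<Sum>j\<in>J. \<Sum>k<c. \<Sum>l<c. d (f j * b k) l)"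
      using that J by (intro member_le_sum[of j _ "\<lambda>j. \<Sum>k<c. \<Sum>l<c. d (f j * b k) l"]) auto
    finally have "d (f j * b k) l \<le> E" unfolding E_def by simp
    then show ?thesis using d polys_below_mono by blast
  qed
  define V where "V D = {g. \<exists>p. (\<forall>l<c. p l \<in> polys_below ?J D) \<and>
      (\<forall>x\<in>X. g x = (\<Sum>l<c. ev (?y x) (p l) * ev x (b l)))}" for D
  have V_mono: "V D \<subseteq> V D'" if "D \<le> D'" for D D'
    using polys_below_mono[OF that, of ?J] unfolding V_def by blast
  have V1: "(\<lambda>x. 1) \<in> V E"
    unfolding V_def using E1 P(2)[of _ 1] by (auto intro!: exI[of _ "P 1"])
  have V_mult: "(\<lambda>x. g x * ev x (f j)) \<in> V (D + E)" if g: "g \<in> V D" and j: "j \<in> J" for g D j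
  proof -
    obtain p where p: "\<And>l. l < c \<Longrightarrow> p l \<in> polys_below ?J D"
      "\<And>x. x \<in> X \<Longrightarrow> g x = (\<Sum>l<c. ev (?y x) (p l) * ev x (b l))"
      using g unfolding V_def by blast
    define q where "q l = (\<Sum>k<c. p k * P (f j * b k) l)" for l
    have "q l \<in> polys_below ?J (D + E)" if "l < c" for l
      unfolding q_def using that p(1) E2[OF j] by (intro polys_below_sum polys_below_mult) auto
    moreover have "g x * ev x (f j) = (\<Sum>l<c. ev (?y x) (q l) * ev x (b l))" if x: "x \<in> X" for x
    proof -
      have e: "ev x (f j * b k) = (\<Sum>l<c. ev (?y x) (P (f j * b k) l) * ev x (b l))" for k
        by (rule P(2)[OF x])
      have "g x * ev x (f j) = (\<Sum>k<c. ev (?y x) (p k) * ev x (f j * b k))"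
        unfolding p(2)[OF x] sum_distrib_right by (intro sum.cong) (auto simp: mult_ac)
      also have "\<dots> = (\<Sum>k<c. \<Sum>l<c. ev (?y x) (p k) * ev (?y x) (P (f j * b k) l) * ev x (b l))"
        by (simp only: e sum_distrib_left mult.assoc)
      also have "\<dots> = (\<Sum>l<c. ev (?y x) (q l) * ev x (b l))"
        by (subst sum.swap) (simp add: q_def ev_sum sum_distrib_right)
      finally show ?thesis .
    qed
    ultimately show ?thesis unfolding V_def by blast
  qed
  have V_pow: "(\<lambda>x. g x * ev x (f j) ^ k) \<in> V (D + k * E)" if g: "g \<in> V D" and j: "j \<in> J" for g D j k
  proof (induction k)
    case (Suc k)
    from V_mult[OF Suc j] show ?case by (simp add: mult_ac add_ac)
  qed (use g in simp)
  have V_prod: "(\<lambda>x. \<Prod>j\<in>J'. ev x (f j) ^ lookup m j) \<in> V (E + (\<Sum>j\<in>J'. lookup m j * E))"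
    if "J' \<subseteq> J" for J' m
    using finite_subset[OF that J] that
  proof (induction J' rule: finite_induct)
    case (insert j J')
    then have "(\<lambda>x. (\<Prod>j\<in>J'. ev x (f j) ^ lookup m j) * ev x (f j) ^ lookup m j)
        \<in> V (E + (\<Sum>j\<in>J'. lookup m j * E) + lookup m j * E)"
      by (intro V_pow) auto
    then show ?case using insert by (simp add: mult_ac add_ac)
  qed (use V1 in simp)
  \<comment> \<open>\<open>B\<close> bounds the exponents in y that occur for a monomial in f with
    exponents at most \<open>D\<close>. The constant \<open>C\<close> gives B + 1 \<le> C (D + 1),
    and \<open>D\<close> is chosen such that c (B + 1)^M \<le> D (D + 1)^M < (D + 1)^(M + 1) \<le>
    (D + 1)^(card J).\<close>
  define C where "C = E * (1 + card J) + 1"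
  define D where "D = c * C ^ M"
  define B where "B = E + card J * (D * E)"
  let ?I = "monoms_below J D" and ?L = "{..<c} \<times> monoms_below ?J B"
  have "Suc B \<le> C * Suc D" unfolding B_def C_def by (simp add: algebra_simps)
  then have "Suc B ^ M \<le> (C * Suc D) ^ M" by (rule power_mono) simp
  then have "c * Suc B ^ M \<le> D * Suc D ^ M"
    unfolding D_def by (metis mult.assoc mult_le_mono2 power_mult_distrib)
  also have "\<dots> < Suc D ^ Suc M" by simp
  also have "\<dots> \<le> Suc D ^ card J" using MJ by (intro power_increasing) auto
  finally have card: "card ?L < card ?I"
    by (simp add: card_cartesian_product card_monoms_below J)
  have "(\<lambda>x. ev_monom (?f x) m) \<in> V B" if m: "m \<in> ?I" for m
  proof -
    have "(\<Sum>j\<in>J. lookup m j * E) \<le> (\<Sum>j\<in>J. D * E)"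
      using m by (intro sum_mono mult_right_mono) (auto simp: monoms_below_def)
    then have "E + (\<Sum>j\<in>J. lookup m j * E) \<le> B" unfolding B_def by simp
    moreover have "ev_monom (?f x) m = (\<Prod>j\<in>J. ev x (f j) ^ lookup m j)" for x
      using m J by (intro ev_monom_superset) (auto simp: monoms_below_def)
    ultimately show ?thesis using V_prod[of J m] V_mono by auto
  qed
  then have "\<exists>p. (\<forall>l<c. p l \<in> polys_below ?J B) \<and>
      (\<forall>x\<in>X. ev_monom (?f x) m = (\<Sum>l<c. ev (?y x) (p l) * ev x (b l)))" if "m \<in> ?I" for m
    using that unfolding V_def by blast
  then have "\<forall>m\<in>?I. \<exists>p. (\<forall>l<c. p l \<in> polys_below ?J B) \<and>
      (\<forall>x\<in>X. ev_monom (?f x) m = (\<Sum>l<c. ev (?y x) (p l) * ev x (b l)))" by blast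
  from bchoice[OF this] obtain p where p: "\<And>m l. m \<in> ?I \<Longrightarrow> l < c \<Longrightarrow> p m l \<in> polys_below ?J B"
    "\<And>m x. m \<in> ?I \<Longrightarrow> x \<in> X \<Longrightarrow> ev_monom (?f x) m = (\<Sum>l<c. ev (?y x) (p m l) * ev x (b l))"
    by blast
  have fI: "finite ?I" and fL: "finite ?L" using card_monoms_below J by auto
  obtain la where l: "\<exists>m\<in>?I. la m \<noteq> 0"
    "\<And>k. k \<in> ?L \<Longrightarrow> (\<Sum>m\<in>?I. la m * lookup (p m (fst k)) (snd k)) = 0"
    using exists_linear_relation[OF fL fI card, of "\<lambda>m k. lookup (p m (fst k)) (snd k)"] by blast
  define Q where "Q = (\<Sum>m\<in>?I. Poly_Mapping.single m (la m))"
  have "Q \<in> polys_in J" unfolding Q_def by (intro polys_in_sum polys_in_single) (auto simp: monoms_below_def)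
  moreover have "lookup Q m = la m" if "m \<in> ?I" for m
    using that fI by (simp add: Q_def lookup_sum lookup_single when_def)
  then have "Q \<noteq> 0" using l(1) by (metis lookup_zero)
  moreover have "ev (?f x) Q = 0" if x: "x \<in> X" for x
  proof -
    \<comment> \<open>The linear relation was imposed on each coefficient of each
      \<open>p m l\<close>, so the combination is zero as a polynomial in y.\<close>
    have z: "(\<Sum>m\<in>?I. Const (la m) * p m l) = 0" if lc: "l < c" for l
    proof (rule poly_mapping_eqI)
      fix k
      have "lookup (Const a * q) k = a * lookup q k" for a and q :: "'a mpoly"
        by (induction q rule: mpoly_induct) (auto simp: distrib_left mult_single lookup_add lookup_single when_def)
      then have "lookup (\<Sum>m\<in>?I. Const (la m) * p m l) k = (\<Sum>m\<in>?I. la m * lookup (p m l) k)"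
        by (simp add: lookup_sum)
      also have "\<dots> = 0"
      proof (cases "k \<in> monoms_below ?J B")
        case True
        then show ?thesis using l(2)[of "(l, k)"] lc by simp
      next
        case False
        then have "lookup (p m l) k = 0" if "m \<in> ?I" for m
          using p(1)[OF that lc] unfolding polys_below_def by (auto simp: in_keys_iff)
        then show ?thesis by simp
      qed
      finally show "lookup (\<Sum>m\<in>?I. Const (la m) * p m l) k = lookup 0 k" by simp
    qed
    have "ev (?f x) Q = (\<Sum>m\<in>?I. la m * ev_monom (?f x) m)" by (simp add: Q_def ev_sum ev_single)
    also have "\<dots> = (\<Sum>m\<in>?I. \<Sum>l<c. ev (?y x) (Const (la m) * p m l) * ev x (b l))"
      by (intro sum.cong) (auto simp: p(2) x sum_distrib_left mult.assoc)
    also have "\<dots> = (\<Sum>l<c. ev (?y x) (\<Sum>m\<in>?I. Const (la m) * p m l) * ev x (b l))"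
      by (subst sum.swap) (simp add: ev_sum sum_distrib_right)
    also have "\<dots> = 0" by (simp add: z)
    finally show ?thesis .
  qed
  ultimately show False using ind unfolding alg_indep_def by blast
qed

section \<open>Noether normalisation by a weighted substitution\<close>

lemma base_expansion_inj:
  fixes a b :: "nat \<Rightarrow> nat"
  assumes "\<And>j. a j < E" "\<And>j. b j < E" "(\<Sum>j<Suc K. a j * E ^ (K - j)) = (\<Sum>j<Suc K. b j * E ^ (K - j))" "j \<le> K"
  shows "a j = b j"
  using assms(3,4)
proof (induction K arbitrary: j)
  case (Suc K)
  have h: "(\<Sum>j<Suc (Suc K). a j * E ^ (Suc K - j)) = E * (\<Sum>j<Suc K. a j * E ^ (K - j)) + a (Suc K)"
    for a :: "nat \<Rightarrow> nat"
  proof -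
    have "(\<Sum>j<Suc K. a j * E ^ (Suc K - j)) = E * (\<Sum>j<Suc K. a j * E ^ (K - j))"
      unfolding sum_distrib_left by (intro sum.cong) (auto simp: Suc_diff_le less_Suc_eq_le)
    then show ?thesis by (subst sum.lessThan_Suc) simp
  qed
  have eq: "E * (\<Sum>j<Suc K. a j * E ^ (K - j)) + a (Suc K) = E * (\<Sum>j<Suc K. b j * E ^ (K - j)) + b (Suc K)"
    using Suc.prems(1) unfolding h .
  from arg_cong[OF eq, of "\<lambda>t. t mod E"] have "a (Suc K) = b (Suc K)"
    using assms(1,2) by simp
  moreover from this eq have "(\<Sum>j<Suc K. a j * E ^ (K - j)) = (\<Sum>j<Suc K. b j * E ^ (K - j))"
    using assms(1)[of 0] by simp
  ultimately show ?case using Suc.IH[of j] Suc.prems(2) by (cases "j = Suc K") auto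
qed simp

text \<open>Lists the products b_l y_K^i by the single index l d + i.\<close>

lemma sum_div_mod:
  fixes g :: "nat \<Rightarrow> nat \<Rightarrow> 'a::comm_monoid_add"
  shows "(\<Sum>k<c * d. g (k div d) (k mod d)) = (\<Sum>l<c. \<Sum>i<d. g l i)"
proof -
  have "(\<Sum>i<d. g l i) = (\<Sum>k\<in>{l * d..<l * d + d}. g (k div d) (k mod d))" for l
    by (rule sum.reindex_bij_witness[of _ "\<lambda>k. k - l * d" "\<lambda>i. l * d + i"]) auto
  then show ?thesis by (simp add: sum.nat_group[symmetric])
qed

text \<open>The substitution \<open>y\<^sub>j = y'\<^sub>j + y\<^sub>K\<^bsup>w\<^sub>j\<^esup>\<close> with rapidly growing weights \<open>w\<^sub>j\<close> turns the relation \<open>Q\<close>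
  into one that is monic in \<open>y\<^sub>K\<close>.\<close>

lemma finite_over_step:
  fixes X :: "(nat \<Rightarrow> 'a::field) set"
  assumes fin: "finite_over X (Suc K) y c b" and Q: "Q \<in> polys_in {..<Suc K}" "Q \<noteq> 0"
    and van: "\<And>x. x \<in> X \<Longrightarrow> ev (\<lambda>j. ev x (y j)) Q = 0"
  shows "\<exists>y' c' b'. finite_over X K y' c' b'"
proof -
  obtain E0 where E0: "Q \<in> polys_below {..<Suc K} E0" using exists_polys_below Q by blast
  \<comment> \<open>Larger than every exponent in Q, so that the exponents of a monomial can serve
    as digits in base \<open>E\<close>.\<close>
  define E where "E = Suc E0"
  have E: "lookup m j < E" if "m \<in> keys Q" for m j
    using E0 that unfolding polys_below_def monoms_below_def E_def by (auto simp: less_Suc_eq_le)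
  \<comment> \<open>\<open>L j\<close> is what replaces y_j, as a polynomial in y_K over the ring
    generated by the new functions. For j = K the exponent is E^0 = 1 and the first summand is
    absent, so \<open>L K\<close> is the variable itself.\<close>
  define L where "L j = (if j < K then [:Var j:] else 0) + monom (1 :: 'a mpoly) (E ^ (K - j))" for j
  have E1: "E ^ i > 0" for i unfolding E_def by simp
  have L: "degree (L j) = E ^ (K - j)" "lead_coeff (L j) = 1" for j
  proof -
    have d: "degree (if j < K then [:Var j:] else 0 :: 'a mpoly poly) < degree (monom (1 :: 'a mpoly) (E ^ (K - j)))"
      using E1 by (simp add: degree_monom_eq E_def)
    show "degree (L j) = E ^ (K - j)"
      unfolding L_def by (subst degree_add_eq_right[OF d]) (simp add: degree_monom_eq)
    show "lead_coeff (L j) = 1"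
      unfolding L_def using d by (subst lead_coeff_add_le) (auto simp: degree_monom_eq)
  qed
  have LA: "L j \<in> polys_over (polys_in {..<K})" for j
    unfolding L_def
    by (intro subringD(3)[OF subring_polys_over] polys_over_monom subring_polys_in polys_in_1)
      (auto intro!: polys_over_const polys_in_Var subringD(1)[OF subring_polys_over])
  define T where "T m = (\<Prod>j<Suc K. L j ^ lookup m j)" for m
  \<comment> \<open>The degree in y_K of the substituted monomial m; its digits in base
    \<open>E\<close> are the exponents of m.\<close>
  define W where "W m = (\<Sum>j<Suc K. lookup m j * E ^ (K - j))" for m
  have L0: "L j \<noteq> 0" for j using L(2)[of j] by auto
  have T: "degree (T m) = W m" "lead_coeff (T m) = 1" for m
  proof -
    show "lead_coeff (T m) = 1" unfolding T_def by (simp only: lead_coeff_prod lead_coeff_power L(2) power_one prod.neutral_const)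
    show "degree (T m) = W m"
      unfolding T_def W_def using L0 by (subst degree_prod_eq_sum_degree) (auto simp: degree_power_eq L mult_ac intro!: sum.cong)
  qed
  have TA: "T m \<in> polys_over (polys_in {..<K})" for m
  proof -
    note P = subringD[OF subring_polys_over[OF subring_polys_in[of "{..<K}"]]]
    have "(\<Prod>j\<in>I. L j ^ lookup m j) \<in> polys_over (polys_in {..<K})" for I
      by (induction I rule: infinite_finite_induct)
        (auto intro!: P(2) P(5) subring_power[OF subring_polys_over] LA subring_polys_in)
    then show ?thesis unfolding T_def by blast
  qed
  define \<Theta> where "\<Theta> p = (\<Sum>m\<in>keys p. smult (Const (lookup p m)) (T m))" for p
  have \<Theta>A: "\<Theta> p \<in> polys_over (polys_in {..<K})" for p
    unfolding \<Theta>_def by (intro subring_sum subring_polys_over polys_over_smult TA subring_polys_in polys_in_Const)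
  have kQ: "keys Q \<noteq> {}" using Q(2) by simp
  then have "Max (W ` keys Q) \<in> W ` keys Q" by (intro Max_in) auto
  then obtain m0 where m0: "m0 \<in> keys Q" "W m0 = Max (W ` keys Q)" by force
  have max: "W m \<le> W m0" if "m \<in> keys Q" for m unfolding m0(2) using that by (intro Max_ge) auto
  \<comment> \<open>Uniqueness of digits: only one monomial of Q reaches the maximal degree, so its
    leading coefficient, a non-zero constant, cannot cancel.\<close>
  have inj: "m = m0" if "m \<in> keys Q" "W m = W m0" for m
  proof (rule poly_mapping_eqI)
    fix j
    show "lookup m j = lookup m0 j"
    proof (cases "j \<le> K")
      case True
      then show ?thesis using base_expansion_inj[of "lookup m" E "lookup m0" K j] E that m0 unfolding W_def by blast
    next
      case False
      then have "j \<notin> keys m" "j \<notin> keys m0" using Q(1) that m0 unfolding polys_in_def by fastforce+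
      then show ?thesis by (simp add: in_keys_iff)
    qed
  qed
  have cT: "coeff (T m) i = 0" if "i > W m" for m i using that T(1) coeff_eq_0 by metis
  have top: "coeff (\<Theta> Q) (W m0) = Const (lookup Q m0)"
  proof -
    have "coeff (\<Theta> Q) (W m0) = (\<Sum>m\<in>keys Q. if m = m0 then Const (lookup Q m0) else 0)"
      unfolding \<Theta>_def coeff_sum
    proof (intro sum.cong refl)
      fix m assume m: "m \<in> keys Q"
      show "coeff (smult (Const (lookup Q m)) (T m)) (W m0) = (if m = m0 then Const (lookup Q m0) else 0)"
      proof (cases "m = m0")
        case True
        then show ?thesis using T[of m0] by simp
      next
        case False
        then have "W m < W m0" using max[OF m] inj[OF m] by fastforce
        then show ?thesis using False cT by simp
      qed
    qed
    then show ?thesis using m0 by simp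
  qed
  have lc0: "lookup Q m0 \<noteq> 0" using m0 by (simp add: in_keys_iff)
  have "coeff (\<Theta> Q) i = 0" if "i > W m0" for i
    unfolding \<Theta>_def coeff_sum using that max cT by (intro sum.neutral) fastforce
  then have "degree (\<Theta> Q) \<le> W m0" by (intro degree_le) auto
  moreover have "degree (\<Theta> Q) \<ge> W m0"
    using top lc0 by (intro le_degree) (metis lookup_single_eq lookup_zero)
  ultimately have deg: "degree (\<Theta> Q) = W m0" by simp
  have lc: "lead_coeff (\<Theta> Q) = Const (lookup Q m0)" unfolding deg by (rule top)
  have \<Theta>0: "\<Theta> Q \<noteq> 0" using top lc0 by (metis coeff_0 lookup_single_eq lookup_zero)
  \<comment> \<open>The inverse substitution. For j = K the difference is 0, but the polynomials
    over the new functions involve only indices below K.\<close>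
  define y' where "y' j = y j - y K ^ (E ^ (K - j))" for j
  let ?v = "\<lambda>x j. ev x (y j)" and ?v' = "\<lambda>x j. ev x (y' j)"
  have eL: "ev (?v' x) (poly (L j) (Const (ev x (y K)))) = ev x (y j)" if "j \<le> K" for x j
    using that by (auto simp: L_def y'_def poly_monom)
  have e\<Theta>: "ev (?v' x) (poly (\<Theta> p) (Const (ev x (y K)))) = ev (?v x) p" if "p \<in> polys_in {..<Suc K}" for p x
  proof -
    have "ev (?v' x) (poly (T m) (Const (ev x (y K)))) = ev_monom (?v x) m" if "m \<in> keys p" for m
    proof -
      have "ev (?v' x) (poly (T m) (Const (ev x (y K)))) = (\<Prod>j<Suc K. ev x (y j) ^ lookup m j)"
        unfolding T_def by (auto simp: poly_prod ev_prod eL less_Suc_eq_le intro!: prod.cong)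
      also have "\<dots> = ev_monom (?v x) m"
        using \<open>p \<in> polys_in {..<Suc K}\<close> that by (intro ev_monom_superset[symmetric]) (auto simp: polys_in_def)
      finally show ?thesis .
    qed
    then show ?thesis unfolding \<Theta>_def by (simp add: poly_sum ev_sum ev_def[of _ p])
  qed
  define d where "d = W m0"
  have red: "\<exists>r. (\<forall>i. r i \<in> polys_in {..<K}) \<and>
      (\<forall>x\<in>X. ev (?v x) p = (\<Sum>i<d. ev (?v' x) (r i) * ev x (y K) ^ i))"
    if p: "p \<in> polys_in {..<Suc K}" for p
  proof -
    obtain k q r where kqr: "q \<in> polys_over (polys_in {..<K})" "r \<in> polys_over (polys_in {..<K})"
      "smult (lead_coeff (\<Theta> Q) ^ k) (\<Theta> p) = q * \<Theta> Q + r" "r = 0 \<or> degree r < degree (\<Theta> Q)"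
      using pseudo_division[OF subring_polys_in \<Theta>A \<Theta>0 \<Theta>A] by blast
    \<comment> \<open>The leading coefficient of the relation is a constant, so the factor
      introduced by pseudo-division is invertible and the powers of y_K below d span.\<close>
    let ?u = "lookup Q m0 ^ k"
    have u0: "?u \<noteq> 0" using lc0 by simp
    have cr: "coeff r i = 0" if "i \<ge> d" for i
      using kqr(4) that by (auto simp: deg d_def coeff_eq_0)
    have "ev (?v x) p = (\<Sum>i<d. ev (?v' x) (Const (inverse ?u) * coeff r i) * ev x (y K) ^ i)" if x: "x \<in> X" for x
    proof -
      let ?e = "\<lambda>P. ev (?v' x) (poly P (Const (ev x (y K))))"
      have "?u * ev (?v x) p = ?e (smult (lead_coeff (\<Theta> Q) ^ k) (\<Theta> p))"
        using e\<Theta>[OF p] by (simp add: lc)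
      also have "\<dots> = ?e q * ev (?v x) Q + ?e r"
        unfolding kqr(3) using e\<Theta>[OF Q(1)] by simp
      also have "\<dots> = ?e r" using van x by simp
      also have "\<dots> = (\<Sum>i\<le>degree r. ev (?v' x) (coeff r i) * ev x (y K) ^ i)"
        by (simp add: poly_altdef ev_sum)
      also have "\<dots> = (\<Sum>i<d. ev (?v' x) (coeff r i) * ev x (y K) ^ i)"
      proof (cases "r = 0")
        case False
        then show ?thesis using kqr(4) by (intro sum.mono_neutral_left) (auto simp: deg d_def coeff_eq_0)
      qed simp
      finally have "ev (?v x) p = inverse ?u * (\<Sum>i<d. ev (?v' x) (coeff r i) * ev x (y K) ^ i)"
        using u0 by (simp add: field_simps)
      then show ?thesis by (simp add: sum_distrib_left mult.assoc)
    qed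
    then show ?thesis
      using kqr(2) by (intro exI[of _ "\<lambda>i. Const (inverse ?u) * coeff r i"])
        (auto simp: polys_over_def intro!: polys_in_mult)
  qed
  have "finite_over X K y' (c * d) (\<lambda>k. b (k div d) * y K ^ (k mod d))"
    unfolding finite_over_def
  proof
    fix f
    obtain p where p: "\<And>l. p l \<in> polys_in {..<Suc K}"
      "\<And>x. x \<in> X \<Longrightarrow> ev x f = (\<Sum>l<c. ev (?v x) (p l) * ev x (b l))"
      using fin unfolding finite_over_def by metis
    obtain r where r: "\<And>l i. r l i \<in> polys_in {..<K}"
      "\<And>l x. x \<in> X \<Longrightarrow> ev (?v x) (p l) = (\<Sum>i<d. ev (?v' x) (r l i) * ev x (y K) ^ i)"
      using red[OF p(1)] by metis
    have "ev x f = (\<Sum>k<c * d. ev (?v' x) (r (k div d) (k mod d)) * ev x (b (k div d) * y K ^ (k mod d)))"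
      if x: "x \<in> X" for x
    proof -
      have "ev x f = (\<Sum>l<c. \<Sum>i<d. ev (?v' x) (r l i) * ev x (b l * y K ^ i))"
        unfolding p(2)[OF x] r(2)[OF x] sum_distrib_right by (intro sum.cong) (auto simp: mult_ac)
      then show ?thesis
        using sum_div_mod[of "\<lambda>l i. ev (?v' x) (r l i) * ev x (b l * y K ^ i)" d c] by simp
    qed
    then show "\<exists>p. (\<forall>l. p l \<in> polys_in {..<K}) \<and>
      (\<forall>x\<in>X. ev x f = (\<Sum>l<c * d. ev (?v' x) (p l) * ev x (b (l div d) * y K ^ (l mod d))))"
      using r(1) by (intro exI[of _ "\<lambda>k. r (k div d) (k mod d)"]) auto
  qed
  then show ?thesis by blast
qed

lemma finite_over_Var:
  assumes "X \<subseteq> affine_space n"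
  shows "finite_over X n Var (Suc 0) (\<lambda>_. 1)"
  unfolding finite_over_def
proof (intro allI exI[of _ "\<lambda>_. restrict_vars {..<n} _"] conjI ballI)
  fix f :: "'a mpoly" and x assume "x \<in> X"
  then have "(\<lambda>i. if i \<in> {..<n} then x i else 0) = x" using assms by (fastforce simp: affine_space_def)
  then show "ev x f = (\<Sum>l<Suc 0. ev (\<lambda>j. ev x (Var j)) (restrict_vars {..<n} f) * ev x 1)"
    by (simp add: ev_restrict_vars)
qed (rule restrict_vars_in)

text \<open>For the least number M of functions over which X is finite, a relation between them
  would allow M - 1 functions. If M = 0 a relation is a constant, and it is zero because X has a
  point.\<close>

lemma noether_normalisation:
  fixes X :: "(nat \<Rightarrow> 'a::field) set"
  assumes X: "X \<subseteq> affine_space n" "X \<noteq> {}"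
  obtains M y c b where "finite_over X M y c b" "alg_indep X {..<M} y"
proof -
  let ?P = "\<lambda>M. \<exists>y c b. finite_over X M y c b"
  define M where "M = (LEAST M. ?P M)"
  have "\<exists>M. ?P M" using finite_over_Var[OF X(1)] by blast
  then have "?P M" unfolding M_def by (rule LeastI_ex)
  then obtain y c b where fin: "finite_over X M y c b" by blast
  have "alg_indep X {..<M} y"
    unfolding alg_indep_def
  proof (intro ballI impI, rule ccontr)
    fix Q assume Q: "Q \<in> polys_in {..<M}" "\<forall>x\<in>X. ev (\<lambda>j. ev x (y j)) Q = 0" "Q \<noteq> 0"
    show False
    proof (cases M)
      case 0
      then obtain q where q: "Q = Const q" using Q(1) polys_in_empty by auto
      then have "q \<noteq> 0" using Q(3) by auto
      moreover obtain x where "x \<in> X" using X(2) by blast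
      ultimately show False using Q(2) q by simp
    next
      case (Suc K)
      have "?P K" using finite_over_step[of X K y c b Q] fin Q unfolding Suc by blast
      then have "M \<le> K" unfolding M_def by (rule Least_le)
      then show False using Suc by simp
    qed
  qed
  with fin that show ?thesis by blast
qed

section \<open>Hypersurface sections\<close>

text \<open>Irreducibility in algebraic form, with a prime vanishing ideal. It makes sense for sets
  that are not closed and is used for locally closed ones.\<close>

definition irr :: "(nat \<Rightarrow> 'a::field) set \<Rightarrow> bool" where
  "irr X \<longleftrightarrow> X \<noteq> {} \<and> (\<forall>p q. p * q \<in> vanishing X \<longrightarrow> p \<in> vanishing X \<or> q \<in> vanishing X)"

lemma irrD: "irr X \<Longrightarrow> p * q \<in> vanishing X \<Longrightarrow> p \<in> vanishing X \<or> q \<in> vanishing X"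
  unfolding irr_def by blast

text \<open>Turns a polynomial expression in the functions y into one polynomial in the coordinates,
  to which primality of a vanishing ideal applies.\<close>

definition subst_poly :: "(nat \<Rightarrow> 'a::field mpoly) \<Rightarrow> 'a mpoly \<Rightarrow> 'a mpoly" where
  "subst_poly y p = (\<Sum>m\<in>keys p. Const (lookup p m) * (\<Prod>i\<in>keys m. y i ^ lookup m i))"

lemma ev_subst_poly: "ev x (subst_poly y p) = ev (\<lambda>j. ev x (y j)) p"
  unfolding subst_poly_def ev_def[of "\<lambda>j. ev x (y j)" p]
  by (simp add: ev_sum ev_prod ev_monom_def)

lemma alg_indep_vanishing:
  "alg_indep X J y \<longleftrightarrow> (\<forall>Q\<in>polys_in J. subst_poly y Q \<in> vanishing X \<longrightarrow> Q = 0)"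
  by (simp add: alg_indep_def vanishing_def ev_subst_poly)

text \<open>A polynomial \<open>G\<close> over \<open>K[y]\<close> is evaluated at \<open>x\<close> by \<open>ev (y x) (poly G (Const (h x)))\<close>; it
  vanishes on \<open>X\<close> iff \<open>G(y, h) = 0\<close> in the coordinate ring.\<close>

lemma relations_principal:
  fixes X :: "(nat \<Rightarrow> 'a::alg_closed_field) set"
  assumes irr: "irr X" and fin: "finite_over X M y c b" and ind: "alg_indep X {..<M} y"
    and h: "h \<notin> vanishing X"
  obtains F where "F \<in> polys_over (polys_in {..<M})" "coeff F 0 \<noteq> 0"
    "\<And>x. x \<in> X \<Longrightarrow> ev (\<lambda>j. ev x (y j)) (poly F (Const (ev x h))) = 0"
    "\<And>G. G \<in> polys_over (polys_in {..<M}) \<Longrightarrow>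
       (\<And>x. x \<in> X \<Longrightarrow> ev (\<lambda>j. ev x (y j)) (poly G (Const (ev x h))) = 0) \<Longrightarrow>
       dvd_in (polys_over (polys_in {..<M})) F G"
proof -
  let ?A = "polys_in {..<M} :: 'a mpoly set" and ?y = "\<lambda>x j. ev x (y j)"
  let ?e = "\<lambda>x G. ev (?y x) (poly G (Const (ev x h)))"
  note P = subringD[OF subring_polys_over[OF subring_polys_in[of "{..<M}"]]]
  define I where "I = {G \<in> polys_over ?A. \<forall>x\<in>X. ?e x G = 0}"
  obtain \<delta> where u: "ufd ?A \<delta>" using ufd_polys_in by blast
  \<comment> \<open>A non-zero relation exists because y and h together are M + 1 functions on a set
    that is finite over M functions.\<close>
  have "\<not> alg_indep X {..<Suc M} (y(M := h))"
    using alg_indep_card_le[OF fin, of "{..<Suc M}"] by auto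
  then obtain Q where Q: "Q \<in> polys_in {..<Suc M}" "Q \<noteq> 0"
    "\<And>x. x \<in> X \<Longrightarrow> ev (\<lambda>j. ev x ((y(M := h)) j)) Q = 0"
    unfolding alg_indep_def by blast
  obtain F0 where F0: "F0 \<in> polys_over ?A" "Q = poly F0 (Var M)"
    using Q(1) polys_in_insert_decompose[of Q M "{..<M}"] by (metis lessThan_Suc)
  have "?e x F0 = ev (\<lambda>j. ev x ((y(M := h)) j)) Q" for x
  proof -
    have "map_poly (ev (\<lambda>j. ev x ((y(M := h)) j))) F0 = map_poly (ev (?y x)) F0"
      by (intro map_poly_ev_cong[OF F0(1)]) auto
    then show ?thesis unfolding F0(2) ev_poly by simp
  qed
  then have F0I: "F0 \<in> I" "F0 \<noteq> 0" unfolding I_def using F0 Q by auto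
  have lin: "u * a - v * b \<in> I" if "a \<in> I" "b \<in> I" "u \<in> polys_over ?A" "v \<in> polys_over ?A" for a b u v
  proof -
    have "u * a - v * b \<in> polys_over ?A"
      by (rule P(4)[OF P(5) P(5)]) (use that in \<open>auto simp: I_def\<close>)
    then show ?thesis using that unfolding I_def by simp
  qed
  have as_poly: "\<exists>s. \<forall>x. ev x s = ?e x G" for G
    by (rule exI[of _ "\<Sum>i\<le>degree G. subst_poly y (coeff G i) * h ^ i"])
      (simp add: ev_sum ev_subst_poly poly_altdef)
  have prime: "a \<in> I \<or> b \<in> I" if ab: "a \<in> polys_over ?A" "b \<in> polys_over ?A" "a * b \<in> I" for a b
  proof -
    obtain s where s: "\<And>x. ev x s = ?e x a" using as_poly by blast
    obtain t where t: "\<And>x. ev x t = ?e x b" using as_poly by blast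
    have "s * t \<in> vanishing X"
      using ab(3) unfolding vanishing_def I_def by (simp add: s t)
    then have "s \<in> vanishing X \<or> t \<in> vanishing X" by (rule irrD[OF irr])
    then show ?thesis using ab unfolding vanishing_def I_def by (simp add: s t)
  qed
  have const: "a = 0" if "[:a:] \<in> I" for a
  proof -
    have "a \<in> ?A" using that unfolding I_def polys_over_def by (auto dest: spec[of _ 0])
    then show ?thesis using that ind unfolding I_def alg_indep_def by simp
  qed
  have IA: "I \<subseteq> polys_over ?A" unfolding I_def by blast
  obtain F where F: "F \<in> I" "F \<noteq> 0" "\<And>G. G \<in> I \<Longrightarrow> dvd_in (polys_over ?A) F G"
    by (rule prime_ideal_principal[OF u IA F0I lin prime const]) blast+
  \<comment> \<open>If T divided F, primality would make T or the cofactor a relation. The first is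
    impossible because h does not vanish on X, the second because F divides every relation and the
    cofactor has smaller degree.\<close>
  have "coeff F 0 \<noteq> 0"
  proof
    assume 0: "coeff F 0 = 0"
    then obtain F' where F': "F = pCons 0 F'" by (cases F) auto
    have F'A: "F' \<in> polys_over ?A"
      unfolding polys_over_def
    proof (intro CollectI allI)
      fix i
      have "coeff F (Suc i) \<in> ?A" using F(1) IA unfolding polys_over_def by blast
      then show "coeff F' i \<in> ?A" by (simp add: F')
    qed
    have TA: "[:0, 1:] \<in> polys_over ?A"
      by (auto simp: polys_over_def coeff_pCons split: nat.splits)
    have "[:0, 1:] * F' \<in> I" using F(1) F' by simp
    then consider "[:0, 1:] \<in> I" | "F' \<in> I" using prime[OF TA F'A] by blast
    then show False
    proof cases
      case 1
      then show False using h unfolding I_def vanishing_def by simp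
    next
      case 2
      then obtain W where "F' = F * W" using F(3) unfolding dvd_in_def by blast
      moreover have "F' \<noteq> 0" using F F' by auto
      ultimately have "degree F \<le> degree F'" by (metis degree_mult_right_le mult_zero_right)
      then show False using F' \<open>F' \<noteq> 0\<close> by simp
    qed
  qed
  moreover have "F \<in> polys_over ?A" "\<And>x. x \<in> X \<Longrightarrow> ?e x F = 0" using F(1) unfolding I_def by auto
  moreover have "dvd_in (polys_over ?A) F G"
    if "G \<in> polys_over ?A" "\<And>x. x \<in> X \<Longrightarrow> ?e x G = 0" for G
    using F(3) that unfolding I_def by blast
  ultimately show ?thesis using that by blast
qed

text \<open>On K[y, h] the assignment of \<eta> to y and of 0 to h is well defined: every relation
  is a multiple of F, whose constant term vanishes at \<eta>. Since X is finite over y, this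
  homomorphism extends to the coordinate ring of X and yields a point.\<close>

lemma exists_point_over_root:
  fixes X :: "(nat \<Rightarrow> 'a::alg_closed_field) set"
  assumes X: "algebraic_set n X" and fin: "finite_over X M y c b"
    and F: "F \<in> polys_over (polys_in {..<M})"
    and dvd: "\<And>G. G \<in> polys_over (polys_in {..<M}) \<Longrightarrow>
       (\<And>x. x \<in> X \<Longrightarrow> ev (\<lambda>j. ev x (y j)) (poly G (Const (ev x h))) = 0) \<Longrightarrow>
       dvd_in (polys_over (polys_in {..<M})) F G"
    and \<eta>: "ev \<eta> (coeff F 0) = 0"
  obtains x where "x \<in> X" "ev x h = 0" "\<And>j. j < M \<Longrightarrow> ev x (y j) = \<eta> j"
proof -
  let ?A = "polys_in {..<M} :: 'a mpoly set" and ?y = "\<lambda>x j. ev x (y j)"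
  let ?e = "\<lambda>x G. ev (?y x) (poly G (Const (ev x h)))"
  note P = subringD[OF subring_polys_over[OF subring_polys_in[of "{..<M}"]]]
  \<comment> \<open>On X the polynomial s is the function G(y, h). Thus \<open>S\<close> is the
    preimage of K[y, h] in the polynomial ring, and \<chi> takes the constant term of G at
    \<eta>.\<close>
  define rep where "rep G s \<longleftrightarrow> G \<in> polys_over ?A \<and> (\<forall>x\<in>X. ev x s = ?e x G)" for G s
  define S where "S = {s. \<exists>G. rep G s}"
  define \<chi> where "\<chi> s = ev \<eta> (coeff (SOME G. rep G s) 0)" for s
  have \<chi>: "\<chi> s = ev \<eta> (coeff G 0)" if G: "rep G s" for G s
  proof -
    let ?H = "SOME H. rep H s"
    have H: "rep ?H s" by (rule someI[of _ G]) (rule G)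
    have "dvd_in (polys_over ?A) F (?H - G)"
    proof (rule dvd)
      show "?H - G \<in> polys_over ?A" using H G P unfolding rep_def by blast
      show "?e x (?H - G) = 0" if "x \<in> X" for x using H G that unfolding rep_def by simp
    qed
    then obtain W where "?H - G = F * W" unfolding dvd_in_def by blast
    then have "coeff ?H 0 - coeff G 0 = coeff F 0 * coeff W 0"
      by (metis coeff_diff coeff_mult_0)
    then have "ev \<eta> (coeff ?H 0) - ev \<eta> (coeff G 0) = 0"
      using \<eta> by (metis ev_diff ev_mult mult_zero_left)
    then show ?thesis unfolding \<chi>_def by simp
  qed
  have rep_const: "rep [:a:] s" if "a \<in> ?A" "\<And>x. x \<in> X \<Longrightarrow> ev x s = ev (?y x) a" for a s
    using that polys_over_const[OF subring_polys_in] unfolding rep_def by simp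
  have rep0: "rep 0 s" if "s \<in> vanishing X" for s
    using that P(1) unfolding rep_def vanishing_def by simp
  have repC: "rep [:Const k:] (Const k)" for k by (rule rep_const) auto
  have reph: "rep [:0, 1:] h"
    unfolding rep_def by (auto simp: polys_over_def coeff_pCons split: nat.splits)
  have repy: "rep [:Var j:] (y j)" if "j < M" for j
    using that by (intro rep_const) (auto intro: polys_in_Var)
  have rep_ops: "rep (G + H) (s + t)" "rep (G - H) (s - t)" "rep (G * H) (s * t)"
    if "rep G s" "rep H t" for G H s t
    using that P unfolding rep_def by auto
  have sub: "subring S"
    unfolding subring_def S_def
  proof (intro conjI ballI)
    show "0 \<in> {s. \<exists>G. rep G s}" using rep0[of 0] by (auto simp: vanishing_def)
    show "1 \<in> {s. \<exists>G. rep G s}" using repC[of 1] by auto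
  qed (use rep_ops in blast)+
  have "hom_on S \<chi>"
    unfolding hom_on_def
  proof (intro conjI ballI)
    show "\<chi> 1 = 1" using \<chi>[OF repC[of 1]] by simp
    fix s t assume "s \<in> S" "t \<in> S"
    then obtain G H where GH: "rep G s" "rep H t" unfolding S_def by blast
    show "\<chi> (s + t) = \<chi> s + \<chi> t" using \<chi>[OF rep_ops(1)[OF GH]] \<chi>[OF GH(1)] \<chi>[OF GH(2)] by simp
    show "\<chi> (s * t) = \<chi> s * \<chi> t"
      using \<chi>[OF rep_ops(3)[OF GH]] \<chi>[OF GH(1)] \<chi>[OF GH(2)] by (simp add: coeff_mult_0)
  qed
  \<comment> \<open>The expansion from \<open>finite_over\<close> holds on X only. The additional
    generator 1 absorbs the error, which lies in \<open>vanishing X\<close> and hence in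
    \<open>S\<close>.\<close>
  moreover have "spans_over S (Suc c) (b(c := 1))"
    unfolding spans_over_def
  proof
    fix f
    obtain p where p: "\<And>l. p l \<in> ?A" "\<And>x. x \<in> X \<Longrightarrow> ev x f = (\<Sum>l<c. ev (?y x) (p l) * ev x (b l))"
      using fin unfolding finite_over_def by metis
    define r where "r = f - (\<Sum>l<c. subst_poly y (p l) * b l)"
    have "r \<in> vanishing X" unfolding r_def vanishing_def by (simp add: ev_sum ev_subst_poly p(2))
    then have rS: "r \<in> S" using rep0 unfolding S_def by blast
    have "rep [:p l:] (subst_poly y (p l))" for l
      by (rule rep_const) (auto simp: p(1) ev_subst_poly)
    then have "subst_poly y (p l) \<in> S" for l unfolding S_def by blast
    moreover have "f = (\<Sum>l<Suc c. (if l = c then r else subst_poly y (p l)) * (b(c := 1)) l)"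
      by (simp add: r_def)
    ultimately show "\<exists>p. (\<forall>l. p l \<in> S) \<and> f = (\<Sum>l<Suc c. p l * (b(c := 1)) l)"
      using rS by (intro exI[of _ "\<lambda>l. if l = c then r else subst_poly y (p l)"]) auto
  qed
  moreover have "range Const \<subseteq> S" using repC unfolding S_def by blast
  moreover have "vanishing X \<subseteq> S" using rep0 unfolding S_def by blast
  moreover have "\<chi> (Const k) = k" for k using \<chi>[OF repC] by simp
  moreover have "\<chi> p = 0" if "p \<in> vanishing X" for p using \<chi>[OF rep0[OF that]] by simp
  ultimately obtain x where x: "x \<in> X" "\<And>s. s \<in> S \<Longrightarrow> ev x s = \<chi> s"
    using exists_point_over_hom[OF X sub] by blast
  have "h \<in> S" using reph unfolding S_def by blast
  then have "ev x h = 0" using x(2) \<chi>[OF reph] by simp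
  moreover have "ev x (y j) = \<eta> j" if "j < M" for j
  proof -
    have "y j \<in> S" using repy[OF that] unfolding S_def by blast
    then show ?thesis using x(2) \<chi>[OF repy[OF that]] by simp
  qed
  ultimately show ?thesis using x(1) that by blast
qed

text \<open>Krull's principal ideal theorem. If \<open>F\<close> generates the relations between \<open>y\<close> and \<open>h\<close>, then
  \<open>X \<inter> {h = 0}\<close> projects onto the hypersurface \<open>{F(y, 0) = 0}\<close>, on which the coordinates other than some \<open>y\<^sub>j\<close>
  occurring in \<open>F(y, 0)\<close> are independent.\<close>

lemma hypersurface_section:
  fixes X :: "(nat \<Rightarrow> 'a::alg_closed_field) set"
  assumes X: "algebraic_set n X" "irr X" and p0: "p0 \<in> X" "ev p0 h = 0" and h: "h \<notin> vanishing X"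
    and f: "alg_indep X J f" "finite J"
  obtains J' y where "finite J'" "card J \<le> Suc (card J')" "alg_indep {x \<in> X. ev x h = 0} J' y"
proof -
  have "X \<subseteq> affine_space n" "X \<noteq> {}" using X unfolding algebraic_set_def irr_def by blast+
  then obtain M y c b where y: "finite_over X M y c b" "alg_indep X {..<M} y"
    by (rule noether_normalisation)
  have JM: "card J \<le> M" by (rule alg_indep_card_le[OF y(1) f])
  obtain F where F: "F \<in> polys_over (polys_in {..<M})" "coeff F 0 \<noteq> 0"
    "\<And>x. x \<in> X \<Longrightarrow> ev (\<lambda>j. ev x (y j)) (poly F (Const (ev x h))) = 0"
    and dvd: "\<And>G. G \<in> polys_over (polys_in {..<M}) \<Longrightarrow>
       (\<And>x. x \<in> X \<Longrightarrow> ev (\<lambda>j. ev x (y j)) (poly G (Const (ev x h))) = 0) \<Longrightarrow>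
       dvd_in (polys_over (polys_in {..<M})) F G"
    by (rule relations_principal[OF X(2) y h]) blast
  let ?c = "coeff F 0"
  have cA: "?c \<in> polys_in {..<M}" using F(1) unfolding polys_over_def by blast
  have cp: "ev (\<lambda>j. ev p0 (y j)) ?c = 0" using F(3)[OF p0(1)] p0(2) by (simp add: poly_0_coeff_0)
  \<comment> \<open>If F(y, 0) involved no variable it would be a constant, and then zero, because
    it vanishes at \<open>p0\<close>.\<close>
  obtain j where j: "j < M" "?c \<notin> polys_in ({..<M} - {j})"
  proof -
    have "\<exists>j<M. ?c \<notin> polys_in ({..<M} - {j})"
    proof (rule ccontr)
      assume "\<not> ?thesis"
      then have "keys m \<subseteq> {..<M} - {j}" if "m \<in> keys ?c" "j < M" for m j
        using that unfolding polys_in_def by blast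
      moreover have "keys m \<subseteq> {..<M}" if "m \<in> keys ?c" for m using cA that unfolding polys_in_def by blast
      ultimately have "keys m = {}" if "m \<in> keys ?c" for m using that by blast
      then have "?c \<in> polys_in {}" unfolding polys_in_def by simp
      then obtain a where "?c = Const a" by (rule polys_in_empty)
      then show False using cp F(2) by simp
    qed
    then show ?thesis using that by blast
  qed
  define J' where "J' = {..<M} - {j}"
  have "?c \<in> polys_in (insert j J')" using cA j(1) unfolding J'_def by (simp add: insert_absorb)
  then obtain C where C: "C \<in> polys_over (polys_in J')" "?c = poly C (Var j)"
    by (rule polys_in_insert_decompose)
  have "degree C > 0"
  proof (rule ccontr)
    assume "\<not> ?thesis"
    then obtain a where "C = [:a:]" by (auto elim: degree_eq_zeroE)
    then have "?c \<in> polys_in J'" using C unfolding polys_over_def by (auto dest: spec[of _ 0])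
    then show False using j(2) unfolding J'_def by blast
  qed
  then have C0: "lead_coeff C \<noteq> 0" by auto
  have "alg_indep {x \<in> X. ev x h = 0} J' y"
    unfolding alg_indep_def
  proof (intro ballI impI, rule ccontr)
    fix q assume q: "q \<in> polys_in J'" "\<forall>x\<in>{x \<in> X. ev x h = 0}. ev (\<lambda>j. ev x (y j)) q = 0" "q \<noteq> 0"
    \<comment> \<open>At \<eta> both q and the leading coefficient of F(y, 0) in y_j are non-zero.
      Neither involves y_j, so y_j can be moved to a root of F(y, 0), and the point of the section
      above it contradicts the vanishing of q.\<close>
    have "q * lead_coeff C \<noteq> 0" using q(3) C0 by simp
    then obtain \<eta> where "ev \<eta> (q * lead_coeff C) \<noteq> 0" by (rule exists_ev_nonzero)
    then have \<eta>: "ev \<eta> q \<noteq> 0" "ev \<eta> (lead_coeff C) \<noteq> 0" by auto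
    have "coeff (map_poly (ev \<eta>) C) (degree C) \<noteq> 0" using \<eta>(2) by (simp add: coeff_map_poly)
    then have "degree (map_poly (ev \<eta>) C) \<ge> degree C" by (rule le_degree)
    then obtain \<xi> where \<xi>: "poly (map_poly (ev \<eta>) C) \<xi> = 0"
      using \<open>degree C > 0\<close> alg_closed_imp_poly_has_root[of "map_poly (ev \<eta>) C"] by auto
    let ?\<eta> = "\<eta>(j := \<xi>)"
    have "map_poly (ev ?\<eta>) C = map_poly (ev \<eta>) C"
      by (intro map_poly_ev_cong[OF C(1)]) (auto simp: J'_def)
    then have "ev ?\<eta> ?c = 0" unfolding C(2) ev_poly using \<xi> by simp
    from exists_point_over_root[OF X(1) y(1) F(1) dvd this]
    obtain x where x: "x \<in> X" "ev x h = 0" "\<And>j. j < M \<Longrightarrow> ev x (y j) = ?\<eta> j" by blast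
    have "ev (\<lambda>j. ev x (y j)) q = ev \<eta> q"
      using x(3) by (intro ev_cong[OF q(1)]) (auto simp: J'_def)
    then show False using q(2) x \<eta>(1) by simp
  qed
  moreover have "finite J'" "card J \<le> Suc (card J')" using JM j(1) unfolding J'_def by auto
  ultimately show ?thesis using that by blast
qed

section \<open>Localisation\<close>

text \<open>The principal open subset \<open>g \<noteq> 0\<close> of \<open>X \<subseteq> K\<^sup>n\<close>, realised as a closed subset of \<open>K\<^bsup>n+1\<^esup>\<close>.\<close>

definition loc_point :: "nat \<Rightarrow> 'a::field mpoly \<Rightarrow> (nat \<Rightarrow> 'a) \<Rightarrow> nat \<Rightarrow> 'a" where
  "loc_point n g x = x(n := inverse (ev x g))"

definition loc :: "nat \<Rightarrow> 'a::field mpoly \<Rightarrow> (nat \<Rightarrow> 'a) set \<Rightarrow> (nat \<Rightarrow> 'a) set" where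
  "loc n g X = loc_point n g ` {x \<in> X. ev x g \<noteq> 0}"

lemma ev_restrict_loc_point:
  assumes "x \<in> affine_space n"
  shows "ev (loc_point n g x) (restrict_vars {..<n} p) = ev x p"
proof -
  have "(\<lambda>i. if i \<in> {..<n} then loc_point n g x i else 0) = x"
    using assms by (fastforce simp: affine_space_def loc_point_def)
  then show ?thesis by (simp add: ev_restrict_vars)
qed

text \<open>The equations are those of X, written without the new coordinate, and x_n g = 1.\<close>

lemma algebraic_loc:
  assumes "algebraic_set n X"
  shows "algebraic_set (Suc n) (loc n g X)"
  unfolding algebraic_set_def
proof (intro equalityI subsetI)
  have aff: "X \<subseteq> affine_space n" using assms unfolding algebraic_set_def by blast
  {
    fix x assume "x \<in> loc n g X"
    then show "x \<in> {x \<in> affine_space (Suc n). \<forall>p\<in>vanishing (loc n g X). ev x p = 0}"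
      using aff by (auto simp: vanishing_def loc_def loc_point_def affine_space_def)
  next
    fix x assume x: "x \<in> {x \<in> affine_space (Suc n). \<forall>p\<in>vanishing (loc n g X). ev x p = 0}"
    define x0 where "x0 = (\<lambda>i. if i \<in> {..<n} then x i else 0)"
    have r: "ev x (restrict_vars {..<n} p) = ev x0 p" for p by (simp add: ev_restrict_vars x0_def)
    have "ev x0 p = 0" if "p \<in> vanishing X" for p
    proof -
      have "restrict_vars {..<n} p \<in> vanishing (loc n g X)"
        using that aff by (auto simp: vanishing_def loc_def ev_restrict_loc_point subset_iff)
      then show ?thesis using x r by auto
    qed
    moreover have "x0 \<in> affine_space n" by (auto simp: x0_def affine_space_def)
    ultimately have x0: "x0 \<in> X" using assms unfolding algebraic_set_def by blast
    have "Var n * restrict_vars {..<n} g - 1 \<in> vanishing (loc n g X)"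
      using aff by (auto simp: vanishing_def loc_def ev_restrict_loc_point subset_iff) (auto simp: loc_point_def)
    then have "x n * ev x0 g - 1 = 0" using x r by fastforce
    then have "ev x0 g * x n = 1" by (simp add: mult.commute)
    then have g: "ev x0 g \<noteq> 0" "x n = inverse (ev x0 g)" by (auto dest: inverse_unique)
    have "x = loc_point n g x0"
    proof
      fix i show "x i = loc_point n g x0 i"
        using x g(2) by (auto simp: loc_point_def x0_def affine_space_def)
    qed
    then show "x \<in> loc n g X" using x0 g(1) unfolding loc_def by blast
  }
qed

lemma clear_denominators:
  fixes g p :: "'a::field mpoly"
  shows "\<exists>e p'. \<forall>x. ev x g \<noteq> 0 \<longrightarrow> ev x p' = ev x g ^ e * ev (loc_point n g x) p"
proof -
  let ?S = "{p. \<exists>e p'. \<forall>x. ev x g \<noteq> 0 \<longrightarrow> ev x p' = ev x g ^ e * ev (loc_point n g x) p}"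
  have "?S = UNIV"
  proof (rule subring_UNIV_if)
    show "subring ?S"
      unfolding subring_def
    proof (intro conjI ballI)
      show "0 \<in> ?S" by (intro CollectI exI[of _ 0] exI[of _ 0]) simp
      show "1 \<in> ?S" by (intro CollectI exI[of _ 0] exI[of _ 1]) simp
      fix p q assume "p \<in> ?S" "q \<in> ?S"
      then obtain e p' e' q' where
        "\<And>x. ev x g \<noteq> 0 \<Longrightarrow> ev x p' = ev x g ^ e * ev (loc_point n g x) p"
        "\<And>x. ev x g \<noteq> 0 \<Longrightarrow> ev x q' = ev x g ^ e' * ev (loc_point n g x) q" by blast
      note * = this
      show "p + q \<in> ?S"
        by (intro CollectI exI[of _ "e + e'"] exI[of _ "g ^ e' * p' + g ^ e * q'"])
          (simp add: * power_add algebra_simps)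
      show "p - q \<in> ?S"
        by (intro CollectI exI[of _ "e + e'"] exI[of _ "g ^ e' * p' - g ^ e * q'"])
          (simp add: * power_add algebra_simps)
      show "p * q \<in> ?S"
        by (intro CollectI exI[of _ "e + e'"] exI[of _ "p' * q'"])
          (simp add: * power_add algebra_simps)
    qed
    show "range Const \<subseteq> ?S"
    proof
      fix p :: "'a mpoly" assume "p \<in> range Const"
      then show "p \<in> ?S" by (intro CollectI exI[of _ 0] exI[of _ p]) auto
    qed
    have "Var i \<in> ?S" for i
    proof (cases "i = n")
      case True
      then show ?thesis by (intro CollectI exI[of _ 1] exI[of _ 1]) (simp add: loc_point_def)
    next
      case False
      then show ?thesis by (intro CollectI exI[of _ 0] exI[of _ "Var i"]) (simp add: loc_point_def)
    qed
    then show "range Var \<subseteq> ?S" by blast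
  qed
  then show ?thesis by blast
qed

text \<open>With denominators cleared, p' q' g vanishes on all of X; the factor g takes care of the
  points removed by the localisation. Primality on X then applies, as g does not vanish on
  X.\<close>

lemma irr_loc:
  assumes X: "irr X" and g: "g \<notin> vanishing X"
  shows "irr (loc n g X)"
  unfolding irr_def
proof (intro conjI allI impI)
  show "loc n g X \<noteq> {}" using g unfolding loc_def vanishing_def by auto
  fix p q assume pq: "p * q \<in> vanishing (loc n g X)"
  obtain e p' where p': "\<And>x. ev x g \<noteq> 0 \<Longrightarrow> ev x p' = ev x g ^ e * ev (loc_point n g x) p"
    using clear_denominators by blast
  obtain e' q' where q': "\<And>x. ev x g \<noteq> 0 \<Longrightarrow> ev x q' = ev x g ^ e' * ev (loc_point n g x) q"
    using clear_denominators by blast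
  have "ev x (p' * q' * g) = 0" if "x \<in> X" for x
  proof (cases "ev x g = 0")
    case False
    then have "ev (loc_point n g x) (p * q) = 0" using pq that unfolding vanishing_def loc_def by blast
    then show ?thesis using p'[OF False] q'[OF False] by auto
  qed simp
  then have "p' * q' * g \<in> vanishing X" unfolding vanishing_def by blast
  then have "p' \<in> vanishing X \<or> q' \<in> vanishing X" using irrD[OF X] g by blast
  then show "p \<in> vanishing (loc n g X) \<or> q \<in> vanishing (loc n g X)"
    using p' q' unfolding vanishing_def loc_def by fastforce
qed

lemma alg_indep_loc:
  assumes X: "irr X" "X \<subseteq> affine_space n" and g: "g \<notin> vanishing X" and f: "alg_indep X J f"
  shows "alg_indep (loc n g X) J (\<lambda>j. restrict_vars {..<n} (f j))"
  unfolding alg_indep_def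
proof (intro ballI impI)
  fix Q assume Q: "Q \<in> polys_in J" "\<forall>x\<in>loc n g X. ev (\<lambda>j. ev x (restrict_vars {..<n} (f j))) Q = 0"
  have "ev x (subst_poly f Q * g) = 0" if x: "x \<in> X" for x
  proof (cases "ev x g = 0")
    case False
    then have "loc_point n g x \<in> loc n g X" using x unfolding loc_def by blast
    then have "ev (\<lambda>j. ev (loc_point n g x) (restrict_vars {..<n} (f j))) Q = 0" using Q(2) by blast
    moreover have "x \<in> affine_space n" using x X(2) by blast
    ultimately show ?thesis by (simp add: ev_restrict_loc_point ev_subst_poly)
  qed simp
  then have "subst_poly f Q * g \<in> vanishing X" unfolding vanishing_def by blast
  then have "subst_poly f Q \<in> vanishing X" using irrD[OF X(1)] g by blast
  then show "Q = 0" using f Q(1) unfolding alg_indep_vanishing by blast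
qed

section \<open>The Zariski topology is Noetherian\<close>

lemma incseq_subsequence:
  fixes a :: "nat \<Rightarrow> nat"
  obtains s :: "nat \<Rightarrow> nat" where "strict_mono s" "incseq (a \<circ> s)"
proof -
  obtain s where s: "strict_mono s" "monoseq (\<lambda>i. a (s i))" using seq_monosub[of a] by blast
  show ?thesis
  proof (cases "incseq (\<lambda>i. a (s i))")
    case True
    then show ?thesis using that[of s] s by (simp add: comp_def)
  next
    case False
    then have dec: "decseq (\<lambda>i. a (s i))" using s by (auto simp: monoseq_iff)
    \<comment> \<open>A decreasing sequence of natural numbers is constant from the index of its
      minimum on.\<close>
    obtain N where N: "\<And>i. a (s N) \<le> a (s i)"
      using ex_has_least_nat[of "\<lambda>_. True" 0 "\<lambda>i. a (s i)"] by auto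
    have "incseq (a \<circ> (\<lambda>i. s (N + i)))"
    proof (rule incseq_SucI)
      fix i
      have "a (s (N + i)) \<le> a (s N)" using dec unfolding decseq_def by simp
      also have "\<dots> \<le> a (s (N + Suc i))" by (rule N)
      finally show "(a \<circ> (\<lambda>i. s (N + i))) i \<le> (a \<circ> (\<lambda>i. s (N + i))) (Suc i)" by simp
    qed
    moreover have "strict_mono (\<lambda>i. s (N + i))" using s(1) by (auto simp: strict_mono_def)
    ultimately show ?thesis using that by blast
  qed
qed

text \<open>Passing to subsequences n times makes every exponent non-decreasing; then the first two
  terms are comparable.\<close>

lemma dickson:
  fixes m :: "nat \<Rightarrow> (nat \<Rightarrow>\<^sub>0 nat)"
  assumes "\<And>i. keys (m i) \<subseteq> {..<n}"
  obtains i j d where "i < j" "m j = m i + d" "keys d \<subseteq> {..<n}"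
proof -
  have "\<exists>s :: nat \<Rightarrow> nat. strict_mono s \<and> (\<forall>k<l. incseq (\<lambda>i. lookup (m (s i)) k))" for l
  proof (induction l)
    case 0
    then show ?case by (intro exI[of _ id]) (auto simp: strict_mono_def)
  next
    case (Suc l)
    then obtain s :: "nat \<Rightarrow> nat" where s: "strict_mono s" "\<And>k. k < l \<Longrightarrow> incseq (\<lambda>i. lookup (m (s i)) k)" by blast
    obtain t where t: "strict_mono t" "incseq ((\<lambda>i. lookup (m (s i)) l) \<circ> t)"
      using incseq_subsequence by blast
    have "incseq (\<lambda>i. lookup (m ((s \<circ> t) i)) k)" if "k < Suc l" for k
    proof (cases "k = l")
      case False
      then have "incseq (\<lambda>i. lookup (m (s i)) k)" using s(2) that by simp
      then show ?thesis using strict_mono_less_eq[OF t(1)] unfolding incseq_def by simp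
    qed (use t(2) in \<open>simp add: comp_def\<close>)
    moreover have "strict_mono (s \<circ> t)" using s(1) t(1) by (rule strict_mono_o)
    ultimately show ?case by blast
  qed
  from this[of n] obtain s :: "nat \<Rightarrow> nat" where s: "strict_mono s" "\<And>k. k < n \<Longrightarrow> incseq (\<lambda>i. lookup (m (s i)) k)"
    by blast
  have le: "lookup (m (s 0)) k \<le> lookup (m (s 1)) k" for k
  proof (cases "k < n")
    case True
    then show ?thesis using s(2) unfolding incseq_def by blast
  next
    case False
    then have "k \<notin> keys (m (s 0))" using assms by blast
    then show ?thesis by (simp add: in_keys_iff)
  qed
  have eq: "m (s 1) = m (s 0) + (m (s 1) - m (s 0))"
    using le by (intro poly_mapping_eqI) (simp add: lookup_add lookup_minus)
  moreover have "keys (m (s 1) - m (s 0)) \<subseteq> keys (m (s 1))"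
    by (auto simp: in_keys_iff lookup_minus)
  moreover have "s 0 < s 1" using s(1) by (simp add: strict_mono_def)
  ultimately show ?thesis using that assms by blast
qed

lemma monom_zero_le: "(0 :: nat \<Rightarrow>\<^sub>0 nat) \<le> d"
proof -
  have "\<not> d < 0" unfolding less_poly_mapping.rep_eq less_fun_def by simp
  then show ?thesis by simp
qed

text \<open>In a descending sequence Dickson's lemma finds i < j with f j = f i + d, and 0 \<le> d
  gives f i \<le> f j.\<close>

lemma wf_monoms: "wf {(a, b). a < b \<and> keys a \<subseteq> {..<n} \<and> keys (b :: nat \<Rightarrow>\<^sub>0 nat) \<subseteq> {..<n}}"
  unfolding wf_iff_no_infinite_down_chain
proof
  assume "\<exists>f. \<forall>i. (f (Suc i), f i) \<in> {(a, b). a < b \<and> keys a \<subseteq> {..<n} \<and> keys (b :: nat \<Rightarrow>\<^sub>0 nat) \<subseteq> {..<n}}"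
  then obtain f :: "nat \<Rightarrow> (nat \<Rightarrow>\<^sub>0 nat)" where f: "\<And>i. f (Suc i) < f i" "\<And>i. keys (f i) \<subseteq> {..<n}"
    by blast
  obtain i j d where "i < j" and d: "f j = f i + d" using dickson[of f] f(2) by metis
  have "f j < f i" using \<open>i < j\<close>
  proof (induction j)
    case (Suc j)
    then show ?case using f(1)[of j] by (cases "i = j") auto
  qed simp
  moreover have "f i + 0 \<le> f i + d" by (intro add_left_mono monom_zero_le)
  ultimately show False using d by simp
qed

section \<open>Ascending chains of ideals\<close>

lemma lookup_single_mult: "lookup (Poly_Mapping.single d c * p) (d + m) = c * lookup (p :: 'a::field mpoly) m"
proof (induction p rule: mpoly_induct)
  case (add m' c' p)
  have "d + m' = d + m \<longleftrightarrow> m' = m" by simp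
  then show ?case using add by (auto simp: distrib_left mult_single lookup_add lookup_single when_def)
qed simp

text \<open>Hilbert's basis theorem by leading monomials. In each difference I(k+1) - I(k) take an
  element p_k with minimal leading monomial. Dickson's lemma gives i < j such that the leading
  monomial of p_j is a multiple of that of p_i; subtracting a multiple of p_i from p_j lowers the
  leading monomial without leaving the difference, against minimality.\<close>

lemma ideal_chain:
  fixes I :: "nat \<Rightarrow> 'a::field mpoly set"
  assumes sub: "\<And>k. I k \<subseteq> polys_in {..<n}" and zero: "\<And>k. 0 \<in> I k"
    and add: "\<And>k p q. p \<in> I k \<Longrightarrow> q \<in> I k \<Longrightarrow> p + q \<in> I k"
    and mult: "\<And>k p q. p \<in> I k \<Longrightarrow> q \<in> polys_in {..<n} \<Longrightarrow> q * p \<in> I k"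
  shows "\<exists>k. \<not> I k \<subset> I (Suc k)"
proof (rule ccontr)
  assume "\<nexists>k. \<not> I k \<subset> I (Suc k)"
  then have inc: "I k \<subset> I (Suc k)" for k by blast
  have mono: "I i \<subseteq> I j" if "i \<le> j" for i j
    by (rule lift_Suc_mono_le[of I, OF _ that]) (use inc in blast)
  let ?lm = "\<lambda>p. Max (keys p) :: nat \<Rightarrow>\<^sub>0 nat"
  have lm: "?lm p \<in> keys p" "\<And>m. m \<in> keys p \<Longrightarrow> m \<le> ?lm p" if "p \<noteq> 0" for p :: "'a mpoly"
    using that by (auto intro: Max_in)
  have "\<exists>p. p \<in> I (Suc k) - I k \<and> (\<forall>q\<in>I (Suc k) - I k. \<not> ?lm q < ?lm p)" for k
  proof -
    have nz: "p \<noteq> 0" "keys (?lm p) \<subseteq> {..<n}" if "p \<in> I (Suc k) - I k" for p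
    proof -
      show "p \<noteq> 0" using that zero by blast
      then show "keys (?lm p) \<subseteq> {..<n}"
        using lm(1)[of p] that sub[of "Suc k"] unfolding polys_in_def by blast
    qed
    obtain p where "p \<in> I (Suc k) - I k" using inc by blast
    then have "?lm p \<in> ?lm ` (I (Suc k) - I k)" by blast
    from wfE_min[OF wf_monoms[of n] this] obtain z where
      z: "z \<in> ?lm ` (I (Suc k) - I k)"
      "\<And>y. (y, z) \<in> {(a, b). a < b \<and> keys a \<subseteq> {..<n} \<and> keys b \<subseteq> {..<n}} \<Longrightarrow> y \<notin> ?lm ` (I (Suc k) - I k)"
      by blast
    then obtain p where p: "p \<in> I (Suc k) - I k" "z = ?lm p" by blast
    have "\<not> ?lm q < ?lm p" if "q \<in> I (Suc k) - I k" for q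
      using z(2)[of "?lm q"] nz(2)[OF that] nz(2)[OF p(1)] p(2) that by blast
    then show ?thesis using p(1) by blast
  qed
  then obtain p where p: "\<And>k. p k \<in> I (Suc k) - I k"
    and min: "\<And>k q. q \<in> I (Suc k) - I k \<Longrightarrow> \<not> ?lm q < ?lm (p k)" by metis
  have p0: "p k \<noteq> 0" for k using p[of k] zero[of k] by auto
  have pk: "p k \<in> polys_in {..<n}" for k using p[of k] sub by blast
  have "keys (?lm (p k)) \<subseteq> {..<n}" for k
    using lm(1)[OF p0] pk unfolding polys_in_def by blast
  from dickson[of "\<lambda>k. ?lm (p k)", OF this]
  obtain i j d where ij: "i < j" "?lm (p j) = ?lm (p i) + d" "keys d \<subseteq> {..<n}" by blast
  \<comment> \<open>The quotient of the leading coefficients, so that the leading terms of p_j and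
    of the multiple of p_i cancel.\<close>
  define e where "e = lookup (p j) (?lm (p j)) / lookup (p i) (?lm (p i))"
  let ?s = "Poly_Mapping.single d (- e) * p i"
  define q where "q = p j + ?s"
  have "?s \<in> I (Suc i)" using p[of i] ij(3) by (intro mult polys_in_single) auto
  then have s: "?s \<in> I j" using mono[of "Suc i" j] ij(1) by auto
  have "q \<in> I (Suc j)" unfolding q_def using p[of j] s mono[of j "Suc j"] by (intro add) auto
  moreover have "q \<notin> I j"
  proof
    assume "q \<in> I j"
    then have "q + (- 1) * ?s \<in> I j"
      by (rule add[OF _ mult[OF s]]) (auto intro: polys_in_uminus)
    then show False using p[of j] unfolding q_def by simp
  qed
  ultimately have q: "q \<in> I (Suc j) - I j" by blast
  then have "q \<noteq> 0" using zero by blast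
  have "m < ?lm (p j)" if m: "m \<in> keys q" for m
  proof -
    have "m \<noteq> ?lm (p j)"
    proof
      assume eq: "m = ?lm (p j)"
      have "lookup ?s (d + ?lm (p i)) = - e * lookup (p i) (?lm (p i))" by (rule lookup_single_mult)
      then have "lookup ?s m = - lookup (p j) m"
        using lm(1)[OF p0[of i]] eq ij(2) by (auto simp: e_def in_keys_iff add.commute)
      then show False using m by (simp add: q_def in_keys_iff lookup_add)
    qed
    moreover have "m \<le> ?lm (p j)"
    proof -
      consider "m \<in> keys (p j)" | "m \<in> keys ?s"
        using m Poly_Mapping.keys_add[of "p j" ?s] unfolding q_def by blast
      then show ?thesis
      proof cases
        case 1
        then show ?thesis using lm(2)[OF p0] by blast
      next
        case 2
        then obtain b where "b \<in> keys (p i)" "m = d + b"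
          using keys_mult[of "Poly_Mapping.single d (- e)" "p i"] by (auto split: if_splits)
        then show ?thesis using lm(2)[OF p0] ij(2) by (metis add.commute add_left_mono)
      qed
    qed
    ultimately show ?thesis by simp
  qed
  then have "?lm q < ?lm (p j)" using lm(1)[OF \<open>q \<noteq> 0\<close>] by blast
  then show False using min[OF q] by blast
qed

section \<open>Noetherian spaces and decomposition of closed sets\<close>

definition noetherian_top :: "'p topology \<Rightarrow> bool" where
  "noetherian_top T \<longleftrightarrow> wf {(A, B). closedin T A \<and> closedin T B \<and> A \<subset> B}"

lemma in_vanishing_restrict:
  assumes "X \<subseteq> affine_space n"
  shows "restrict_vars {..<n} p \<in> vanishing X \<longleftrightarrow> p \<in> vanishing X"
proof -
  have "(\<lambda>i. if i \<in> {..<n} then x i else 0) = x" if "x \<in> X" for x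
    using that assms by (fastforce simp: affine_space_def)
  then show ?thesis unfolding vanishing_def by (simp add: ev_restrict_vars)
qed

lemma zero_set_ev: "F \<subseteq> polys n \<Longrightarrow> zero_set n F = {x \<in> affine_space n. \<forall>p\<in>F. ev x p = 0}"
  unfolding zero_set_def using eval_poly_eq_ev by (metis (no_types, lifting) subsetD)

lemma closedin_zariski_algebraic: "closedin (zariski n) V \<longleftrightarrow> algebraic_set n V"
proof
  assume "closedin (zariski n) V"
  then obtain F where "F \<subseteq> polys n" "V = zero_set n F" unfolding closedin_zariski_iff by blast
  then show "algebraic_set n V" unfolding algebraic_set_def vanishing_def by (auto simp: zero_set_ev)
next
  assume V: "algebraic_set n V"
  then have aff: "V \<subseteq> affine_space n" unfolding algebraic_set_def by blast
  let ?F = "vanishing V \<inter> polys n"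
  have "V = zero_set n ?F"
  proof (intro equalityI subsetI)
    fix x assume x: "x \<in> zero_set n ?F"
    then have xa: "x \<in> affine_space n" by (simp add: zero_set_def)
    have "ev x p = 0" if "p \<in> vanishing V" for p
    proof -
      have "restrict_vars {..<n} p \<in> ?F"
        using that in_vanishing_restrict[OF aff] restrict_vars_in polys_eq_polys_in by blast
      then have "ev x (restrict_vars {..<n} p) = 0" using x by (auto simp: zero_set_ev)
      moreover have "(\<lambda>i. if i \<in> {..<n} then x i else 0) = x"
        using xa by (fastforce simp: affine_space_def)
      ultimately show ?thesis by (simp add: ev_restrict_vars)
    qed
    then show "x \<in> V" using V xa unfolding algebraic_set_def by blast
  qed (use aff in \<open>auto simp: zero_set_ev vanishing_def\<close>)
  then show "closedin (zariski n) V" unfolding closedin_zariski_iff by blast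
qed

lemma closedin_zariski_zero: "closedin (zariski n) {x \<in> affine_space n. ev x p = 0}"
  unfolding closedin_zariski_algebraic algebraic_set_def vanishing_def by auto

lemma noetherian_zariski: "noetherian_top (zariski n :: (nat \<Rightarrow> 'a::field) topology)"
  unfolding noetherian_top_def wf_iff_no_infinite_down_chain
proof
  assume "\<exists>Z. \<forall>k. (Z (Suc k), Z k) \<in> {(A, B). closedin (zariski n) A \<and> closedin (zariski n) (B :: (nat \<Rightarrow> 'a) set) \<and> A \<subset> B}"
  then obtain Z where "\<forall>k. (Z (Suc k), Z k) \<in> {(A, B). closedin (zariski n) A \<and> closedin (zariski n) (B :: (nat \<Rightarrow> 'a) set) \<and> A \<subset> B}"
    by (rule exE)
  then have Z: "\<And>k. closedin (zariski n) (Z k)" "\<And>k. Z (Suc k) \<subset> Z k" by simp_all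
  define I where "I k = vanishing (Z k) \<inter> polys n" for k
  have "\<exists>k. \<not> I k \<subset> I (Suc k)"
  proof (rule ideal_chain)
    show "I k \<subseteq> polys_in {..<n}" for k unfolding I_def polys_eq_polys_in by blast
  qed (auto simp: I_def vanishing_def polys_eq_polys_in intro: polys_in_add polys_in_mult)
  then obtain k where k: "\<not> I k \<subset> I (Suc k)" by blast
  obtain x where x: "x \<in> Z k" "x \<notin> Z (Suc k)" using Z(2) by blast
  obtain F where F: "F \<subseteq> polys n" "Z (Suc k) = zero_set n F" using Z(1) unfolding closedin_zariski_iff by blast
  have "x \<in> affine_space n" using x(1) closedin_subset[OF Z(1)[of k]] by auto
  then obtain p where p: "p \<in> F" "ev x p \<noteq> 0"
    using x(2) unfolding F(2) zero_set_ev[OF F(1)] by blast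
  have "\<forall>z\<in>Z (Suc k). ev z p = 0" using p(1) unfolding F(2) zero_set_ev[OF F(1)] by blast
  then have "p \<in> I (Suc k)" "p \<notin> I k"
    using F(1) p x(1) unfolding I_def vanishing_def by blast+
  moreover have "I k \<subseteq> I (Suc k)" using Z(2)[of k] unfolding I_def vanishing_def by blast
  ultimately show False using k by blast
qed

lemma closed_decomposition:
  assumes "noetherian_top T" "closedin T V"
  shows "\<exists>F. finite F \<and> (\<forall>Y\<in>F. irreducible_closed T Y) \<and> V = \<Union>F"
  using assms(2)
proof (induction V rule: wf_induct_rule[OF assms(1)[unfolded noetherian_top_def]])
  case (1 V)
  show ?case
  proof (cases "V = {} \<or> irreducible_closed T V")
    case True
    then show ?thesis by (elim disjE) (auto intro: exI[of _ "{}"] exI[of _ "{V}"])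
  next
    case False
    then obtain A B where AB: "closedin T A" "closedin T B" "V = A \<union> B" "V \<noteq> A" "V \<noteq> B"
      using 1(2) unfolding irreducible_closed_def by blast
    then have "A \<subset> V" "B \<subset> V" by blast+
    then obtain F G where "finite F" "\<forall>Y\<in>F. irreducible_closed T Y" "A = \<Union>F"
      "finite G" "\<forall>Y\<in>G. irreducible_closed T Y" "B = \<Union>G"
      using 1 AB(1,2) by (metis (mono_tags, lifting) case_prodI mem_Collect_eq)
    then show ?thesis using AB(3) by (intro exI[of _ "F \<union> G"]) auto
  qed
qed

section \<open>Chains of irreducible closed sets and algebraic independence\<close>

lemma irreducible_closed_subtopology_irr:
  assumes "irreducible_closed (subtopology (zariski n) V) Z"
  shows "irr Z"
  unfolding irr_def
proof (intro conjI allI impI)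
  show "Z \<noteq> {}" using assms unfolding irreducible_closed_def by blast
  fix p q assume pq: "p * q \<in> vanishing Z"
  let ?A = "\<lambda>p. Z \<inter> {x \<in> affine_space n. ev x p = 0}"
  have cl: "closedin (subtopology (zariski n) V) Z" using assms unfolding irreducible_closed_def by blast
  have "closedin (subtopology (zariski n) V) (?A p)" for p
  proof -
    obtain T where T: "closedin (zariski n) T" "Z = T \<inter> V" using cl unfolding closedin_subtopology by blast
    have "closedin (zariski n) (T \<inter> {x \<in> affine_space n. ev x p = 0})"
      by (intro closedin_Int T closedin_zariski_zero)
    then show ?thesis unfolding closedin_subtopology T(2) by blast
  qed
  moreover have "Z \<subseteq> affine_space n"
    using closedin_subset[OF cl] by auto
  then have "Z = ?A p \<union> ?A q" using pq by (auto simp: vanishing_def)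
  ultimately have "Z = ?A p \<or> Z = ?A q" using assms unfolding irreducible_closed_def by blast
  then show "p \<in> vanishing Z \<or> q \<in> vanishing Z" unfolding vanishing_def by blast
qed

lemma irreducible_closed_irr:
  assumes "irreducible_closed (zariski n) Z"
  shows "irr Z"
  using irreducible_closed_subtopology_irr[of n "affine_space n" Z] assms
  by (metis subtopology_topspace topspace_zariski)

text \<open>A polynomial g that vanishes on Z d but not on Z (Suc d) is independent of the functions
  f found for Z d. In a relation G(f, g) = 0 on Z (Suc d), restriction to Z d leaves only the
  constant coefficient, which is zero by independence of f; irreducibility of Z (Suc d) allows
  division by g, and the argument repeats.\<close>

lemma chain_alg_indep:
  fixes V :: "(nat \<Rightarrow> 'a::field) set"
  assumes "\<And>i. i \<le> d \<Longrightarrow> irreducible_closed (subtopology (zariski n) V) (Z i)" "\<And>i. i < d \<Longrightarrow> Z i \<subset> Z (Suc i)"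
  shows "\<exists>f. alg_indep (Z d) {..<d} f"
  using assms
proof (induction d)
  case 0
  have "Z 0 \<noteq> {}" using 0(1)[of 0] unfolding irreducible_closed_def by blast
  have "Q = 0" if Q: "Q \<in> polys_in {}" "\<forall>x\<in>Z 0. ev (\<lambda>j. ev x (0 :: 'a mpoly)) Q = 0" for Q :: "'a mpoly"
  proof -
    obtain q where "Q = Const q" using Q(1) by (rule polys_in_empty)
    then show ?thesis using Q(2) \<open>Z 0 \<noteq> {}\<close> by auto
  qed
  then show ?case unfolding alg_indep_def by (intro exI[of _ "\<lambda>_. 0"]) auto
next
  case (Suc d)
  have "\<exists>f. alg_indep (Z d) {..<d} f" by (rule Suc.IH) (use Suc.prems in auto)
  then obtain f where f: "alg_indep (Z d) {..<d} f" by blast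
  have irr: "irr (Z (Suc d))" using irreducible_closed_subtopology_irr Suc.prems(1) by blast
  obtain x where x: "x \<in> Z (Suc d)" "x \<notin> Z d" using Suc.prems(2)[of d] by auto
  have cl: "closedin (subtopology (zariski n) V) (Z d)" "closedin (subtopology (zariski n) V) (Z (Suc d))"
    using Suc.prems(1) unfolding irreducible_closed_def by auto
  obtain T where T: "closedin (zariski n) T" "Z d = T \<inter> V" using cl(1) unfolding closedin_subtopology by blast
  obtain F where F: "F \<subseteq> polys n" "T = zero_set n F" using T(1) unfolding closedin_zariski_iff by blast
  have "x \<in> V" "x \<in> affine_space n" using closedin_subset[OF cl(2)] x(1) by auto
  then obtain g where g: "g \<in> F" "ev x g \<noteq> 0" using x(2) T(2) F by (auto simp: zero_set_ev)
  have g0: "ev z g = 0" if "z \<in> Z d" for z using that g T F by (auto simp: zero_set_ev)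
  have gn: "g \<notin> vanishing (Z (Suc d))" using x g unfolding vanishing_def by blast
  let ?f = "f(d := g)" and ?v = "\<lambda>x j. ev x (f j)"
  have key: "G = 0" if "G \<in> polys_over (polys_in {..<d})" "\<forall>x\<in>Z (Suc d). ev (?v x) (poly G (Const (ev x g))) = 0" for G
    using that
  proof (induction G)
    case (pCons a G)
    have "coeff (pCons a G) i \<in> polys_in {..<d}" for i using pCons(3) unfolding polys_over_def by blast
    from this[of 0] this[of "Suc _"] have A: "a \<in> polys_in {..<d}" "G \<in> polys_over (polys_in {..<d})"
      unfolding polys_over_def by auto
    have "ev (?v x) a = 0" if "x \<in> Z d" for x
    proof -
      have "x \<in> Z (Suc d)" using that Suc.prems(2)[of d] by auto
      then have "ev (?v x) (poly (pCons a G) (Const (ev x g))) = 0" using pCons(4) by blast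
      then show ?thesis using g0[OF that] by simp
    qed
    then have a: "a = 0" using f A(1) unfolding alg_indep_def by blast
    define s where "s = (\<Sum>i\<le>degree G. subst_poly f (coeff G i) * g ^ i)"
    have s: "ev x s = ev (?v x) (poly G (Const (ev x g)))" for x
      by (simp add: s_def ev_sum ev_subst_poly poly_altdef)
    have "g * s \<in> vanishing (Z (Suc d))" using pCons(4) unfolding vanishing_def by (simp add: s a)
    then have "s \<in> vanishing (Z (Suc d))" using irrD[OF irr] gn by blast
    then have "G = 0" using pCons.IH[OF A(2)] unfolding vanishing_def by (simp add: s)
    then show ?case using a by simp
  qed simp
  have "alg_indep (Z (Suc d)) {..<Suc d} ?f"
    unfolding alg_indep_def
  proof (intro ballI impI)
    fix Q :: "'a mpoly"
    assume Q: "Q \<in> polys_in {..<Suc d}" "\<forall>x\<in>Z (Suc d). ev (\<lambda>j. ev x (?f j)) Q = 0"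
    obtain G where G: "G \<in> polys_over (polys_in {..<d})" "Q = poly G (Var d)"
      using Q(1) polys_in_insert_decompose[of Q d "{..<d}"] by (metis lessThan_Suc)
    have "ev (?v x) (poly G (Const (ev x g))) = ev (\<lambda>j. ev x (?f j)) Q" for x
    proof -
      have "map_poly (ev (\<lambda>j. ev x (?f j))) G = map_poly (ev (?v x)) G"
        by (intro map_poly_ev_cong[OF G(1)]) auto
      then show ?thesis unfolding G(2) ev_poly by simp
    qed
    then show "Q = 0" using key[OF G(1)] Q(2) G(2) by simp
  qed
  then show ?case by blast
qed

section \<open>Krull's height theorem\<close>

lemma algebraic_separate:
  assumes "algebraic_set n Y" "p \<in> affine_space n" "p \<notin> Y"
  shows "\<exists>g\<in>vanishing Y. ev p g \<noteq> 0"
  using assms unfolding algebraic_set_def by blast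

text \<open>Krull's height theorem at an isolated point \<open>p\<close>. The induction passes to a principal open
  neighbourhood of \<open>p\<close> in which all components of \<open>X \<inter> {h = 0}\<close> contain \<open>p\<close>.\<close>

lemma isolated_point_bound:
  fixes X :: "(nat \<Rightarrow> 'a::alg_closed_field) set"
  assumes "algebraic_set n X" "irr X" "p \<in> X" "finite H" "card H \<le> k"
    and "{x \<in> X. \<forall>h\<in>H. ev x h = 0} = {p}" "alg_indep X J f" "finite J"
  shows "card J \<le> k"
  using assms
proof (induction k arbitrary: n X p H J f)
  case 0
  then have X: "X = {p}" by auto
  have "J = {}"
  proof (rule ccontr)
    assume "J \<noteq> {}"
    then obtain j where j: "j \<in> J" by blast
    let ?Q = "Var j - Const (ev p (f j))"
    have "?Q \<in> polys_in J" using j by (intro polys_in_diff polys_in_Var) auto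
    moreover have "\<forall>x\<in>X. ev (\<lambda>j. ev x (f j)) ?Q = 0" by (simp add: X)
    ultimately have "?Q = 0" using 0 unfolding alg_indep_def by blast
    then have "ev (\<lambda>_. ev p (f j) + 1) ?Q = 0" by (metis ev_0)
    then show False by simp
  qed
  then show ?case by simp
next
  case (Suc k)
  note X = Suc.prems(1-3) and H = Suc.prems(4-6) and f = Suc.prems(7,8)
  have aff: "X \<subseteq> affine_space n" using X unfolding algebraic_set_def by blast
  have Hp: "ev p h = 0" if "h \<in> H" for h using H(3) that by blast
  show ?case
  proof (cases "H \<subseteq> vanishing X")
    case True
    then have "{x \<in> X. \<forall>h\<in>H. ev x h = 0} = X" unfolding vanishing_def by blast
    then have "{x \<in> X. \<forall>h\<in>{}. ev x h = 0} = {p}" using H(3) by simp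
    then have "card J \<le> k" using Suc.IH[OF X, of "{}" J f] f by simp
    then show ?thesis by simp
  next
    case False
    then obtain h where h: "h \<in> H" "h \<notin> vanishing X" by blast
    define W where "W = {x \<in> X. ev x h = 0}"
    have W: "W = X \<inter> {x \<in> affine_space n. ev x h = 0}" using aff unfolding W_def by blast
    have "closedin (zariski n) X" unfolding closedin_zariski_algebraic by (rule X(1))
    then have "closedin (zariski n) W" unfolding W by (rule closedin_Int[OF _ closedin_zariski_zero])
    from closed_decomposition[OF noetherian_zariski this] obtain \<Y> where \<Y>: "finite \<Y>" "\<And>Y. Y \<in> \<Y> \<Longrightarrow> irreducible_closed (zariski n) Y" "W = \<Union>\<Y>"
      by blast
    have Y: "algebraic_set n Y" "irr Y" "Y \<subseteq> W" if "Y \<in> \<Y>" for Y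
    proof -
      show "irr Y" using \<Y>(2)[OF that] by (rule irreducible_closed_irr)
      show "algebraic_set n Y"
        using \<Y>(2)[OF that] unfolding irreducible_closed_def closedin_zariski_algebraic by blast
      show "Y \<subseteq> W" using \<Y>(3) that by blast
    qed
    have "\<forall>Y\<in>{Y\<in>\<Y>. p \<notin> Y}. \<exists>g. g \<in> vanishing Y \<and> ev p g \<noteq> 0"
      using algebraic_separate Y(1) X(3) aff by blast
    from bchoice[OF this] obtain gs where
      gs: "\<And>Y. Y \<in> \<Y> \<Longrightarrow> p \<notin> Y \<Longrightarrow> gs Y \<in> vanishing Y \<and> ev p (gs Y) \<noteq> 0" by blast
    \<comment> \<open>Non-zero at p and zero on all components of W that miss p: inverting g removes
      these components.\<close>
    define g where "g = (\<Prod>Y\<in>{Y\<in>\<Y>. p \<notin> Y}. gs Y)"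
    have gp: "ev p g \<noteq> 0" unfolding g_def ev_prod using gs \<Y>(1) by (auto simp: prod_zero_iff)
    have gY: "ev x g = 0" if "Y \<in> \<Y>" "p \<notin> Y" "x \<in> Y" for x Y
      unfolding g_def ev_prod using gs[OF that(1,2)] that \<Y>(1)
      by (auto simp: prod_zero_iff vanishing_def)
    have gX: "g \<notin> vanishing X" using gp X(3) unfolding vanishing_def by blast
    let ?X = "loc n g X" and ?p = "loc_point n g p" and ?r = "restrict_vars {..<n} :: 'a mpoly \<Rightarrow> 'a mpoly"
    have r: "ev (loc_point n g x) (?r q) = ev x q" if "x \<in> X" for x q
      using ev_restrict_loc_point that aff by blast
    have X': "algebraic_set (Suc n) ?X" "irr ?X" "?p \<in> ?X" "ev ?p (?r h) = 0"
      using algebraic_loc[OF X(1)] irr_loc[OF X(2) gX] X(3) gp r Hp[OF h(1)] by (auto simp: loc_def)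
    have h': "?r h \<notin> vanishing ?X"
    proof
      assume "?r h \<in> vanishing ?X"
      then have "ev x (h * g) = 0" if "x \<in> X" for x
        using r[OF that, of h] that unfolding vanishing_def loc_def by (cases "ev x g = 0") auto
      then have "h * g \<in> vanishing X" unfolding vanishing_def by blast
      then show False using irrD[OF X(2)] gX h(2) by blast
    qed
    obtain J' y where y: "finite J'" "card J \<le> Suc (card J')" "alg_indep {x \<in> ?X. ev x (?r h) = 0} J' y"
      using hypersurface_section[OF X' h' alg_indep_loc[OF X(2) aff gX f(1)] f(2)] by blast
    have cover: "\<exists>Y\<in>\<Y>. p \<in> Y \<and> x \<in> loc n g Y" if "x \<in> ?X" "ev x (?r h) = 0" for x
    proof -
      obtain x0 where x0: "x0 \<in> X" "ev x0 g \<noteq> 0" "x = loc_point n g x0" using \<open>x \<in> ?X\<close> unfolding loc_def by blast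
      then have "x0 \<in> W" using that(2) r unfolding W_def by simp
      then obtain Y where "Y \<in> \<Y>" "x0 \<in> Y" using \<Y>(3) by blast
      moreover from this have "p \<in> Y" using gY x0(2) by blast
      ultimately show ?thesis using x0 unfolding loc_def by blast
    qed
    have "\<exists>Y\<in>\<Y>. p \<in> Y \<and> alg_indep (loc n g Y) J' y"
    proof (rule ccontr)
      assume "\<not> ?thesis"
      then have "\<forall>Y\<in>{Y\<in>\<Y>. p \<in> Y}. \<exists>Q. Q \<in> polys_in J' \<and> Q \<noteq> 0 \<and> (\<forall>x\<in>loc n g Y. ev (\<lambda>j. ev x (y j)) Q = 0)"
        unfolding alg_indep_def by blast
      from bchoice[OF this] obtain Q where Q: "\<And>Y. Y \<in> \<Y> \<Longrightarrow> p \<in> Y \<Longrightarrow> Q Y \<in> polys_in J' \<and> Q Y \<noteq> 0"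
        "\<And>Y x. Y \<in> \<Y> \<Longrightarrow> p \<in> Y \<Longrightarrow> x \<in> loc n g Y \<Longrightarrow> ev (\<lambda>j. ev x (y j)) (Q Y) = 0" by blast
      \<comment> \<open>If every component through p had a relation, their product would be a
        relation on the whole localised section.\<close>
      define P where "P = (\<Prod>Y\<in>{Y\<in>\<Y>. p \<in> Y}. Q Y)"
      have "P \<in> polys_in J'" unfolding P_def using Q by (intro polys_in_prod) auto
      moreover have "P \<noteq> 0" unfolding P_def using Q \<Y>(1) by (auto simp: prod_zero_iff)
      moreover have "ev (\<lambda>j. ev x (y j)) P = 0" if "x \<in> ?X" "ev x (?r h) = 0" for x
        unfolding P_def ev_prod using cover[OF that] Q(2) \<Y>(1) by (auto simp: prod_zero_iff)
      ultimately show False using y(3) unfolding alg_indep_def by blast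
    qed
    then obtain Y0 where Y0: "Y0 \<in> \<Y>" "p \<in> Y0" "alg_indep (loc n g Y0) J' y" by blast
    have gY0: "g \<notin> vanishing Y0" using gp Y0(2) unfolding vanishing_def by blast
    let ?H = "?r ` (H - {h})"
    have "card ?H \<le> card (H - {h})" using H(1) by (intro card_image_le) auto
    also have "\<dots> \<le> k" using H h(1) by simp
    finally have cH: "card ?H \<le> k" .
    have iso: "{x \<in> loc n g Y0. \<forall>h\<in>?H. ev x h = 0} = {?p}"
    proof (intro equalityI subsetI)
      fix x assume x: "x \<in> {x \<in> loc n g Y0. \<forall>h\<in>?H. ev x h = 0}"
      then obtain x0 where x0: "x0 \<in> Y0" "x = loc_point n g x0" unfolding loc_def by blast
      then have "x0 \<in> X" "ev x0 h = 0" using Y(3)[OF Y0(1)] unfolding W_def by auto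
      moreover have "ev x0 h' = 0" if "h' \<in> H - {h}" for h'
        using x that r[OF \<open>x0 \<in> X\<close>] x0(2) by auto
      ultimately have "x0 \<in> {x \<in> X. \<forall>h\<in>H. ev x h = 0}" by blast
      then show "x \<in> {?p}" using H(3) x0(2) by simp
    next
      fix x assume "x \<in> {?p}"
      then show "x \<in> {x \<in> loc n g Y0. \<forall>h\<in>?H. ev x h = 0}"
        using Y0(2) gp Hp r[OF X(3)] unfolding loc_def by auto
    qed
    have "?p \<in> loc n g Y0" using Y0(2) gp unfolding loc_def by blast
    from Suc.IH[OF algebraic_loc[OF Y(1)[OF Y0(1)]] irr_loc[OF Y(2)[OF Y0(1)] gY0] this _ cH iso Y0(3) y(1)]
    have "card J' \<le> k" using H(1) by simp
    then show ?thesis using y(2) by simp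
  qed
qed

section \<open>Irreducible components\<close>

text \<open>Irreducibility of arbitrary subsets. The notions \<open>irreducible_closed\<close> and
  \<open>irreducible_locally_closed\<close> are this property together with being closed or locally
  closed.\<close>

definition irreducible_set :: "'p topology \<Rightarrow> 'p set \<Rightarrow> bool" where
  "irreducible_set T S \<longleftrightarrow> S \<noteq> {} \<and> S \<subseteq> topspace T \<and>
     (\<forall>A B. closedin T A \<longrightarrow> closedin T B \<longrightarrow> S \<subseteq> A \<union> B \<longrightarrow> S \<subseteq> A \<or> S \<subseteq> B)"

lemma irreducible_setD:
  "irreducible_set T S \<Longrightarrow> closedin T A \<Longrightarrow> closedin T B \<Longrightarrow> S \<subseteq> A \<union> B \<Longrightarrow> S \<subseteq> A \<or> S \<subseteq> B"
  unfolding irreducible_set_def by blast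

lemma irreducible_closed_iff: "irreducible_closed T V \<longleftrightarrow> closedin T V \<and> irreducible_set T V"
proof
  assume V: "irreducible_closed T V"
  then have cl: "closedin T V" unfolding irreducible_closed_def by blast
  have "V \<subseteq> A \<or> V \<subseteq> B" if "closedin T A" "closedin T B" "V \<subseteq> A \<union> B" for A B
  proof -
    have "closedin T (V \<inter> A)" "closedin T (V \<inter> B)" using cl that by (auto intro: closedin_Int)
    moreover have "V = (V \<inter> A) \<union> (V \<inter> B)" using that(3) by blast
    ultimately have "V = V \<inter> A \<or> V = V \<inter> B" using V unfolding irreducible_closed_def by blast
    then show ?thesis by blast
  qed
  then show "closedin T V \<and> irreducible_set T V"
    using V cl closedin_subset[OF cl] unfolding irreducible_closed_def irreducible_set_def by blast
next
  assume V: "closedin T V \<and> irreducible_set T V"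
  have "V = A \<or> V = B" if "closedin T A" "closedin T B" "V = A \<union> B" for A B
    using irreducible_setD[of T V A B] V that by blast
  then show "irreducible_closed T V" using V unfolding irreducible_closed_def irreducible_set_def by blast
qed

text \<open>This form mentions closed sets only, which are what closed embeddings transport.\<close>

lemma locally_closed_iff: "locally_closed T S \<longleftrightarrow> (\<exists>C D. closedin T C \<and> closedin T D \<and> S = C - D)"
proof
  assume "locally_closed T S"
  then obtain U V where UV: "openin T U" "closedin T V" "S = U \<inter> V" unfolding locally_closed_def by blast
  then have "S = V - (topspace T - U)" using openin_subset[OF UV(1)] closedin_subset[OF UV(2)] by blast
  then show "\<exists>C D. closedin T C \<and> closedin T D \<and> S = C - D" using UV by blast
next
  assume "\<exists>C D. closedin T C \<and> closedin T D \<and> S = C - D"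
  then obtain C D where CD: "closedin T C" "closedin T D" "S = C - D" by blast
  then have "S = (topspace T - D) \<inter> C" using closedin_subset[OF CD(1)] by blast
  then show "locally_closed T S" using CD unfolding locally_closed_def by blast
qed

text \<open>A cover of a non-empty open part of V by closed sets becomes a cover of V by adding the
  complement of the open set, and V does not lie in this complement. Conversely, the irreducible
  closed set is the closure of S.\<close>

lemma irreducible_locally_closed_iff:
  "irreducible_locally_closed T S \<longleftrightarrow> locally_closed T S \<and> irreducible_set T S"
proof
  assume "irreducible_locally_closed T S"
  then obtain V where V: "S \<noteq> {}" "irreducible_closed T V" "openin (subtopology T V) S"
    unfolding irreducible_locally_closed_def by blast
  then obtain U where U: "openin T U" "S = U \<inter> V" unfolding openin_subtopology by blast
  have Vc: "closedin T V" "irreducible_set T V" using V(2) irreducible_closed_iff by blast+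
  have "S \<subseteq> A \<or> S \<subseteq> B" if AB: "closedin T A" "closedin T B" "S \<subseteq> A \<union> B" for A B
  proof -
    let ?D = "topspace T - U"
    have "V \<subseteq> (A \<union> B) \<union> ?D" using U AB(3) closedin_subset[OF Vc(1)] by blast
    moreover have "closedin T (A \<union> B)" "closedin T ?D" using AB U(1) by auto
    ultimately have "V \<subseteq> A \<union> B \<or> V \<subseteq> ?D" using irreducible_setD[OF Vc(2)] by blast
    then have "V \<subseteq> A \<union> B" using V(1) U(2) by blast
    then show ?thesis using irreducible_setD[OF Vc(2) AB(1,2)] U(2) by blast
  qed
  then show "locally_closed T S \<and> irreducible_set T S"
    using U Vc V(1) closedin_subset[OF Vc(1)] unfolding locally_closed_def irreducible_set_def by blast
next
  assume S: "locally_closed T S \<and> irreducible_set T S"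
  then obtain U C where UC: "openin T U" "closedin T C" "S = U \<inter> C" unfolding locally_closed_def by blast
  let ?V = "T closure_of S"
  have sub: "S \<subseteq> topspace T" "S \<noteq> {}" using S unfolding irreducible_set_def by blast+
  have SV: "S \<subseteq> ?V" using closure_of_subset[OF sub(1)] .
  have "?V \<subseteq> C" using UC by (intro closure_of_minimal) auto
  then have eq: "S = U \<inter> ?V" using SV UC(3) by blast
  have "?V \<subseteq> A \<or> ?V \<subseteq> B" if "closedin T A" "closedin T B" "?V \<subseteq> A \<union> B" for A B
  proof -
    have "S \<subseteq> A \<or> S \<subseteq> B" using irreducible_setD[of T S A B] S that SV by blast
    then show ?thesis using closure_of_minimal that(1,2) by metis
  qed
  then have "irreducible_closed T ?V"
    using SV sub unfolding irreducible_closed_iff irreducible_set_def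
    by (auto simp: closure_of_subset_topspace)
  moreover have "openin (subtopology T ?V) S" using UC(1) eq unfolding openin_subtopology by blast
  ultimately show "irreducible_locally_closed T S" using sub(2) unfolding irreducible_locally_closed_def by blast
qed

lemma irreducible_set_Union:
  assumes "finite F" "irreducible_set T S" "\<And>Y. Y \<in> F \<Longrightarrow> closedin T Y" "S \<subseteq> \<Union>F"
  shows "\<exists>Y\<in>F. S \<subseteq> Y"
  using assms
proof (induction F rule: finite_induct)
  case empty
  then show ?case unfolding irreducible_set_def by auto
next
  case (insert Y F)
  have "S \<subseteq> Y \<or> S \<subseteq> \<Union>F"
    using insert by (intro irreducible_setD[of T] closedin_Union) auto
  then show ?case using insert by auto
qed

text \<open>The hypotheses say that both sets are closed in their union. An irreducible subset then
  lies in one of them, and a maximal one remains maximal in the smaller set.\<close>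

lemma irreducible_components_union:
  assumes "closedin T T1" "closedin T T2" "W1 = (W1 \<union> W2) \<inter> T1" "W2 = (W1 \<union> W2) \<inter> T2"
  shows "irreducible_components T (W1 \<union> W2) \<subseteq> irreducible_components T W1 \<union> irreducible_components T W2"
proof
  fix Z assume Z: "Z \<in> irreducible_components T (W1 \<union> W2)"
  then have Zs: "Z \<subseteq> W1 \<union> W2" "irreducible_set T Z"
    unfolding irreducible_components_def irreducible_locally_closed_iff by blast+
  then have "Z \<subseteq> T1 \<union> T2" using assms(3,4) by blast
  then have "Z \<subseteq> T1 \<or> Z \<subseteq> T2" using irreducible_setD[OF Zs(2) assms(1,2)] by blast
  then have "Z \<subseteq> W1 \<or> Z \<subseteq> W2" using Zs(1) assms(3,4) by blast
  then show "Z \<in> irreducible_components T W1 \<union> irreducible_components T W2"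
    using Z unfolding irreducible_components_def by blast
qed

text \<open>Without finiteness the sum in \<open>deg\<close> would take the default value 0. Every
  component is the trace on U of one of the finitely many irreducible closed sets that make up
  C.\<close>

lemma finite_irreducible_components:
  assumes "noetherian_top T" "locally_closed T W"
  shows "finite (irreducible_components T W)"
proof -
  obtain U C where UC: "openin T U" "closedin T C" "W = U \<inter> C" using assms(2) unfolding locally_closed_def by blast
  obtain F where F: "finite F" "\<And>Y. Y \<in> F \<Longrightarrow> irreducible_closed T Y" "C = \<Union>F"
    using closed_decomposition[OF assms(1) UC(2)] by blast
  have "irreducible_components T W \<subseteq> (\<lambda>Y. U \<inter> Y) ` F"
  proof
    fix Z assume Z: "Z \<in> irreducible_components T W"
    have Z1: "irreducible_locally_closed T Z" "Z \<subseteq> W"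
      and max: "\<And>Z'. irreducible_locally_closed T Z' \<Longrightarrow> Z \<subseteq> Z' \<Longrightarrow> Z' \<subseteq> W \<Longrightarrow> Z' = Z"
      using Z unfolding irreducible_components_def by blast+
    have "irreducible_set T Z" using Z1(1) unfolding irreducible_locally_closed_iff by blast
    moreover have "Z \<noteq> {}" using calculation unfolding irreducible_set_def by blast
    ultimately have Zs: "irreducible_locally_closed T Z" "irreducible_set T Z" "Z \<subseteq> W" "Z \<noteq> {}"
      using Z1 by auto
    have "closedin T Y" if "Y \<in> F" for Y using F(2)[OF that] unfolding irreducible_closed_def by blast
    moreover have "Z \<subseteq> \<Union>F" using Zs(3) UC(3) F(3) by blast
    ultimately obtain Y where Y: "Y \<in> F" "Z \<subseteq> Y"
      using irreducible_set_Union[OF F(1) Zs(2)] by blast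
    have "openin (subtopology T Y) (U \<inter> Y)" using UC(1) unfolding openin_subtopology by blast
    moreover have "Z \<subseteq> U \<inter> Y" using Y Zs(3) UC(3) by blast
    ultimately have "irreducible_locally_closed T (U \<inter> Y)"
      using Zs(4) F(2)[OF Y(1)] unfolding irreducible_locally_closed_def by blast
    then have "U \<inter> Y = Z" using max[of "U \<inter> Y"] \<open>Z \<subseteq> U \<inter> Y\<close> Y(1) F(3) UC(3) by blast
    then show "Z \<in> (\<lambda>Y. U \<inter> Y) ` F" using Y(1) by blast
  qed
  then show ?thesis using F(1) by (meson finite_imageI finite_subset)
qed

section \<open>Degrees of unions and of closures\<close>

lemma deg_union_le:
  assumes "locally_closed (zariski n) W1" "locally_closed (zariski n) W2"
    and sub: "irreducible_components (zariski n) (W1 \<union> W2) \<subseteq>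
      irreducible_components (zariski n) W1 \<union> irreducible_components (zariski n) W2"
  shows "deg n (W1 \<union> W2) \<le> deg n W1 + deg n W2"
proof -
  let ?c = "irreducible_components (zariski n)" and ?d = "deg_irreducible n"
  have fin: "finite (?c W1)" "finite (?c W2)"
    using finite_irreducible_components[OF noetherian_zariski] assms(1,2) by blast+
  have "deg n (W1 \<union> W2) \<le> (\<Sum>V\<in>?c W1 \<union> ?c W2. ?d V)"
    unfolding deg_def using fin sub by (intro sum_mono2) auto
  also have "\<dots> \<le> deg n W1 + deg n W2"
    unfolding deg_def using sum.union_inter[OF fin, of ?d] by simp
  finally show ?thesis .
qed

lemma closedin_imp_locally_closed: "closedin T W \<Longrightarrow> locally_closed T W"
  unfolding locally_closed_def using closedin_subset by (metis inf.absorb_iff2 openin_topspace)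

lemma deg_z_Un_le: "deg_z n (C \<union> C') \<le> deg_z n C + deg_z n C'"
proof -
  let ?V = "zariski n closure_of C" and ?W = "zariski n closure_of C'"
  have "irreducible_components (zariski n) (?V \<union> ?W) \<subseteq>
      irreducible_components (zariski n) ?V \<union> irreducible_components (zariski n) ?W"
    by (rule irreducible_components_union[of _ ?V ?W]) auto
  then show ?thesis
    unfolding deg_z_def closure_of_Un by (intro deg_union_le closedin_imp_locally_closed) auto
qed

section \<open>Decompositions into irreducible locally closed sets\<close>

lemma largest_open_mono: "C \<subseteq> D \<Longrightarrow> largest_open n V C \<subseteq> largest_open n V D"
  unfolding largest_open_def by blast

text \<open>Gives the minimum in \<open>deg_lci\<close> its meaning. Each locally closed piece is
  split along an irreducible decomposition of its closed part, dropping the varieties that miss the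
  open part; passing to the largest open set stays inside C.\<close>

lemma lci_decomposition_exists:
  fixes C :: "(nat \<Rightarrow> 'a::field) set"
  assumes "constructible (zariski n) C"
  shows "\<exists>\<V>. lci_decomposition n C \<V>"
proof -
  obtain F where F: "finite F" "\<And>S. S \<in> F \<Longrightarrow> locally_closed (zariski n) S" "C = \<Union>F"
    using assms unfolding constructible_def by blast
  have "\<exists>U G. openin (zariski n) U \<and> finite G \<and> (\<forall>Y\<in>G. irreducible_closed (zariski n) Y) \<and> S = U \<inter> \<Union>G"
    if SF: "S \<in> F" for S
  proof -
    obtain U V where "openin (zariski n) U" "closedin (zariski n) V" "S = U \<inter> V"
      using F(2)[OF SF] unfolding locally_closed_def by blast
    then show ?thesis using closed_decomposition[OF noetherian_zariski, of n V] by blast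
  qed
  then have "\<exists>UG. openin (zariski n) (fst UG) \<and> finite (snd UG) \<and>
      (\<forall>Y\<in>snd UG. irreducible_closed (zariski n) Y) \<and> S = fst UG \<inter> \<Union>(snd UG)" if "S \<in> F" for S
    using that by fastforce
  note ex = this
  define UG where "UG S = (SOME UG. openin (zariski n) (fst UG) \<and> finite (snd UG) \<and>
      (\<forall>Y\<in>snd UG. irreducible_closed (zariski n) Y) \<and> S = fst UG \<inter> \<Union>(snd UG))" for S :: "(nat \<Rightarrow> 'a) set"
  have UG: "openin (zariski n) (fst (UG S)) \<and> finite (snd (UG S)) \<and>
      (\<forall>Y\<in>snd (UG S). irreducible_closed (zariski n) Y) \<and> S = fst (UG S) \<inter> \<Union>(snd (UG S))" if "S \<in> F" for S
    unfolding UG_def by (rule someI_ex[OF ex[OF that]])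
  define \<V> where "\<V> = (\<Union>S\<in>F. {Y\<in>snd (UG S). fst (UG S) \<inter> Y \<noteq> {}})"
  have sub: "fst (UG S) \<subseteq> largest_open n Y C" if "S \<in> F" "Y \<in> snd (UG S)" for S Y
  proof (rule largest_open(3))
    show "openin (zariski n) (fst (UG S))" using UG[OF that(1)] by blast
    show "fst (UG S) \<inter> Y \<subseteq> C" using UG[OF that(1)] that F(3) by blast
  qed
  have "lci_decomposition n C \<V>"
    unfolding lci_decomposition_def
  proof (intro conjI ballI)
    show "finite \<V>" unfolding \<V>_def using F(1) UG by auto
    fix V assume "V \<in> \<V>"
    then obtain S where S: "S \<in> F" "V \<in> snd (UG S)" "fst (UG S) \<inter> V \<noteq> {}" unfolding \<V>_def by blast
    then show "irreducible_closed (zariski n) V" "largest_open n V C \<inter> V \<noteq> {}"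
      using UG[OF S(1)] sub[OF S(1,2)] by blast+
  next
    have "C \<subseteq> (\<Union>V\<in>\<V>. largest_open n V C \<inter> V)"
    proof
      fix x assume "x \<in> C"
      then obtain S where S: "S \<in> F" "x \<in> S" using F(3) by blast
      then obtain Y where "Y \<in> snd (UG S)" "x \<in> Y" "x \<in> fst (UG S)" using UG[OF S(1)] by blast
      then show "x \<in> (\<Union>V\<in>\<V>. largest_open n V C \<inter> V)" using S(1) sub[OF S(1)] unfolding \<V>_def by blast
    qed
    then show "C = (\<Union>V\<in>\<V>. largest_open n V C \<inter> V)" using largest_open(2) by blast
  qed
  then show ?thesis by blast
qed

lemma deg_lci_attained:
  assumes "constructible (zariski n) C"
  shows "\<exists>\<V>. lci_decomposition n C \<V> \<and> deg_lci n C = (\<Sum>V\<in>\<V>. deg n V)"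
  unfolding deg_lci_def by (rule LeastI_ex) (use lci_decomposition_exists[OF assms] in blast)

text \<open>The two families are united. The largest open sets grow with the constructible set, so
  pieces stay non-empty and still cover, and a variety that occurs in both families is counted
  once.\<close>

lemma deg_lci_Un_le:
  assumes "constructible (zariski n) C" "constructible (zariski n) C'"
  shows "deg_lci n (C \<union> C') \<le> deg_lci n C + deg_lci n C'"
proof -
  obtain \<V> where V: "lci_decomposition n C \<V>" "deg_lci n C = (\<Sum>V\<in>\<V>. deg n V)"
    using deg_lci_attained[OF assms(1)] by blast
  obtain \<W> where W: "lci_decomposition n C' \<W>" "deg_lci n C' = (\<Sum>V\<in>\<W>. deg n V)"
    using deg_lci_attained[OF assms(2)] by blast
  have fin: "finite \<V>" "finite \<W>" using V W unfolding lci_decomposition_def by blast+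
  let ?L = "\<lambda>V. largest_open n V (C \<union> C')"
  have L: "largest_open n V C \<subseteq> ?L V" "largest_open n V C' \<subseteq> ?L V" "?L V \<inter> V \<subseteq> C \<union> C'" for V
    using largest_open_mono[of C "C \<union> C'"] largest_open_mono[of C' "C \<union> C'"] largest_open(2)[of n V "C \<union> C'"]
    by blast+
  have CV: "C = (\<Union>V\<in>\<V>. largest_open n V C \<inter> V)" and CW: "C' = (\<Union>V\<in>\<W>. largest_open n V C' \<inter> V)"
    using V(1) W(1) unfolding lci_decomposition_def by blast+
  have "lci_decomposition n (C \<union> C') (\<V> \<union> \<W>)"
    unfolding lci_decomposition_def
  proof (intro conjI ballI)
    show "finite (\<V> \<union> \<W>)" using fin by blast
    fix V assume "V \<in> \<V> \<union> \<W>"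
    then have "irreducible_closed (zariski n) V \<and> (largest_open n V C \<inter> V \<noteq> {} \<or> largest_open n V C' \<inter> V \<noteq> {})"
      using V(1) W(1) unfolding lci_decomposition_def by (elim UnE) simp_all
    then show "irreducible_closed (zariski n) V" "?L V \<inter> V \<noteq> {}" using L(1,2)[of V] by auto
  next
    have "(\<Union>V\<in>\<V>. largest_open n V C \<inter> V) \<subseteq> (\<Union>V\<in>\<V>. ?L V \<inter> V)"
      "(\<Union>V\<in>\<W>. largest_open n V C' \<inter> V) \<subseteq> (\<Union>V\<in>\<W>. ?L V \<inter> V)"
      using L(1,2) by (intro UN_mono Int_mono order_refl; blast)+
    then have "C \<subseteq> (\<Union>V\<in>\<V>. ?L V \<inter> V)" "C' \<subseteq> (\<Union>V\<in>\<W>. ?L V \<inter> V)"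
      using CV CW by argo+
    moreover have "(\<Union>V\<in>\<V> \<union> \<W>. ?L V \<inter> V) \<subseteq> C \<union> C'" by (rule UN_least) (rule L(3))
    ultimately show "C \<union> C' = (\<Union>V\<in>\<V> \<union> \<W>. ?L V \<inter> V)" unfolding UN_Un by (intro equalityI) auto
  qed
  then have "deg_lci n (C \<union> C') \<le> (\<Sum>V\<in>\<V> \<union> \<W>. deg n V)"
    unfolding deg_lci_def by (intro Least_le) blast
  also have "\<dots> \<le> (\<Sum>V\<in>\<V>. deg n V) + (\<Sum>V\<in>\<W>. deg n V)"
    using sum.union_inter[OF fin, of "deg n"] by simp
  finally show ?thesis using V W by simp
qed

section \<open>Closed embeddings\<close>

text \<open>A homeomorphism onto a closed subspace, phrased by closed sets.\<close>

definition closed_emb :: "'p topology \<Rightarrow> 'q topology \<Rightarrow> ('p \<Rightarrow> 'q) \<Rightarrow> bool" where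
  "closed_emb X Y f \<longleftrightarrow> inj_on f (topspace X) \<and> (\<forall>V. closedin X V \<longrightarrow> closedin Y (f ` V)) \<and>
     (\<forall>T. closedin Y T \<longrightarrow> closedin X {x \<in> topspace X. f x \<in> T})"

lemma closed_embD:
  assumes "closed_emb X Y f"
  shows "inj_on f (topspace X)" "closedin X V \<Longrightarrow> closedin Y (f ` V)"
    "closedin Y T \<Longrightarrow> closedin X {x \<in> topspace X. f x \<in> T}"
  using assms unfolding closed_emb_def by blast+

lemma closed_emb_topspace: "closed_emb X Y f \<Longrightarrow> f ` topspace X \<subseteq> topspace Y"
  using closed_embD(2)[of X Y f "topspace X"] closedin_subset by blast

lemma closed_emb_preimage:
  assumes "closed_emb X Y f" "S \<subseteq> topspace X"
  shows "{x \<in> topspace X. f x \<in> f ` S} = S"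
  using closed_embD(1)[OF assms(1)] assms(2) unfolding inj_on_def by blast

lemma closed_emb_closedin_iff:
  assumes "closed_emb X Y f" "S \<subseteq> topspace X"
  shows "closedin Y (f ` S) \<longleftrightarrow> closedin X S"
  using closed_embD(2,3)[OF assms(1)] closed_emb_preimage[OF assms] by metis

lemma image_subset_image_iff: "inj_on f A \<Longrightarrow> B \<subseteq> A \<Longrightarrow> C \<subseteq> A \<Longrightarrow> f ` B \<subseteq> f ` C \<longleftrightarrow> B \<subseteq> C"
  unfolding inj_on_def by blast

lemma closed_emb_irreducible_set:
  assumes f: "closed_emb X Y f" and S: "S \<subseteq> topspace X"
  shows "irreducible_set Y (f ` S) \<longleftrightarrow> irreducible_set X S"
proof
  assume I: "irreducible_set Y (f ` S)"
  have "S \<subseteq> A \<or> S \<subseteq> B" if AB: "closedin X A" "closedin X B" "S \<subseteq> A \<union> B" for A B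
  proof -
    have "f ` S \<subseteq> f ` A \<or> f ` S \<subseteq> f ` B"
      using irreducible_setD[OF I closed_embD(2)[OF f AB(1)] closed_embD(2)[OF f AB(2)]] AB(3) by blast
    then show ?thesis
      using image_subset_image_iff[OF closed_embD(1)[OF f] S] closedin_subset[OF AB(1)] closedin_subset[OF AB(2)]
      by blast
  qed
  then show "irreducible_set X S" using I S unfolding irreducible_set_def by blast
next
  assume I: "irreducible_set X S"
  have "f ` S \<subseteq> A \<or> f ` S \<subseteq> B" if AB: "closedin Y A" "closedin Y B" "f ` S \<subseteq> A \<union> B" for A B
  proof -
    have "S \<subseteq> {x \<in> topspace X. f x \<in> A} \<union> {x \<in> topspace X. f x \<in> B}" using AB(3) S by blast
    from irreducible_setD[OF I closed_embD(3)[OF f AB(1)] closed_embD(3)[OF f AB(2)] this]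
    show ?thesis by blast
  qed
  then show "irreducible_set Y (f ` S)"
    using I closed_emb_topspace[OF f] unfolding irreducible_set_def by blast
qed

lemma closed_emb_locally_closed:
  assumes f: "closed_emb X Y f" and S: "S \<subseteq> topspace X"
  shows "locally_closed Y (f ` S) \<longleftrightarrow> locally_closed X S"
proof
  assume "locally_closed Y (f ` S)"
  then obtain C D where CD: "closedin Y C" "closedin Y D" "f ` S = C - D" unfolding locally_closed_iff by blast
  have "S = {x \<in> topspace X. f x \<in> C} - {x \<in> topspace X. f x \<in> D}"
    using closed_emb_preimage[OF f S] unfolding CD(3) by blast
  then show "locally_closed X S"
    unfolding locally_closed_iff
    by (intro exI conjI) (assumption | rule closed_embD(3)[OF f CD(1)] closed_embD(3)[OF f CD(2)])+
next
  assume "locally_closed X S"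
  then obtain C D where CD: "closedin X C" "closedin X D" "S = C - D" unfolding locally_closed_iff by blast
  have "f ` S = f ` C - f ` D"
    unfolding CD(3) using closedin_subset CD(1,2)
    by (intro inj_on_image_set_diff[OF closed_embD(1)[OF f]]) auto
  then show "locally_closed Y (f ` S)"
    unfolding locally_closed_iff
    by (intro exI conjI) (assumption | rule closed_embD(2)[OF f CD(1)] closed_embD(2)[OF f CD(2)])+
qed

lemma closed_emb_irreducible_locally_closed:
  assumes "closed_emb X Y f" "S \<subseteq> topspace X"
  shows "irreducible_locally_closed Y (f ` S) \<longleftrightarrow> irreducible_locally_closed X S"
  unfolding irreducible_locally_closed_iff closed_emb_irreducible_set[OF assms] closed_emb_locally_closed[OF assms] ..

lemma closed_emb_irreducible_closed:
  assumes "closed_emb X Y f" "S \<subseteq> topspace X"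
  shows "irreducible_closed Y (f ` S) \<longleftrightarrow> irreducible_closed X S"
  unfolding irreducible_closed_iff closed_emb_irreducible_set[OF assms] closed_emb_closedin_iff[OF assms] ..

lemma irreducible_componentsD:
  assumes "Z \<in> irreducible_components X W"
  shows "irreducible_locally_closed X Z" "Z \<subseteq> W"
    "irreducible_locally_closed X Z' \<Longrightarrow> Z \<subseteq> Z' \<Longrightarrow> Z' \<subseteq> W \<Longrightarrow> Z' = Z"
  using assms unfolding irreducible_components_def by auto

lemma irreducible_componentsI:
  assumes "irreducible_locally_closed X Z" "Z \<subseteq> W"
    "\<And>Z'. irreducible_locally_closed X Z' \<Longrightarrow> Z \<subseteq> Z' \<Longrightarrow> Z' \<subseteq> W \<Longrightarrow> Z' = Z"
  shows "Z \<in> irreducible_components X W"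
  using assms unfolding irreducible_components_def by auto

lemma closed_emb_irreducible_components:
  assumes f: "closed_emb X Y f" and W: "W \<subseteq> topspace X"
  shows "irreducible_components Y (f ` W) = (`) f ` irreducible_components X W"
proof -
  have lift: "\<exists>Z0\<subseteq>W. Z = f ` Z0" if "Z \<subseteq> f ` W" for Z using that by (rule subset_imageE) blast
  have ilc: "irreducible_locally_closed Y (f ` S) \<longleftrightarrow> irreducible_locally_closed X S" if "S \<subseteq> W" for S
    using closed_emb_irreducible_locally_closed[OF f, of S] that W by auto
  have le: "f ` A \<subseteq> f ` B \<longleftrightarrow> A \<subseteq> B" if "A \<subseteq> W" "B \<subseteq> W" for A B
    using that W by (intro image_subset_image_iff[OF closed_embD(1)[OF f]]) auto
  have "f ` Z0 \<in> irreducible_components Y (f ` W) \<longleftrightarrow> Z0 \<in> irreducible_components X W" if Z0: "Z0 \<subseteq> W" for Z0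
  proof
    assume Z: "f ` Z0 \<in> irreducible_components Y (f ` W)"
    show "Z0 \<in> irreducible_components X W"
    proof (rule irreducible_componentsI)
      show "irreducible_locally_closed X Z0" using irreducible_componentsD(1)[OF Z] ilc[OF Z0] by simp
      fix Z' assume Z': "irreducible_locally_closed X Z'" "Z0 \<subseteq> Z'" "Z' \<subseteq> W"
      then have "f ` Z' = f ` Z0"
        using irreducible_componentsD(3)[OF Z, of "f ` Z'"] ilc[OF Z'(3)] by (simp add: image_mono)
      then show "Z' = Z0" using le[OF Z'(3) Z0] Z'(2) by auto
    qed (rule Z0)
  next
    assume Z: "Z0 \<in> irreducible_components X W"
    show "f ` Z0 \<in> irreducible_components Y (f ` W)"
    proof (rule irreducible_componentsI)
      show "irreducible_locally_closed Y (f ` Z0)" using irreducible_componentsD(1)[OF Z] ilc[OF Z0] by simp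
      show "f ` Z0 \<subseteq> f ` W" using Z0 by (rule image_mono)
      fix Z' assume Z': "irreducible_locally_closed Y Z'" "f ` Z0 \<subseteq> Z'" "Z' \<subseteq> f ` W"
      then obtain Z1 where Z1: "Z1 \<subseteq> W" "Z' = f ` Z1" using lift by metis
      then show "Z' = f ` Z0"
        using irreducible_componentsD(3)[OF Z, of Z1] ilc[OF Z1(1)] le[OF Z0 Z1(1)] Z' by simp
    qed
  qed
  note iff = this
  show ?thesis
  proof (intro equalityI subsetI)
    fix Z assume Z: "Z \<in> irreducible_components Y (f ` W)"
    obtain Z0 where "Z0 \<subseteq> W" "Z = f ` Z0" using lift[OF irreducible_componentsD(2)[OF Z]] by metis
    then show "Z \<in> (`) f ` irreducible_components X W" using iff Z by auto
  next
    fix Z assume "Z \<in> (`) f ` irreducible_components X W"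
    then obtain Z0 where "Z0 \<in> irreducible_components X W" "Z = f ` Z0" by (rule imageE)
    then show "Z \<in> irreducible_components Y (f ` W)" using iff irreducible_componentsD(2) by metis
  qed
qed

lemma closed_emb_subtopology:
  assumes f: "closed_emb X Y f" and V: "V \<subseteq> topspace X"
  shows "closed_emb (subtopology X V) (subtopology Y (f ` V)) f"
  unfolding closed_emb_def
proof (intro conjI allI impI)
  show "inj_on f (topspace (subtopology X V))"
    using closed_embD(1)[OF f] by (auto intro: inj_on_subset)
  fix S assume "closedin (subtopology X V) S"
  then obtain T where T: "closedin X T" "S = T \<inter> V" unfolding closedin_subtopology by blast
  have "f ` S = f ` T \<inter> f ` V"
    unfolding T(2) using closedin_subset[OF T(1)] V by (intro inj_on_image_Int[OF closed_embD(1)[OF f]])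
  then show "closedin (subtopology Y (f ` V)) (f ` S)"
    unfolding closedin_subtopology using closed_embD(2)[OF f T(1)] by blast
next
  fix S assume "closedin (subtopology Y (f ` V)) S"
  then obtain T where T: "closedin Y T" "S = T \<inter> f ` V" unfolding closedin_subtopology by blast
  have "{x \<in> topspace (subtopology X V). f x \<in> S} = {x \<in> topspace X. f x \<in> T} \<inter> V"
    unfolding T(2) using V by auto
  then show "closedin (subtopology X V) {x \<in> topspace (subtopology X V). f x \<in> S}"
    unfolding closedin_subtopology using closed_embD(3)[OF f T(1)] by blast
qed

lemma closed_emb_krull_dim:
  assumes f: "closed_emb X Y f" and onto: "f ` topspace X = topspace Y"
  shows "krull_dim Y = krull_dim X"
proof -
  note iff = closed_emb_irreducible_closed[OF f]
  have le: "f ` A \<subset> f ` B \<longleftrightarrow> A \<subset> B" if "A \<subseteq> topspace X" "B \<subseteq> topspace X" for A B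
    using image_subset_image_iff[OF closed_embD(1)[OF f]] that unfolding less_le_not_le by simp
  have top: "Z \<subseteq> topspace T" if "irreducible_closed T Z" for Z and T :: "'z topology"
    using that closedin_subset unfolding irreducible_closed_def by blast
  have "(\<exists>Z. (\<forall>i\<le>d. irreducible_closed Y (Z i)) \<and> (\<forall>i<d. Z i \<subset> Z (Suc i))) \<longleftrightarrow>
      (\<exists>Z. (\<forall>i\<le>d. irreducible_closed X (Z i)) \<and> (\<forall>i<d. Z i \<subset> Z (Suc i)))" for d
  proof
    assume "\<exists>Z. (\<forall>i\<le>d. irreducible_closed X (Z i)) \<and> (\<forall>i<d. Z i \<subset> Z (Suc i))"
    then obtain Z where Z: "\<And>i. i \<le> d \<Longrightarrow> irreducible_closed X (Z i)" "\<And>i. i < d \<Longrightarrow> Z i \<subset> Z (Suc i)" by blast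
    then have s: "Z i \<subseteq> topspace X" if "i \<le> d" for i using top that by blast
    have "irreducible_closed Y (f ` Z i)" if "i \<le> d" for i using iff[OF s[OF that]] Z(1)[OF that] by blast
    moreover have "f ` Z i \<subset> f ` Z (Suc i)" if "i < d" for i
      using le[of "Z i" "Z (Suc i)"] s[of i] s[of "Suc i"] Z(2)[OF that] that by simp
    ultimately show "\<exists>Z. (\<forall>i\<le>d. irreducible_closed Y (Z i)) \<and> (\<forall>i<d. Z i \<subset> Z (Suc i))"
      by (intro exI[of _ "\<lambda>i. f ` Z i"]) blast
  next
    assume "\<exists>Z. (\<forall>i\<le>d. irreducible_closed Y (Z i)) \<and> (\<forall>i<d. Z i \<subset> Z (Suc i))"
    then obtain Z where Z: "\<And>i. i \<le> d \<Longrightarrow> irreducible_closed Y (Z i)" "\<And>i. i < d \<Longrightarrow> Z i \<subset> Z (Suc i)" by blast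
    define Z0 where "Z0 i = {x \<in> topspace X. f x \<in> Z i}" for i
    have s: "Z0 i \<subseteq> topspace X" for i unfolding Z0_def by blast
    have im: "f ` Z0 i = Z i" if "i \<le> d" for i
    proof -
      have "Z i \<subseteq> f ` topspace X" using top[OF Z(1)[OF that]] onto by simp
      then show ?thesis unfolding Z0_def by auto
    qed
    have "irreducible_closed X (Z0 i)" if "i \<le> d" for i using iff[OF s, of i] Z(1)[OF that] im[OF that] by simp
    moreover have "Z0 i \<subset> Z0 (Suc i)" if "i < d" for i
      using le[OF s s, of i "Suc i"] Z(2)[OF that] im[of i] im[of "Suc i"] that by simp
    ultimately show "\<exists>Z. (\<forall>i\<le>d. irreducible_closed X (Z i)) \<and> (\<forall>i<d. Z i \<subset> Z (Suc i))" by blast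
  qed
  then show ?thesis unfolding krull_dim_def by simp
qed

section \<open>Affine linear sections\<close>

abbreviation scal :: "'a::field \<Rightarrow> (nat \<Rightarrow> 'a) \<Rightarrow> nat \<Rightarrow> 'a" where
  "scal c x \<equiv> (\<lambda>i. c * x i)"

definition unit_vec :: "nat \<Rightarrow> nat \<Rightarrow> 'a::field" where
  "unit_vec i = (\<lambda>j. if j = i then 1 else 0)"

lemma sum_fun_apply: "(\<Sum>i\<in>I. f i) (x :: nat) = (\<Sum>i\<in>I. f i x :: 'a::field)"
  by (induction I rule: infinite_finite_induct) auto

lemma affine_space_expand:
  assumes "x \<in> affine_space m"
  shows "x = (\<Sum>i<m. scal (x i) (unit_vec i))"
proof
  fix k
  have "(\<Sum>i<m. x i * unit_vec i k) = (\<Sum>i<m. if k = i then x i else 0)"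
    by (intro sum.cong) (auto simp: unit_vec_def)
  also have "\<dots> = x k" using assms by (auto simp: affine_space_def)
  finally show "x k = (\<Sum>i<m. scal (x i) (unit_vec i)) k" by (simp add: sum_fun_apply)
qed

lemma subspace_affine_space: "fun_vs.subspace (affine_space m)"
  by (intro fun_vs.subspaceI) (auto simp: affine_space_def)

lemma unit_vec_in: "i < m \<Longrightarrow> unit_vec i \<in> affine_space m"
  by (auto simp: unit_vec_def affine_space_def)

lemma affine_space_span: "affine_space m \<subseteq> fun_vs.span (unit_vec ` {..<m})"
proof
  fix x :: "nat \<Rightarrow> 'a" assume "x \<in> affine_space m"
  then have "x = (\<Sum>i<m. scal (x i) (unit_vec i))" by (rule affine_space_expand)
  also have "\<dots> \<in> fun_vs.span (unit_vec ` {..<m})"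
    by (intro fun_vs.span_sum fun_vs.span_scale fun_vs.span_base) auto
  finally show "x \<in> fun_vs.span (unit_vec ` {..<m})" .
qed

text \<open>The dimension counts between K^m and K^(m+1) all add a vector with non-zero coordinate m
  to a basis inside K^m.\<close>

lemma independent_insert_coord:
  assumes B: "\<not> fun_vs.dependent B" "\<And>b. b \<in> B \<Longrightarrow> b m = 0" and w: "w m \<noteq> (0 :: 'a::field)"
  shows "\<not> fun_vs.dependent (insert w B)" "w \<notin> B"
proof -
  have "fun_vs.subspace {x :: nat \<Rightarrow> 'a. x m = 0}" by (intro fun_vs.subspaceI) auto
  then have "fun_vs.span B \<subseteq> {x. x m = 0}" using B(2) by (intro fun_vs.span_minimal) auto
  then show "\<not> fun_vs.dependent (insert w B)" using fun_vs.independent_insertI B(1) w by blast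
  show "w \<notin> B" using B(2) w by blast
qed

lemma independent_unit_vecs:
  "\<not> fun_vs.dependent (unit_vec ` {..<m} :: (nat \<Rightarrow> 'a::field) set) \<and> card (unit_vec ` {..<m} :: (nat \<Rightarrow> 'a) set) = m"
proof (induction m)
  case (Suc m)
  have z: "b m = 0" if "b \<in> unit_vec ` {..<m}" for b :: "nat \<Rightarrow> 'a" using that by (auto simp: unit_vec_def)
  have u: "unit_vec m m \<noteq> (0 :: 'a)" by (simp add: unit_vec_def)
  have i: "\<not> fun_vs.dependent (insert (unit_vec m) (unit_vec ` {..<m} :: (nat \<Rightarrow> 'a) set))"
    "unit_vec m \<notin> (unit_vec ` {..<m} :: (nat \<Rightarrow> 'a) set)"
    using independent_insert_coord[of "unit_vec ` {..<m} :: (nat \<Rightarrow> 'a) set" m "unit_vec m"] Suc z u by blast+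
  have "unit_vec ` {..<Suc m} = insert (unit_vec m :: nat \<Rightarrow> 'a) (unit_vec ` {..<m})" by (auto simp: lessThan_Suc)
  then show ?case using i Suc by simp
qed (simp add: fun_vs.independent_empty)

lemma independent_in_affine_space:
  fixes B :: "(nat \<Rightarrow> 'a::field) set"
  assumes "\<not> fun_vs.dependent B" "B \<subseteq> affine_space m"
  shows "finite B" "card B \<le> m"
proof -
  have "finite B \<and> card B \<le> card (unit_vec ` {..<m} :: (nat \<Rightarrow> 'a) set)"
    using assms affine_space_span by (intro fun_vs.independent_span_bound) auto
  then show "finite B" "card B \<le> m"
    using independent_unit_vecs[where ?'a = 'a and m = m] by simp_all
qed

lemma subspace_basis:
  assumes "fun_vs.subspace W" "W \<subseteq> affine_space m"
  obtains B where "B \<subseteq> W" "\<not> fun_vs.dependent B" "fun_vs.span B = W" "finite B" "card B = fun_vs.dim W"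
proof -
  obtain B where B: "B \<subseteq> W" "\<not> fun_vs.dependent B" "W \<subseteq> fun_vs.span B" "card B = fun_vs.dim W"
    by (rule fun_vs.basis_exists)
  have "fun_vs.span B \<subseteq> W" using B(1) assms(1) by (rule fun_vs.span_minimal)
  then show ?thesis using that B independent_in_affine_space(1)[OF B(2)] assms(2) by (metis subset_antisym subset_trans)
qed

text \<open>A basis B of W is extended to a basis of K^m; the equations are the coordinate
  functionals of the added vectors. Compatibility with differences is the part of linearity that
  turns equations of W into equations of its cosets.\<close>

lemma subspace_equations:
  fixes W :: "(nat \<Rightarrow> 'a::field) set"
  assumes W: "fun_vs.subspace W" "W \<subseteq> affine_space m" and dim: "fun_vs.dim W + s = m"
  obtains L :: "'a mpoly set" where "finite L" "card L \<le> s"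
    "\<And>l x y. l \<in> L \<Longrightarrow> ev (x - y) l = ev x l - ev y l"
    "W = {x \<in> affine_space m. \<forall>l\<in>L. ev x l = 0}"
proof -
  obtain B where B: "B \<subseteq> W" "\<not> fun_vs.dependent B" "fun_vs.span B = W" "finite B" "card B = fun_vs.dim W"
    by (rule subspace_basis[OF W])
  obtain B' where B': "B \<subseteq> B'" "B' \<subseteq> affine_space m" "\<not> fun_vs.dependent B'" "affine_space m \<subseteq> fun_vs.span B'"
    using fun_vs.maximal_independent_subset_extend[of B "affine_space m"] B W by (metis subset_trans)
  have fB': "finite B'" "card B' \<le> m" using independent_in_affine_space[OF B'(3,2)] by auto
  define R where "R = fun_vs.representation B'"
  define l where "l v = (\<Sum>i<m. Const (R (unit_vec i) v) * Var i)" for v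
  have ev_l: "ev x (l v) = (\<Sum>i<m. R (unit_vec i) v * x i)" for x v by (simp add: l_def ev_sum)
  have l: "ev x (l v) = R x v" if x: "x \<in> affine_space m" for x v
  proof -
    have s: "unit_vec i \<in> fun_vs.span B'" if "i < m" for i using B'(4) unit_vec_in[OF that] by blast
    have "R x v = R (\<Sum>i<m. scal (x i) (unit_vec i)) v" using affine_space_expand[OF x] by simp
    also have "\<dots> = (\<Sum>i<m. R (scal (x i) (unit_vec i)) v)"
      unfolding R_def using s by (subst fun_vs.representation_sum[OF B'(3)]) (auto intro: fun_vs.span_scale)
    also have "\<dots> = (\<Sum>i<m. x i * R (unit_vec i) v)"
      unfolding R_def using s by (intro sum.cong) (auto simp: fun_vs.representation_scale[OF B'(3)])
    finally show ?thesis by (simp add: ev_l mult.commute)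
  qed
  have W_eq: "W = {x \<in> affine_space m. \<forall>l\<in>l ` (B' - B). ev x l = 0}"
  proof (intro equalityI subsetI)
    fix x assume x: "x \<in> W"
    have "R x = fun_vs.representation B x"
      unfolding R_def using x B(3) B'(1,3) by (intro fun_vs.representation_extend) auto
    then have "R x v = 0" if "v \<in> B' - B" for v
      using fun_vs.representation_ne_zero[of B x v] that by auto
    then show "x \<in> {x \<in> affine_space m. \<forall>l\<in>l ` (B' - B). ev x l = 0}" using x W(2) l by auto
  next
    fix x assume x: "x \<in> {x \<in> affine_space m. \<forall>l\<in>l ` (B' - B). ev x l = 0}"
    then have z: "R x v = 0" if "v \<in> B' - B" for v using l that by auto
    have "x = (\<Sum>b\<in>B'. scal (R x b) b)"
      unfolding R_def using x B'(3,4) fB'(1) by (intro fun_vs.sum_representation_eq[symmetric]) auto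
    also have "\<dots> = (\<Sum>b\<in>B. scal (R x b) b)"
      using z fB'(1) B'(1) by (intro sum.mono_neutral_right) (auto simp: fun_eq_iff)
    also have "\<dots> \<in> fun_vs.span B" by (intro fun_vs.span_sum fun_vs.span_scale fun_vs.span_base)
    finally show "x \<in> W" using B(3) by simp
  qed
  have "card (l ` (B' - B)) \<le> card (B' - B)" using fB' by (intro card_image_le) auto
  also have "\<dots> = card B' - card B" using B'(1) B(4) by (rule card_Diff_subset[rotated])
  also have "\<dots> \<le> s" using fB' B(5) dim by simp
  finally have c: "card (l ` (B' - B)) \<le> s" .
  have "ev (x - y) p = ev x p - ev y p" if "p \<in> l ` (B' - B)" for p x y
    using that by (auto simp: ev_l right_diff_distrib sum_subtractf)
  then show ?thesis using that[OF _ c _ W_eq] fB'(1) by simp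
qed

section \<open>Dimension bound from a finite linear section\<close>

lemma algebraic_set_finite:
  assumes "finite S" "S \<subseteq> affine_space m"
  shows "closedin (zariski m) S"
  using assms
proof (induction S rule: finite_induct)
  case (insert q S)
  have "{q} = {x \<in> affine_space m. \<forall>p\<in>vanishing {q}. ev x p = 0}"
  proof (intro equalityI subsetI)
    fix x assume x: "x \<in> {x \<in> affine_space m. \<forall>p\<in>vanishing {q}. ev x p = 0}"
    have "Var i - Const (q i) \<in> vanishing {q}" for i by (simp add: vanishing_def)
    then have "ev x (Var i - Const (q i)) = 0" for i using x by blast
    then show "x \<in> {q}" by (auto simp: fun_eq_iff)
  qed (use insert in \<open>auto simp: vanishing_def\<close>)
  then have "closedin (zariski m) {q}" unfolding closedin_zariski_algebraic algebraic_set_def .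
  then have "closedin (zariski m) ({q} \<union> S)" using insert by (intro closedin_Un) auto
  then show ?case by simp
qed simp

lemma vanishing_antimono: "X \<subseteq> Y \<Longrightarrow> vanishing Y \<subseteq> vanishing X"
  unfolding vanishing_def by blast

lemma irreducible_set_irr:
  assumes "irreducible_set (zariski m) V"
  shows "irr V"
  unfolding irr_def
proof (intro conjI allI impI)
  show "V \<noteq> {}" using assms unfolding irreducible_set_def by blast
  fix p q assume pq: "p * q \<in> vanishing V"
  have V: "V \<subseteq> affine_space m" using assms unfolding irreducible_set_def by simp
  then have "V \<subseteq> {x \<in> affine_space m. ev x p = 0} \<union> {x \<in> affine_space m. ev x q = 0}"
    using pq unfolding vanishing_def by auto
  then have "V \<subseteq> {x \<in> affine_space m. ev x p = 0} \<or> V \<subseteq> {x \<in> affine_space m. ev x q = 0}"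
    by (rule irreducible_setD[OF assms closedin_zariski_zero closedin_zariski_zero])
  then show "p \<in> vanishing V \<or> q \<in> vanishing V" unfolding vanishing_def by blast
qed

text \<open>On a suitable principal open subset of the closure Y of V, the section consists of v
  alone. A chain in V gives as many algebraically independent functions on Y as it has strict
  inclusions, and \<open>isolated_point_bound\<close> limits their number by the number of equations
  of W.\<close>

lemma krull_dim_le_codim:
  fixes V :: "(nat \<Rightarrow> 'a::alg_closed_field) set"
  assumes V: "irreducible_locally_closed (zariski m) V"
    and W: "fun_vs.subspace W" "W \<subseteq> affine_space m" "fun_vs.dim W + s = m"
    and v: "v \<in> V" "finite ((\<lambda>w. v + w) ` W \<inter> V)"
  shows "krull_dim (subtopology (zariski m) V) \<le> s"
proof -
  have lc: "locally_closed (zariski m) V" and ir: "irreducible_set (zariski m) V"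
    using V irreducible_locally_closed_iff by blast+
  obtain X D where XD: "closedin (zariski m) X" "closedin (zariski m) D" "V = X - D"
    using lc unfolding locally_closed_iff by blast
  \<comment> \<open>The Zariski closure of V, described by \<open>vanishing V\<close> so that both
    sets have the same vanishing ideal.\<close>
  define Y where "Y = {x \<in> affine_space m. \<forall>p\<in>vanishing V. ev x p = 0}"
  have Vm: "V \<subseteq> affine_space m" using ir unfolding irreducible_set_def by simp
  have VY: "V \<subseteq> Y" using Vm unfolding Y_def vanishing_def by auto
  have vY: "vanishing Y = vanishing V"
    using vanishing_antimono[OF VY] unfolding Y_def by (auto simp: vanishing_def)
  have Y: "algebraic_set m Y" unfolding algebraic_set_def vY by (simp add: Y_def)
  have YX: "Y \<subseteq> X"
  proof -
    have "algebraic_set m X" using XD(1) closedin_zariski_algebraic by blast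
    moreover have "vanishing X \<subseteq> vanishing V" using XD(3) by (intro vanishing_antimono) auto
    ultimately show ?thesis unfolding algebraic_set_def Y_def by blast
  qed
  have irrV: "irr V" by (rule irreducible_set_irr[OF ir])
  have irrY: "irr Y" using irrV VY unfolding irr_def vY by blast
  obtain L where L: "finite L" "card L \<le> s" "\<And>l x y. l \<in> L \<Longrightarrow> ev (x - y) l = ev x l - ev y l"
    "W = {x \<in> affine_space m. \<forall>l\<in>L. ev x l = 0}"
    by (rule subspace_equations[OF W]) blast
  define A where "A = (\<lambda>w. v + w) ` W"
  have A: "x \<in> A \<longleftrightarrow> (\<forall>l\<in>L. ev x l = ev v l)" if "x \<in> affine_space m" for x
  proof -
    have "x - v \<in> affine_space m" using that v(1) Vm by (auto simp: affine_space_def)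
    then have "x - v \<in> W \<longleftrightarrow> (\<forall>l\<in>L. ev x l = ev v l)" unfolding L(4) by (auto simp: L(3))
    moreover have "x \<in> A \<longleftrightarrow> x - v \<in> W" unfolding A_def by (auto intro: image_eqI[of _ _ "x - v"])
    ultimately show ?thesis by simp
  qed
  \<comment> \<open>What the localisation has to remove: D contains the points of Y outside V, and
    the second set the finitely many other points of the section.\<close>
  define E where "E = D \<union> (A \<inter> V - {v})"
  have "closedin (zariski m) (A \<inter> V - {v})"
    using v(2) Vm unfolding A_def by (intro algebraic_set_finite) auto
  then have "closedin (zariski m) E" unfolding E_def using XD(2) by (intro closedin_Un)
  moreover have "v \<notin> E" unfolding E_def using v(1) XD(3) by blast
  ultimately obtain g where g: "g \<in> vanishing E" "ev v g \<noteq> 0"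
    using algebraic_separate[of m E v] closedin_zariski_algebraic v(1) Vm by blast
  have gY: "g \<notin> vanishing Y" using g(2) v(1) VY unfolding vanishing_def by blast
  let ?r = "restrict_vars {..<m} :: 'a mpoly \<Rightarrow> 'a mpoly" and ?v = "loc_point m g v"
  let ?H = "(\<lambda>l. ?r l - Const (ev v l)) ` L"
  have Ym: "Y \<subseteq> affine_space m" unfolding Y_def by blast
  have iso: "{x \<in> loc m g Y. \<forall>h\<in>?H. ev x h = 0} = {?v}"
  proof (intro equalityI subsetI)
    fix x assume x: "x \<in> {x \<in> loc m g Y. \<forall>h\<in>?H. ev x h = 0}"
    then obtain x0 where x0: "x0 \<in> Y" "ev x0 g \<noteq> 0" "x = loc_point m g x0" unfolding loc_def by blast
    have xm: "x0 \<in> affine_space m" using x0(1) Ym by blast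
    then have "\<forall>l\<in>L. ev x0 l = ev v l" using x unfolding x0(3) by (auto simp: ev_restrict_loc_point)
    then have "x0 \<in> A" using A[OF xm] by blast
    moreover have "x0 \<notin> E" using g(1) x0(2) unfolding vanishing_def by blast
    moreover have "x0 \<in> X" using x0(1) YX by blast
    ultimately have "x0 = v" unfolding E_def using XD(3) by blast
    then show "x \<in> {?v}" using x0(3) by simp
  next
    fix x assume "x \<in> {?v}"
    moreover have "v \<in> affine_space m" using v(1) Vm by blast
    ultimately show "x \<in> {x \<in> loc m g Y. \<forall>h\<in>?H. ev x h = 0}"
      using v(1) VY g(2) unfolding loc_def by (auto simp: ev_restrict_loc_point)
  qed
  have cH: "finite ?H" "card ?H \<le> s" using L(1,2) card_image_le[OF L(1)] by (auto intro: order_trans)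
  have vl: "?v \<in> loc m g Y" using v(1) VY g(2) unfolding loc_def by blast
  let ?C = "{d. \<exists>Z. (\<forall>i\<le>d. irreducible_closed (subtopology (zariski m) V) (Z i)) \<and> (\<forall>i<d. Z i \<subset> Z (Suc i))}"
  have bound: "d \<le> s" if "d \<in> ?C" for d
  proof -
    obtain Z where Z: "\<And>i. i \<le> d \<Longrightarrow> irreducible_closed (subtopology (zariski m) V) (Z i)"
      "\<And>i. i < d \<Longrightarrow> Z i \<subset> Z (Suc i)" using \<open>d \<in> ?C\<close> by blast
    obtain f where f: "alg_indep (Z d) {..<d} f"
      using chain_alg_indep[of d m V Z] Z by blast
    have "closedin (subtopology (zariski m) V) (Z d)" using Z(1)[of d] unfolding irreducible_closed_def by blast
    then have "Z d \<subseteq> V" using closedin_subset by fastforce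
    then have "alg_indep Y {..<d} f" using f VY unfolding alg_indep_def by (meson subsetD)
    from alg_indep_loc[OF irrY Ym gY this]
    show ?thesis
      using isolated_point_bound[OF algebraic_loc[OF Y] irr_loc[OF irrY gY] vl cH iso, of "{..<d}"] by simp
  qed
  have "irreducible_closed (subtopology (zariski m) V) V"
  proof -
    have "A = V \<or> B = V" if AB: "closedin (subtopology (zariski m) V) A" "closedin (subtopology (zariski m) V) B" "V = A \<union> B" for A B
    proof -
      obtain S T where ST: "closedin (zariski m) S" "A = S \<inter> V" "closedin (zariski m) T" "B = T \<inter> V"
        using AB(1,2) unfolding closedin_subtopology by blast
      have "V \<subseteq> S \<union> T" using AB(3) ST(2,4) by blast
      then have "V \<subseteq> S \<or> V \<subseteq> T" by (rule irreducible_setD[OF ir ST(1,3)])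
      then show ?thesis using ST by blast
    qed
    moreover have "closedin (subtopology (zariski m) V) V"
      using Vm by (metis closedin_topspace inf.absorb_iff2 topspace_subtopology topspace_zariski)
    ultimately show ?thesis using v(1) unfolding irreducible_closed_def by blast
  qed
  \<comment> \<open>The chain consisting of V alone provides the non-emptiness required by
    \<open>cSup_least\<close>.\<close>
  then have "0 \<in> ?C" by (auto intro!: exI[of _ "\<lambda>_. V"])
  then show ?thesis unfolding krull_dim_def using bound by (intro cSup_least) auto
qed

section \<open>Embedding affine space as a hyperplane\<close>

text \<open>Used with c = 0 as the inclusion of K^m into K^(m+1), by \<open>hyper_0\<close>, and
  with c = 0 and c = 1 to place two sets in disjoint hyperplanes.\<close>

definition hyper :: "nat \<Rightarrow> 'a::field \<Rightarrow> (nat \<Rightarrow> 'a) \<Rightarrow> nat \<Rightarrow> 'a" where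
  "hyper m c x = x(m := c)"

lemma hyper_in: "x \<in> affine_space m \<Longrightarrow> hyper m c x \<in> affine_space (Suc m)"
  by (auto simp: hyper_def affine_space_def)

lemma hyper_at: "hyper m c x m = c"
  by (simp add: hyper_def)

lemma inj_on_hyper: "inj_on (hyper m c) (affine_space m)"
proof (rule inj_onI)
  fix x y :: "nat \<Rightarrow> 'a" assume xy: "x \<in> affine_space m" "y \<in> affine_space m" "hyper m c x = hyper m c y"
  show "x = y"
  proof
    fix i show "x i = y i"
      using xy(1,2) fun_cong[OF xy(3), of i] by (cases "i = m") (auto simp: hyper_def affine_space_def)
  qed
qed

lemma hyper_0: "x \<in> affine_space m \<Longrightarrow> hyper m 0 x = x"
  by (auto simp: hyper_def affine_space_def fun_eq_iff)

lemma ev_hyper_restrict: "x \<in> affine_space m \<Longrightarrow> ev (hyper m c x) (restrict_vars {..<m} p) = ev x p"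
proof -
  assume "x \<in> affine_space m"
  then have "(\<lambda>i. if i \<in> {..<m} then hyper m c x i else 0) = x"
    by (fastforce simp: affine_space_def hyper_def)
  then show ?thesis by (simp add: ev_restrict_vars)
qed

text \<open>The image of V is given by the equations of V, written without x_m, and x_m = c; a
  preimage is given by substituting c for x_m.\<close>

lemma closed_emb_hyper: "closed_emb (zariski m) (zariski (Suc m)) (hyper m c)"
  unfolding closed_emb_def
proof (intro conjI allI impI)
  show "inj_on (hyper m c) (topspace (zariski m))" using inj_on_hyper by simp
next
  fix V :: "(nat \<Rightarrow> 'a) set" assume "closedin (zariski m) V"
  then have V: "algebraic_set m V" unfolding closedin_zariski_algebraic .
  then have Vm: "V \<subseteq> affine_space m" unfolding algebraic_set_def by blast
  show "closedin (zariski (Suc m)) (hyper m c ` V)"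
    unfolding closedin_zariski_algebraic algebraic_set_def
  proof (intro equalityI subsetI)
    fix x assume x: "x \<in> {x \<in> affine_space (Suc m). \<forall>p\<in>vanishing (hyper m c ` V). ev x p = 0}"
    define x0 where "x0 = (\<lambda>i. if i \<in> {..<m} then x i else 0)"
    have x0m: "x0 \<in> affine_space m" by (auto simp: x0_def affine_space_def)
    have "ev x0 p = 0" if "p \<in> vanishing V" for p
    proof -
      have "restrict_vars {..<m} p \<in> vanishing (hyper m c ` V)"
        using that Vm by (auto simp: vanishing_def ev_hyper_restrict subset_iff)
      then have "ev x (restrict_vars {..<m} p) = 0" using x by blast
      then show ?thesis by (simp add: ev_restrict_vars x0_def)
    qed
    then have "x0 \<in> V" using V x0m unfolding algebraic_set_def by blast
    moreover have "Var m - Const c \<in> vanishing (hyper m c ` V)" by (auto simp: vanishing_def hyper_def)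
    then have "ev x (Var m - Const c) = 0" using x by blast
    then have "x = hyper m c x0" using x by (auto simp: hyper_def x0_def affine_space_def fun_eq_iff)
    ultimately show "x \<in> hyper m c ` V" by blast
  qed (use Vm hyper_in in \<open>auto simp: vanishing_def\<close>)
next
  fix T :: "(nat \<Rightarrow> 'a) set" assume "closedin (zariski (Suc m)) T"
  then have T: "algebraic_set (Suc m) T" unfolding closedin_zariski_algebraic .
  let ?P = "{x \<in> affine_space m. hyper m c x \<in> T}"
  have s: "ev x (subst_poly (Var(m := Const c)) p) = ev (hyper m c x) p" for x p
  proof -
    have "(\<lambda>j. ev x ((Var(m := Const c)) j)) = hyper m c x" by (auto simp: hyper_def)
    then show ?thesis by (simp only: ev_subst_poly)
  qed
  have "algebraic_set m ?P"
    unfolding algebraic_set_def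
  proof (intro equalityI subsetI)
    fix x assume x: "x \<in> {x \<in> affine_space m. \<forall>p\<in>vanishing ?P. ev x p = 0}"
    have "ev (hyper m c x) p = 0" if "p \<in> vanishing T" for p
    proof -
      have "subst_poly (Var(m := Const c)) p \<in> vanishing ?P" using that unfolding vanishing_def by (auto simp: s)
      then have "ev x (subst_poly (Var(m := Const c)) p) = 0" using x by blast
      then show ?thesis by (simp add: s)
    qed
    then have "hyper m c x \<in> T" using T hyper_in x unfolding algebraic_set_def by blast
    then show "x \<in> ?P" using x by blast
  qed (auto simp: vanishing_def)
  then show "closedin (zariski m) {x \<in> topspace (zariski m). hyper m c x \<in> T}"
    unfolding closedin_zariski_algebraic topspace_zariski .
qed

lemma krull_dim_hyper:
  assumes "V \<subseteq> affine_space m"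
  shows "krull_dim (subtopology (zariski (Suc m)) (hyper m c ` V)) = krull_dim (subtopology (zariski m) V)"
proof (rule closed_emb_krull_dim[OF closed_emb_subtopology[OF closed_emb_hyper]])
  show "V \<subseteq> topspace (zariski m)" using assms by simp
  have "hyper m c ` V \<subseteq> affine_space (Suc m)" using assms hyper_in by blast
  then show "hyper m c ` topspace (subtopology (zariski m) V) = topspace (subtopology (zariski (Suc m)) (hyper m c ` V))"
    using assms by (simp add: Int_absorb1 Int_absorb2)
qed

section \<open>Affine subspaces of consecutive affine spaces\<close>

lemma affine_linear_point:
  assumes "affine_linear n r A" "v \<in> A"
  obtains W where "W \<subseteq> affine_space n" "fun_vs.subspace W" "fun_vs.dim W + r = n" "A = (\<lambda>w. v + w) ` W"
proof -
  obtain a W where W: "W \<subseteq> affine_space n" "fun_vs.subspace W" "fun_vs.dim W + r = n" "A = (\<lambda>w. a + w) ` W"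
    using assms(1) unfolding affine_linear_def by blast
  obtain w0 where w0: "w0 \<in> W" "v = a + w0" using assms(2) W(4) by blast
  have "A = (\<lambda>w. v + w) ` W"
  proof (intro equalityI subsetI)
    fix x assume "x \<in> A"
    then obtain w where w: "w \<in> W" "x = a + w" using W(4) by blast
    then have "w - w0 \<in> W" "x = v + (w - w0)" using w0 fun_vs.subspace_diff[OF W(2)] by auto
    then show "x \<in> (\<lambda>w. v + w) ` W" by blast
  next
    fix x assume "x \<in> (\<lambda>w. v + w) ` W"
    then obtain w where w: "w \<in> W" "x = v + w" by blast
    then have "w0 + w \<in> W" "x = a + (w0 + w)" using w0 fun_vs.subspace_add[OF W(2)] by auto
    then show "x \<in> A" unfolding W(4) by blast
  qed
  with that W show ?thesis by blast
qed

lemma affine_linearI: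
  assumes "v \<in> affine_space n" "W \<subseteq> affine_space n" "fun_vs.subspace W" "fun_vs.dim W + r = n"
  shows "affine_linear n r ((\<lambda>w. v + w) ` W)"
  using assms unfolding affine_linear_def by blast

text \<open>The product of A with a line has the same codimension in the larger space and cuts the
  hyperplane in a copy of A. Hence every cardinality attained for V is attained for its
  image.\<close>

lemma affine_linear_cylinder:
  fixes A V :: "(nat \<Rightarrow> 'a::field) set"
  assumes A: "affine_linear m r A" and V: "V \<subseteq> affine_space m"
  shows "\<exists>A'. affine_linear (Suc m) r A' \<and> A' \<inter> hyper m c ` V = hyper m c ` (A \<inter> V)"
proof -
  obtain a W where W: "a \<in> affine_space m" "W \<subseteq> affine_space m" "fun_vs.subspace W" "fun_vs.dim W + r = m"
    "A = (\<lambda>w. a + w) ` W"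
    using A unfolding affine_linear_def by blast
  define W' where "W' = {x \<in> affine_space (Suc m). x(m := 0) \<in> W}"
  have sub: "fun_vs.subspace W'"
  proof (rule fun_vs.subspaceI)
    show "0 \<in> W'" using fun_vs.subspace_0[OF W(3)] by (auto simp: W'_def affine_space_def fun_upd_def zero_fun_def)
    fix x y assume xy: "x \<in> W'" "y \<in> W'"
    have "(x + y)(m := 0) = x(m := 0) + y(m := 0)" by auto
    then show "x + y \<in> W'"
      using xy fun_vs.subspace_add[OF W(3)] by (auto simp: W'_def affine_space_def)
  next
    fix k x assume x: "x \<in> W'"
    have "(scal k x)(m := 0) = scal k (x(m := 0))" by auto
    moreover have "x(m := 0) \<in> W" using x unfolding W'_def by blast
    from fun_vs.subspace_scale[OF W(3) this, of k] have "scal k (x(m := 0)) \<in> W" .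
    ultimately have "(scal k x)(m := 0) \<in> W" by metis
    moreover have "scal k x \<in> affine_space (Suc m)" using x by (simp add: W'_def affine_space_def)
    ultimately show "scal k x \<in> W'" unfolding W'_def by blast
  qed
  obtain B where B: "B \<subseteq> W" "\<not> fun_vs.dependent B" "fun_vs.span B = W" "finite B" "card B = fun_vs.dim W"
    by (rule subspace_basis[OF W(3,2)])
  have Wm: "w m = 0" if "w \<in> W" for w using that W(2) by (auto simp: affine_space_def)
  let ?e = "unit_vec m :: nat \<Rightarrow> 'a"
  have "?e m \<noteq> 0" by (simp add: unit_vec_def)
  then have i: "\<not> fun_vs.dependent (insert ?e B)" "?e \<notin> B"
    using independent_insert_coord[of B m ?e] B(1,2) Wm by blast+
  have WW': "W \<subseteq> W'"
  proof
    fix w assume "w \<in> W"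
    moreover from this have "w(m := 0) = w" using Wm by auto
    ultimately show "w \<in> W'" using W(2) by (auto simp: W'_def affine_space_def)
  qed
  have "?e(m := 0) = 0" by (auto simp: unit_vec_def)
  then have eW': "?e \<in> W'"
    using fun_vs.subspace_0[OF W(3)] by (simp add: W'_def unit_vec_in)
  have "W' \<subseteq> fun_vs.span (insert ?e B)"
  proof
    fix x assume "x \<in> W'"
    then have "x(m := 0) \<in> fun_vs.span B" using B(3) by (simp add: W'_def)
    then have "x(m := 0) \<in> fun_vs.span (insert ?e B)" using fun_vs.span_mono[of B "insert ?e B"] by blast
    moreover have "scal (x m) ?e \<in> fun_vs.span (insert ?e B)"
      by (intro fun_vs.span_scale fun_vs.span_base) auto
    moreover have "x = x(m := 0) + scal (x m) ?e" by (auto simp: unit_vec_def fun_eq_iff)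
    ultimately show "x \<in> fun_vs.span (insert ?e B)" using fun_vs.span_add by metis
  qed
  then have "fun_vs.dim W' = card (insert ?e B)"
    using B(1) WW' eW' i(1) by (intro fun_vs.dim_unique[of "insert ?e B"]) auto
  then have dim: "fun_vs.dim W' + r = Suc m" using i(2) B(4,5) W(4) by simp
  let ?A' = "(\<lambda>w. a + w) ` W'"
  have "a \<in> affine_space (Suc m)" using W(1) by (auto simp: affine_space_def)
  then have "affine_linear (Suc m) r ?A'"
    using sub dim by (intro affine_linearI) (auto simp: W'_def)
  moreover have "?A' \<inter> hyper m c ` V = hyper m c ` (A \<inter> V)"
  proof (intro equalityI subsetI)
    fix x assume "x \<in> ?A' \<inter> hyper m c ` V"
    then obtain w v where wv: "w \<in> W'" "x = a + w" "v \<in> V" "x = hyper m c v" by blast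
    have "v = a + w(m := 0)"
    proof
      fix i
      have "hyper m c v i = a i + w i" using wv by (metis plus_fun_apply)
      moreover have "v m = 0" "a m = 0" using wv(3) V W(1) by (auto simp: affine_space_def)
      ultimately show "v i = (a + w(m := 0)) i" by (cases "i = m") (auto simp: hyper_def)
    qed
    then have "v \<in> A" using wv(1) unfolding W(5) W'_def by blast
    then show "x \<in> hyper m c ` (A \<inter> V)" using wv by blast
  next
    fix x assume "x \<in> hyper m c ` (A \<inter> V)"
    then obtain v where v: "v \<in> A" "v \<in> V" "x = hyper m c v" by blast
    then obtain w where w: "w \<in> W" "v = a + w" using W(5) by blast
    have "w(m := c) \<in> W'" using w(1) Wm[OF w(1)] W(2) by (auto simp: W'_def affine_space_def fun_upd_idem)
    moreover have "x = a + w(m := c)" using v(3) w(2) W(1) by (auto simp: hyper_def affine_space_def)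
    ultimately show "x \<in> ?A' \<inter> hyper m c ` V" using v by blast
  qed
  ultimately show ?thesis by blast
qed

text \<open>Let W0 be the directions of A inside the hyperplane. \<open>krull_dim_le_codim\<close>
  excludes that all directions of A lie there, so A has a transversal direction and W0 has dimension
  one less than W, which is the codimension wanted.\<close>

lemma affine_linear_hyper_section:
  fixes A V :: "(nat \<Rightarrow> 'a::alg_closed_field) set"
  assumes V: "irreducible_locally_closed (zariski m) V"
    and A: "affine_linear (Suc m) (krull_dim (subtopology (zariski m) V)) A"
    and fin: "finite (A \<inter> hyper m c ` V)" and ne: "A \<inter> hyper m c ` V \<noteq> {}"
  shows "\<exists>A0. affine_linear m (krull_dim (subtopology (zariski m) V)) A0 \<and> A \<inter> hyper m c ` V = hyper m c ` (A0 \<inter> V)"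
proof -
  let ?r = "krull_dim (subtopology (zariski m) V)"
  have Vm: "V \<subseteq> affine_space m"
    using V unfolding irreducible_locally_closed_iff irreducible_set_def by simp
  obtain v where v: "v \<in> V" "hyper m c v \<in> A" using ne by blast
  obtain W where W: "W \<subseteq> affine_space (Suc m)" "fun_vs.subspace W" "fun_vs.dim W + ?r = Suc m"
    "A = (\<lambda>w. hyper m c v + w) ` W"
    by (rule affine_linear_point[OF A v(2)])
  define W0 where "W0 = W \<inter> affine_space m"
  have sub: "fun_vs.subspace W0" unfolding W0_def using W(2) subspace_affine_space by (rule fun_vs.subspace_inter)
  have shift: "hyper m c v + w = hyper m c (v + w)" if "w m = 0" for w
    using that by (auto simp: hyper_def fun_eq_iff)
  have eq: "A \<inter> hyper m c ` V = hyper m c ` ((\<lambda>w. v + w) ` W0 \<inter> V)"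
  proof (intro equalityI subsetI)
    fix x assume "x \<in> A \<inter> hyper m c ` V"
    then obtain w u where w: "w \<in> W" "x = hyper m c v + w" "u \<in> V" "x = hyper m c u" unfolding W(4) by blast
    have "hyper m c v m + w m = hyper m c u m" using w(2,4) by (metis plus_fun_apply)
    then have wm: "w m = 0" by (simp add: hyper_def)
    have "w \<in> affine_space m"
      unfolding affine_space_def
    proof (intro CollectI allI impI)
      fix i assume "m \<le> i"
      then show "w i = 0" using wm w(1) W(1) by (cases "i = m") (auto simp: affine_space_def)
    qed
    then have "v + w \<in> affine_space m" "w \<in> W0" using v(1) Vm w(1) by (auto simp: affine_space_def W0_def)
    moreover have "hyper m c (v + w) = hyper m c u" using w shift[of w] wm by simp
    moreover have "u \<in> affine_space m" using w(3) Vm by blast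
    ultimately have "v + w = u" "w \<in> W0" using inj_on_hyper[of m c] by (auto dest: inj_onD)
    then show "x \<in> hyper m c ` ((\<lambda>w. v + w) ` W0 \<inter> V)" using w by blast
  next
    fix x assume "x \<in> hyper m c ` ((\<lambda>w. v + w) ` W0 \<inter> V)"
    then obtain w where w: "w \<in> W0" "v + w \<in> V" "x = hyper m c (v + w)" by blast
    have "w m = 0" "w \<in> W" using w(1) by (auto simp: W0_def affine_space_def)
    then have "x = hyper m c v + w" using w(3) shift[of w] by simp
    then have "x \<in> A" using \<open>w \<in> W\<close> unfolding W(4) by blast
    then show "x \<in> A \<inter> hyper m c ` V" using w(2,3) by blast
  qed
  have "inj_on (hyper m c) ((\<lambda>w. v + w) ` W0 \<inter> V)"
    by (rule inj_on_subset[OF inj_on_hyper[of m c]]) (use Vm in blast)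
  then have fin0: "finite ((\<lambda>w. v + w) ` W0 \<inter> V)" using fin unfolding eq by (rule finite_imageD[rotated])
  have bound: "?r \<le> s" if "fun_vs.dim W0 + s = m" for s
    using krull_dim_le_codim[OF V sub _ that v(1) fin0] unfolding W0_def by blast
  obtain B where B: "B \<subseteq> W0" "\<not> fun_vs.dependent B" "fun_vs.span B = W0" "finite B" "card B = fun_vs.dim W0"
    by (rule subspace_basis[OF sub]) (auto simp: W0_def)
  have dimm: "fun_vs.dim W0 \<le> m"
    using independent_in_affine_space(2)[OF B(2), of m] B(1,5) unfolding W0_def by auto
  \<comment> \<open>Otherwise W0 = W would have codimension r - 1 in K^m, where r is the dimension
    of V, and the bound would read r \<le> r - 1.\<close>
  have "\<not> W \<subseteq> affine_space m"
  proof
    assume "W \<subseteq> affine_space m"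
    then have "W0 = W" unfolding W0_def by blast
    then have "?r \<le> m - fun_vs.dim W" "fun_vs.dim W \<le> m" using bound[of "m - fun_vs.dim W"] dimm by auto
    then show False using W(3) by linarith
  qed
  then obtain w1 where w1: "w1 \<in> W" "w1 \<notin> affine_space m" by blast
  have w1m: "w1 m \<noteq> 0"
  proof
    assume z: "w1 m = 0"
    have "w1 i = 0" if "m \<le> i" for i
      using that z w1(1) W(1) by (cases "i = m") (auto simp: affine_space_def)
    then show False using w1(2) by (simp add: affine_space_def)
  qed
  have Bm: "b m = 0" if "b \<in> B" for b using that B(1) by (auto simp: W0_def affine_space_def)
  have i: "\<not> fun_vs.dependent (insert w1 B)" "w1 \<notin> B"
    using independent_insert_coord[of B m w1] B(2) Bm w1m by blast+
  have "W \<subseteq> fun_vs.span (insert w1 B)"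
  proof
    fix w assume w: "w \<in> W"
    define k where "k = w m / w1 m"
    define u where "u = w - scal k w1"
    have "u \<in> W" unfolding u_def using w w1(1) fun_vs.subspace_diff[OF W(2)] fun_vs.subspace_scale[OF W(2)] by blast
    moreover have "u m = 0" using w1m by (simp add: u_def k_def)
    then have "u i = 0" if "m \<le> i" for i
      using that \<open>u \<in> W\<close> W(1) by (cases "i = m") (auto simp: affine_space_def)
    then have "u \<in> affine_space m" by (simp add: affine_space_def)
    ultimately have "u \<in> fun_vs.span B" unfolding B(3) W0_def by blast
    then have "u \<in> fun_vs.span (insert w1 B)" using fun_vs.span_mono[of B "insert w1 B"] by blast
    moreover have "scal k w1 \<in> fun_vs.span (insert w1 B)" by (intro fun_vs.span_scale fun_vs.span_base) auto
    moreover have "w = u + scal k w1" unfolding u_def by simp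
    ultimately show "w \<in> fun_vs.span (insert w1 B)" using fun_vs.span_add by metis
  qed
  then have "fun_vs.dim W = card (insert w1 B)"
    using B(1) w1(1) i(1) by (intro fun_vs.dim_unique[of "insert w1 B"]) (auto simp: W0_def)
  then have "fun_vs.dim W0 + ?r = m" using i(2) B(4,5) W(3) by simp
  moreover have "v \<in> affine_space m" using v(1) Vm by blast
  ultimately have "affine_linear m ?r ((\<lambda>w. v + w) ` W0)"
    using sub by (intro affine_linearI) (auto simp: W0_def)
  then show ?thesis using eq by blast
qed

text \<open>Both sides are the same unspecified value \<open>Max\<close> of an infinite set should the cardinalities be
  unbounded, so their boundedness need not be established.\<close>

lemma deg_irreducible_hyper_le:
  fixes V :: "(nat \<Rightarrow> 'a::alg_closed_field) set"
  assumes V: "irreducible_locally_closed (zariski m) V"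
  shows "deg_irreducible (Suc m) (hyper m c ` V) \<le> deg_irreducible m V"
proof -
  let ?r = "krull_dim (subtopology (zariski m) V)"
  have Vm: "V \<subseteq> affine_space m"
    using V unfolding irreducible_locally_closed_iff irreducible_set_def by simp
  define S where "S = {card (A \<inter> V) | A. affine_linear m ?r A \<and> finite (A \<inter> V)}"
  define S' where "S' = {card (A \<inter> hyper m c ` V) | A. affine_linear (Suc m) ?r A \<and> finite (A \<inter> hyper m c ` V)}"
  have inj: "inj_on (hyper m c) (A \<inter> V)" for A
    by (rule inj_on_subset[OF inj_on_hyper[of m c]]) (use Vm in blast)
  have SS': "S \<subseteq> S'"
  proof
    fix k assume "k \<in> S"
    then obtain A where A: "k = card (A \<inter> V)" "affine_linear m ?r A" "finite (A \<inter> V)" unfolding S_def by blast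
    obtain A' where A': "affine_linear (Suc m) ?r A'" "A' \<inter> hyper m c ` V = hyper m c ` (A \<inter> V)"
      using affine_linear_cylinder[OF A(2) Vm] by blast
    have "k = card (A' \<inter> hyper m c ` V)" "finite (A' \<inter> hyper m c ` V)"
      unfolding A'(2) A(1) using A(3) by (auto simp: card_image[OF inj])
    then show "k \<in> S'" unfolding S'_def using A'(1) by blast
  qed
  \<comment> \<open>The value 0 stands for the affine subspaces that miss the embedded set.\<close>
  have S'S: "S' \<subseteq> insert 0 S"
  proof
    fix k assume "k \<in> S'"
    then obtain A where A: "k = card (A \<inter> hyper m c ` V)" "affine_linear (Suc m) ?r A" "finite (A \<inter> hyper m c ` V)"
      unfolding S'_def by blast
    show "k \<in> insert 0 S"
    proof (cases "A \<inter> hyper m c ` V = {}")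
      case True
      then show ?thesis using A(1) by simp
    next
      case False
      obtain A0 where A0: "affine_linear m ?r A0" "A \<inter> hyper m c ` V = hyper m c ` (A0 \<inter> V)"
        using affine_linear_hyper_section[OF V A(2,3) False] by blast
      have "finite (A0 \<inter> V)" using A(3) inj unfolding A0(2) by (rule finite_imageD)
      moreover have "k = card (A0 \<inter> V)" unfolding A(1) A0(2) by (rule card_image[OF inj])
      ultimately show ?thesis unfolding S_def using A0(1) by blast
    qed
  qed
  have "Max S' \<le> Max S"
  proof (cases "finite S")
    case False
    then have "infinite S'" using SS' finite_subset by blast
    then show ?thesis using False by (simp add: Max.infinite)
  next
    case True
    then have fin: "finite S'" using S'S finite_subset by blast
    show ?thesis
    proof (cases "S' = {}")
      case True
      \<comment> \<open>Then \<open>S\<close> is empty too, and both sides are the same unspecified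
        \<open>Max {}\<close>.\<close>
      then show ?thesis using SS' by simp
    next
      case False
      then have "Max S' \<in> insert 0 S" using Max_in[OF fin] S'S by blast
      then show ?thesis using \<open>finite S\<close> by auto
    qed
  qed
  then show ?thesis unfolding deg_irreducible_def krull_dim_hyper[OF Vm] S_def S'_def .
qed

section \<open>Degrees in larger affine spaces\<close>

lemma deg_hyper_le:
  fixes W :: "(nat \<Rightarrow> 'a::alg_closed_field) set"
  assumes W: "W \<subseteq> affine_space m"
  shows "deg (Suc m) (hyper m c ` W) \<le> deg m W"
proof -
  let ?C = "irreducible_components (zariski m) W"
  have sub: "Z \<subseteq> affine_space m" if "Z \<in> ?C" for Z using irreducible_componentsD(2)[OF that] W by blast
  have "inj_on ((`) (hyper m c)) ?C"
  proof (rule inj_onI)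
    fix Y Z assume "Y \<in> ?C" "Z \<in> ?C" "hyper m c ` Y = hyper m c ` Z"
    then show "Y = Z" using inj_on_image_eq_iff[OF inj_on_hyper[of m c] sub sub] by blast
  qed
  then have "deg (Suc m) (hyper m c ` W) = (\<Sum>Z\<in>?C. deg_irreducible (Suc m) (hyper m c ` Z))"
    unfolding deg_def closed_emb_irreducible_components[OF closed_emb_hyper W[folded topspace_zariski]]
    by (subst sum.reindex) auto
  also have "\<dots> \<le> deg m W"
    unfolding deg_def using irreducible_componentsD(1) by (intro sum_mono deg_irreducible_hyper_le) blast
  finally show ?thesis .
qed

lemma locally_closed_hyper:
  assumes "locally_closed (zariski m) V"
  shows "locally_closed (zariski (Suc m)) (hyper m c ` V)"
proof -
  have "V \<subseteq> topspace (zariski m)" using assms closedin_subset unfolding locally_closed_def by blast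
  then show ?thesis using closed_emb_locally_closed[OF closed_emb_hyper] assms by blast
qed

lemma locally_closed_zariski_subset: "locally_closed (zariski m) V \<Longrightarrow> V \<subseteq> affine_space m"
  using closedin_subset unfolding locally_closed_def by fastforce

text \<open>In the chosen encoding K^m is a subset of K^M, so the set V does not change:
  \<open>hyper k 0\<close> is the identity on it.\<close>

lemma locally_closed_raise:
  fixes V :: "(nat \<Rightarrow> 'a::alg_closed_field) set"
  assumes "locally_closed (zariski m) V" "m \<le> M"
  shows "locally_closed (zariski M) V \<and> deg M V \<le> deg m V"
  using assms(2)
proof (induction rule: dec_induct)
  case (step k)
  then have lc: "locally_closed (zariski k) V" by blast
  have eq: "hyper k 0 ` V = V" using hyper_0 locally_closed_zariski_subset[OF lc] by (force simp: subset_iff)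
  have "locally_closed (zariski (Suc k)) V" using locally_closed_hyper[OF lc, of 0] unfolding eq .
  moreover have "deg (Suc k) V \<le> deg k V" using deg_hyper_le[OF locally_closed_zariski_subset[OF lc], of 0] unfolding eq .
  ultimately show ?case using step by linarith
qed (use assms(1) in simp)

section \<open>Projections of locally closed sets\<close>

lemma canonical_proj_hyper: "n \<le> m \<Longrightarrow> canonical_proj n ` hyper m c ` V = canonical_proj n ` V"
  by (auto simp: canonical_proj_def hyper_def image_image intro!: image_cong)

text \<open>A union of two locally closed sets need not be locally closed. Here disjoint closed sets
  separate them, and the two differences of closed sets can be combined after intersecting with the
  separating sets.\<close>

lemma locally_closed_Un:
  assumes "locally_closed T V" "locally_closed T V'" "closedin T S" "closedin T S'" "V \<subseteq> S" "V' \<subseteq> S'" "S \<inter> S' = {}"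
  shows "locally_closed T (V \<union> V')"
proof -
  obtain C D where C: "closedin T C" "closedin T D" "V = C - D"
    using assms(1) unfolding locally_closed_iff by blast
  obtain C' D' where C': "closedin T C'" "closedin T D'" "V' = C' - D'"
    using assms(2) unfolding locally_closed_iff by blast
  have "V \<union> V' = ((C \<inter> S) \<union> (C' \<inter> S')) - ((D \<inter> S) \<union> (D' \<inter> S'))"
    unfolding C(3) C'(3) using assms(5-7)[unfolded C(3) C'(3)] by blast
  moreover have "closedin T ((C \<inter> S) \<union> (C' \<inter> S'))" "closedin T ((D \<inter> S) \<union> (D' \<inter> S'))"
    by (intro closedin_Un closedin_Int C C' assms)+
  ultimately show ?thesis unfolding locally_closed_iff by blast
qed

lemma disjoint_union_projection:
  fixes V V' :: "(nat \<Rightarrow> 'a::alg_closed_field) set"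
  assumes V: "locally_closed (zariski m) V" "n \<le> m" and V': "locally_closed (zariski m') V'" "n \<le> m'"
  shows "\<exists>M U. n \<le> M \<and> locally_closed (zariski M) U \<and>
    canonical_proj n ` U = canonical_proj n ` V \<union> canonical_proj n ` V' \<and> deg M U \<le> deg m V + deg m' V'"
proof -
  let ?m = "max m m'"
  have r: "locally_closed (zariski ?m) V" "deg ?m V \<le> deg m V" "locally_closed (zariski ?m) V'" "deg ?m V' \<le> deg m' V'"
    using locally_closed_raise[OF V(1), of ?m] locally_closed_raise[OF V'(1), of ?m] by auto
  let ?V = "hyper ?m 0 ` V" and ?V' = "hyper ?m 1 ` V'"
  define T where "T c = {x \<in> affine_space (Suc ?m). ev x (Var ?m - Const c) = 0}" for c :: 'a
  have T: "closedin (zariski (Suc ?m)) (T c)" for c unfolding T_def by (rule closedin_zariski_zero)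
  have "hyper ?m c ` Z \<subseteq> T c" if "locally_closed (zariski ?m) Z" for c Z
    using locally_closed_zariski_subset[OF that] hyper_in[of _ ?m c] by (auto simp: T_def hyper_at)
  then have VT: "?V \<subseteq> T 0" "?V' \<subseteq> T 1" using r by blast+
  have dis: "T 0 \<inter> T 1 = {}" by (auto simp: T_def)
  have TV: "?V = (?V \<union> ?V') \<inter> T 0" "?V' = (?V \<union> ?V') \<inter> T 1" using VT dis by blast+
  have lc: "locally_closed (zariski (Suc ?m)) ?V" "locally_closed (zariski (Suc ?m)) ?V'"
    using r by (auto intro: locally_closed_hyper)
  have "locally_closed (zariski (Suc ?m)) (?V \<union> ?V')"
    by (rule locally_closed_Un[OF lc T T VT dis])
  moreover have "deg (Suc ?m) (?V \<union> ?V') \<le> deg (Suc ?m) ?V + deg (Suc ?m) ?V'"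
    by (rule deg_union_le[OF lc irreducible_components_union[OF T T TV]])
  then have "deg (Suc ?m) (?V \<union> ?V') \<le> deg m V + deg m' V'"
    using deg_hyper_le[OF locally_closed_zariski_subset[OF r(1)], of 0]
      deg_hyper_le[OF locally_closed_zariski_subset[OF r(3)], of 1] r by linarith
  moreover have "canonical_proj n ` (?V \<union> ?V') = canonical_proj n ` V \<union> canonical_proj n ` V'"
    unfolding image_Un using V(2) by (subst (1 2) canonical_proj_hyper) auto
  moreover have "n \<le> Suc ?m" using V(2) by simp
  ultimately show ?thesis by blast
qed

text \<open>Shows that the minimum in \<open>deg_pi\<close> is taken over a non-empty set. The
  finitely many pieces are added one at a time as disjoint unions in spaces of growing
  dimension.\<close>

lemma constructible_projection:
  fixes C :: "(nat \<Rightarrow> 'a::alg_closed_field) set"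
  assumes "constructible (zariski n) C"
  shows "\<exists>m V. n \<le> m \<and> locally_closed (zariski m) V \<and> canonical_proj n ` V = C"
proof -
  obtain F where F: "finite F" "\<forall>S\<in>F. locally_closed (zariski n) S" "C = \<Union>F"
    using assms unfolding constructible_def by blast
  have "\<exists>m V. n \<le> m \<and> locally_closed (zariski m) V \<and> canonical_proj n ` V = \<Union>F"
    using F(1,2)
  proof (induction F rule: finite_induct)
    case empty
    have "locally_closed (zariski n) {}" by (intro closedin_imp_locally_closed) simp
    then show ?case by (intro exI[of _ n] exI[of _ "{}"]) simp
  next
    case (insert S F)
    then obtain m V where V: "n \<le> m" "locally_closed (zariski m) V" "canonical_proj n ` V = \<Union>F" by blast
    have S: "locally_closed (zariski n) S" using insert by blast
    have "canonical_proj n x = x" if "x \<in> S" for x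
      using locally_closed_zariski_subset[OF S] that by (auto simp: canonical_proj_def affine_space_def fun_eq_iff)
    then have "canonical_proj n ` S = S" by force
    then show ?case using disjoint_union_projection[OF S order_refl V(2,1)] V(3) by auto
  qed
  then show ?thesis using F(3) by simp
qed

lemma deg_pi_attained:
  fixes C :: "(nat \<Rightarrow> 'a::alg_closed_field) set"
  assumes "constructible (zariski n) C"
  shows "\<exists>m V. n \<le> m \<and> locally_closed (zariski m) V \<and> canonical_proj n ` V = C \<and> deg_pi n C = deg m V"
  unfolding deg_pi_def by (rule LeastI_ex) (use constructible_projection[OF assms] in blast)

lemma deg_pi_Un_le:
  fixes C C' :: "(nat \<Rightarrow> 'a::alg_closed_field) set"
  assumes "constructible (zariski n) C" "constructible (zariski n) C'"
  shows "deg_pi n (C \<union> C') \<le> deg_pi n C + deg_pi n C'"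
proof -
  obtain m V where V: "n \<le> m" "locally_closed (zariski m) V" "canonical_proj n ` V = C" "deg_pi n C = deg m V"
    using deg_pi_attained[OF assms(1)] by blast
  obtain m' V' where V': "n \<le> m'" "locally_closed (zariski m') V'" "canonical_proj n ` V' = C'" "deg_pi n C' = deg m' V'"
    using deg_pi_attained[OF assms(2)] by blast
  obtain M U where U: "n \<le> M" "locally_closed (zariski M) U" "canonical_proj n ` U = C \<union> C'" "deg M U \<le> deg m V + deg m' V'"
    using disjoint_union_projection[OF V(2,1) V'(2,1)] V(3) V'(3) by auto
  have "deg_pi n (C \<union> C') \<le> deg M U" unfolding deg_pi_def using U(1-3) by (intro Least_le) blast
  then show ?thesis using U(4) V(4) V'(4) by linarith
qed

theorem proposition2p16:
  fixes C C' :: "(nat \<Rightarrow> 'a::alg_closed_field) set" and n :: nat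
  assumes "constructible (zariski n) C" and "constructible (zariski n) C'"
  shows "deg_z n (C \<union> C') \<le> deg_z n C + deg_z n C'
    \<and> deg_pi n (C \<union> C') \<le> deg_pi n C + deg_pi n C'
    \<and> deg_lci n (C \<union> C') \<le> deg_lci n C + deg_lci n C'"
  using deg_z_Un_le deg_pi_Un_le[OF assms] deg_lci_Un_le[OF assms] by blast

end
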